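(* Let $\varphi:\mathbb{Z}\to\Bbbk$ be a non-zero exponential-polynomial function, let $r=\deg\varphi$ be its degree, and suppose that $$\varphi=\wp_r\cdot\sum_i a_i\,\mathrm{EXP}(\lambda_i)$$ for a finite collection of polynomial functions $a_i:\mathbb{Z}\to\Bbbk$ and distinct scalars $\lambda_i\in\Bbbk^\times$ such that $(\lambda_i/\lambda_j)^r=1$ implies $i=j$. Let $$P_\varphi(Z)=\frac{\prod_{a_i\in\mathbb{Z}_+}(1-Z^{a_i+1})}{(1-Z)^M},\qquad M=\sum_i(\deg a_i+1),$$ where the product is over those indices $i$ for which $a_i$ is a constant function with value in $\mathbb{Z}_+$. Then the character of the irreducible $\tilde{\mathfrak g}$-module $\mathbf{N}(\varphi)$ is $$\mathrm{char}\,\mathbf{N}(\varphi)=Z^{\varphi(0)\frac{\alpha}{2}}\cdot\frac1r\sum_{n\in\mathbb{Z}}\ \sum_{d\mid r}c_d(n)\left(P_\varphi(Z^{-d\alpha})\right)^{\frac rd}Z^{n\delta},$$ where the inner sum is over the positive divisors $d$ of $r$, and $c_d(n)$ denotes the Ramanujan sum.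
   Context: $\Bbbk$ is an algebraically closed field of characteristic zero; $\mathbb{Z}_+$ is the set of non-negative integers; $\mathcal A=\Bbbk[t,t^{-1}]$. Functions. For $\lambda\in\Bbbk^\times$, $\mathrm{EXP}(\lambda):\mathbb{Z}\to\Bbbk$ is $m\mapsto\lambda^m$. A function $\mathbb{Z}\to\Bbbk$ is exponential polynomial if it is a finite sum of products of polynomial functions and functions $\mathrm{EXP}(\lambda)$. For $r\ge1$, $\wp_r=\sum_{\zeta^r=1}\mathrm{EXP}(\zeta)$, the sum being over all $\zeta\in\Bbbk$ with $\zeta^r=1$. For a non-zero exponential-polynomial function $\varphi$, the additive submonoid of $\mathbb{Z}$ generated by the support of $\varphi$ equals $r\mathbb{Z}$ for a unique positive integer $r$; this $r$ is the degree $\deg\varphi$. For a polynomial function $a_i$, $\deg a_i$ is its polynomial degree, with every constant function (including zero) having degree $0$. Lie algebras. $\mathfrak g=\mathfrak{sl}(2)$ over $\Bbbk$ has basis $e,f,h$ with $[e,f]=h$, $[h,e]=2e$, $[h,f]=-2f$; $\mathfrak h=\Bbbk h$. The loop algebra is $\hat{\mathfrak g}=\mathfrak g\otimes\mathcal A$ with $[x\otimes t^i,y\otimes t^j]=[x,y]\otimes t^{i+j}$; put $\hat{\mathfrak g}_+=\Bbbk e\otimes\mathcal A$ and $\hat{\mathfrak h}=\mathfrak h\otimes\mathcal A$. The Lie algebra $\tilde{\mathfrak g}=\hat{\mathfrak g}\oplus\Bbbk\mathrm d$ is the extension by $[\mathrm d,x\otimes t^n]=n\,x\otimes t^n$. Put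 $\tilde{\mathfrak h}=\mathfrak h\oplus\Bbbk\mathrm d$ and $\mathfrak t=\hat{\mathfrak h}\oplus\Bbbk\mathrm d$. The functionals $\alpha,\delta\in\tilde{\mathfrak h}^*$ are given by $\alpha(h)=2$, $\alpha(\mathrm d)=0$, $\delta(h)=0$, $\delta(\mathrm d)=1$. The module $\mathbf N(\varphi)$. $\mathcal A$ is a $\mathfrak t$-module via $(h\otimes t^m)\cdot t^n=\varphi(m)t^{m+n}$, $\mathrm d\cdot t^n=nt^n$; $\mathbf H(\varphi)$ is the $\mathfrak t$-submodule generated by $1$. Let $\hat{\mathfrak g}_+$ act by zero on $\mathbf H(\varphi)$. Then $\mathbf N(\varphi)$ is the unique irreducible quotient of the induced $\tilde{\mathfrak g}$-module $\mathrm{Ind}_{\mathfrak t+\hat{\mathfrak g}_+}^{\tilde{\mathfrak g}}\mathbf H(\varphi)$. Characters. For a weight $\tilde{\mathfrak g}$-module $N=\bigoplus_{\chi\in\tilde{\mathfrak h}^*}N_\chi$ (with $\tilde{\mathfrak h}$ acting on $N_\chi$ by $\chi$) with finite-dimensional weight spaces, $\mathrm{char}\,N=\sum_\chi\dim N_\chi\,Z^\chi$, a formal sum with $Z^\chi Z^{\chi'}=Z^{\chi+\chi'}$. The expression $P_\varphi(Z^{-d\alpha})$ is expanded as a power series in $Z^{-\alpha}$. Ramanujan sum: $c_d(n)=\dfrac{\phi(d)\mu(d')}{\phi(d')}$ with $d'=d/\gcd(d,n)$, where $\phi$ is Euler's totient function and $\mu$ the Möbius function; equivalently $c_d(n)$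 is the sum of $\zeta^n$ over the primitive $d$-th roots of unity $\zeta$. *)

theory Defs
  imports
    "Jordan_Normal_Form.VS_Connect"
    "HOL-Algebra.AbelCoset"
    "HOL-Library.Poly_Mapping"
    "HOL-Library.Product_Plus"
    "HOL-Computational_Algebra.Computational_Algebra"
    "HOL-Number_Theory.Totient"
begin

hide_const (open) Multiset.mult Polynomial.smult Modules.module Real_Vector_Spaces.subspace

section \<open>Exponential-polynomial functions\<close>

definition EXP :: "'k::field \<Rightarrow> int \<Rightarrow> 'k" where
  "EXP c = (\<lambda>m. c powi m)"

text \<open>A polynomial function on the integers is \<open>\<lambda>m. poly p (of_int m)\<close>; in characteristic
  zero it determines the polynomial \<open>p\<close>.\<close>

definition exponential_polynomial :: "(int \<Rightarrow> 'k::field) \<Rightarrow> bool" where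
  "exponential_polynomial \<phi> \<longleftrightarrow>
     (\<exists>(n::nat) p c. (\<forall>i<n. c i \<noteq> 0) \<and>
        \<phi> = (\<lambda>m. \<Sum>i<n. poly (p i) (of_int m) * EXP (c i) m))"

definition wp :: "nat \<Rightarrow> int \<Rightarrow> 'k::field" where
  "wp r = (\<lambda>m. \<Sum>\<zeta> | \<zeta> ^ r = 1. EXP \<zeta> m)"

inductive_set add_submonoid :: "int set \<Rightarrow> int set" for X where
  zero: "0 \<in> add_submonoid X"
| base: "x \<in> X \<Longrightarrow> x \<in> add_submonoid X"
| add: "x \<in> add_submonoid X \<Longrightarrow> y \<in> add_submonoid X \<Longrightarrow> x + y \<in> add_submonoid X"

definition expoly_degree :: "(int \<Rightarrow> 'k::field) \<Rightarrow> nat" where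
  "expoly_degree \<phi> =
     (THE r. r > 0 \<and> add_submonoid {m. \<phi> m \<noteq> 0} = {int r * k | k. True})"


section \<open>The Lie algebra\<close>

text \<open>The basis vectors \<open>e \<otimes> t\<^sup>m\<close>, \<open>f \<otimes> t\<^sup>m\<close>, \<open>h \<otimes> t\<^sup>m\<close> and \<open>d\<close>.\<close>

datatype gen = gen_e int | gen_f int | gen_h int | gen_d

type_synonym 'k gtilde = "gen \<Rightarrow>\<^sub>0 'k"

type_synonym 'k laurent = "int \<Rightarrow>\<^sub>0 'k"

definition pscale :: "'k::field \<Rightarrow> ('x \<Rightarrow>\<^sub>0 'k) \<Rightarrow> ('x \<Rightarrow>\<^sub>0 'k)" where
  "pscale c p = Poly_Mapping.map ((*) c) p"

fun gen_bracket :: "gen \<Rightarrow> gen \<Rightarrow> 'k::field gtilde" where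
  "gen_bracket (gen_e m) (gen_f n) = Poly_Mapping.single (gen_h (m + n)) 1"
| "gen_bracket (gen_f m) (gen_e n) = Poly_Mapping.single (gen_h (m + n)) (- 1)"
| "gen_bracket (gen_h m) (gen_e n) = Poly_Mapping.single (gen_e (m + n)) 2"
| "gen_bracket (gen_e m) (gen_h n) = Poly_Mapping.single (gen_e (m + n)) (- 2)"
| "gen_bracket (gen_h m) (gen_f n) = Poly_Mapping.single (gen_f (m + n)) (- 2)"
| "gen_bracket (gen_f m) (gen_h n) = Poly_Mapping.single (gen_f (m + n)) 2"
| "gen_bracket gen_d (gen_e n) = Poly_Mapping.single (gen_e n) (of_int n)"
| "gen_bracket gen_d (gen_f n) = Poly_Mapping.single (gen_f n) (of_int n)"
| "gen_bracket gen_d (gen_h n) = Poly_Mapping.single (gen_h n) (of_int n)"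
| "gen_bracket (gen_e n) gen_d = Poly_Mapping.single (gen_e n) (- of_int n)"
| "gen_bracket (gen_f n) gen_d = Poly_Mapping.single (gen_f n) (- of_int n)"
| "gen_bracket (gen_h n) gen_d = Poly_Mapping.single (gen_h n) (- of_int n)"
| "gen_bracket _ _ = 0"

definition bracket :: "'k::field gtilde \<Rightarrow> 'k gtilde \<Rightarrow> 'k gtilde" where
  "bracket x y =
     (\<Sum>a\<in>Poly_Mapping.keys x. \<Sum>b\<in>Poly_Mapping.keys y.
        pscale (Poly_Mapping.lookup x a * Poly_Mapping.lookup y b) (gen_bracket a b))"

definition t_sub :: "'k::field gtilde set" where
  "t_sub = {x. Poly_Mapping.keys x \<subseteq> range gen_h \<union> {gen_d}}"

definition parabolic :: "'k::field gtilde set" where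
  "parabolic = {x. Poly_Mapping.keys x \<subseteq> range gen_e \<union> range gen_h \<union> {gen_d}}"


section \<open>Modules\<close>

text \<open>Vector spaces over \<open>'k\<close> are modules over \<open>class_ring\<close>; the fields \<open>mult\<close> and \<open>one\<close>
  inherited from the ring record play no role and are left undefined.\<close>

record ('g, 'k, 'v) lmodule = "('k, 'v) module" +
  act :: "'g \<Rightarrow> 'v \<Rightarrow> 'v"

definition stable_submodule ::
    "'g set \<Rightarrow> ('g, 'k::field, 'v) lmodule \<Rightarrow> 'v set \<Rightarrow> bool" where
  "stable_submodule S M W \<longleftrightarrow>
     submodule class_ring W M \<and> (\<forall>x\<in>S. \<forall>w\<in>W. act M x w \<in> W)"

definition generated_submodule ::
    "'g set \<Rightarrow> ('g, 'k::field, 'v) lmodule \<Rightarrow> 'v set \<Rightarrow> 'v set" where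
  "generated_submodule S M X = \<Inter> {W. stable_submodule S M W \<and> X \<subseteq> W}"

definition quotient_module ::
    "('g, 'k, 'v) lmodule \<Rightarrow> 'v set \<Rightarrow> ('g, 'k, 'v set) lmodule" where
  "quotient_module M W =
     \<lparr>carrier = A_RCOSETS M W, mult = undefined, one = undefined,
      zero = W, add = set_add M,
      smult = (\<lambda>c A. set_add M (smult M c ` A) W),
      act = (\<lambda>x A. set_add M (act M x ` A) W)\<rparr>"

definition irreducible_module :: "('g, 'k::field, 'v) lmodule \<Rightarrow> bool" where
  "irreducible_module M \<longleftrightarrow> carrier M \<noteq> {\<zero>\<^bsub>M\<^esub>} \<and>
     (\<forall>W. stable_submodule UNIV M W \<longrightarrow> W = {\<zero>\<^bsub>M\<^esub>} \<or> W = carrier M)"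


section \<open>The module N\<close>

text \<open>The action on Laurent polynomials is only ever restricted to \<open>t_sub\<close> and \<open>parabolic\<close>,
  so the value on \<open>gen_f\<close> is immaterial; \<open>gen_e\<close> acts by zero.\<close>

fun gen_laurent_act :: "(int \<Rightarrow> 'k::field) \<Rightarrow> gen \<Rightarrow> int \<Rightarrow> 'k laurent" where
  "gen_laurent_act \<phi> (gen_h m) n = Poly_Mapping.single (m + n) (\<phi> m)"
| "gen_laurent_act \<phi> gen_d n = Poly_Mapping.single n (of_int n)"
| "gen_laurent_act \<phi> (gen_e m) n = 0"
| "gen_laurent_act \<phi> (gen_f m) n = 0"

definition laurent_module :: "(int \<Rightarrow> 'k::field) \<Rightarrow> ('k gtilde, 'k, 'k laurent) lmodule" where
  "laurent_module \<phi> =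
     \<lparr>carrier = UNIV, mult = undefined, one = undefined, zero = 0, add = (+), smult = pscale,
      act = (\<lambda>x p. \<Sum>a\<in>Poly_Mapping.keys x. \<Sum>n\<in>Poly_Mapping.keys p.
        pscale (Poly_Mapping.lookup x a * Poly_Mapping.lookup p n) (gen_laurent_act \<phi> a n))\<rparr>"

text \<open>Here \<open>1\<close> is the unit \<open>t\<^sup>0\<close> of the Laurent polynomial ring.\<close>

definition H_module :: "(int \<Rightarrow> 'k::field) \<Rightarrow> ('k gtilde, 'k, 'k laurent) lmodule" where
  "H_module \<phi> = (laurent_module \<phi>)
     \<lparr>carrier := generated_submodule t_sub (laurent_module \<phi>) {1}\<rparr>"

text \<open>The tensor algebra of the Lie algebra has the words in \<open>gen\<close> as a basis. Its tensor
  product with \<open>H_module \<phi>\<close> consists of the finitely supported functions from words to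
  \<open>H_module \<phi>\<close>, where \<open>w \<otimes> v\<close> is \<open>Poly_Mapping.single w v\<close>. It is acted on by left
  multiplication, which is not yet an action of the Lie algebra.\<close>

definition left_mult ::
    "'k::field gtilde \<Rightarrow> (gen list \<Rightarrow>\<^sub>0 'k laurent) \<Rightarrow> (gen list \<Rightarrow>\<^sub>0 'k laurent)" where
  "left_mult x u =
     (\<Sum>a\<in>Poly_Mapping.keys x. \<Sum>w\<in>Poly_Mapping.keys u.
        Poly_Mapping.single (a # w) (pscale (Poly_Mapping.lookup x a) (Poly_Mapping.lookup u w)))"

definition tensor_module ::
    "(int \<Rightarrow> 'k::field) \<Rightarrow> ('k gtilde, 'k, gen list \<Rightarrow>\<^sub>0 'k laurent) lmodule" where
  "tensor_module \<phi> =
     \<lparr>carrier = {u. \<forall>w. Poly_Mapping.lookup u w \<in> carrier (H_module \<phi>)},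
      mult = undefined, one = undefined, zero = 0, add = (+),
      smult = (\<lambda>c. Poly_Mapping.map (pscale c)), act = left_mult\<rparr>"

text \<open>Dividing \<open>T \<otimes> H\<close>, where \<open>T\<close> is the tensor algebra, by the left submodule generated by the
  first family of relations gives \<open>U \<otimes> H\<close> with \<open>U\<close> the universal enveloping algebra; the second
  family makes the tensor product balanced over the enveloping algebra of \<open>parabolic\<close>.
  The quotient is the induced module.\<close>

definition induction_relations ::
    "(int \<Rightarrow> 'k::field) \<Rightarrow> (gen list \<Rightarrow>\<^sub>0 'k laurent) set" where
  "induction_relations \<phi> =
     {left_mult x (left_mult y u) - left_mult y (left_mult x u) - left_mult (bracket x y) u
        | x y u. u \<in> carrier (tensor_module \<phi>)} \<union>
     {left_mult x (Poly_Mapping.single [] v) - Poly_Mapping.single [] (act (H_module \<phi>) x v)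
        | x v. x \<in> parabolic \<and> v \<in> carrier (H_module \<phi>)}"

definition Ind_module ::
    "(int \<Rightarrow> 'k::field) \<Rightarrow> ('k gtilde, 'k, (gen list \<Rightarrow>\<^sub>0 'k laurent) set) lmodule" where
  "Ind_module \<phi> = quotient_module (tensor_module \<phi>)
     (generated_submodule UNIV (tensor_module \<phi>) (induction_relations \<phi>))"

definition N_module ::
    "(int \<Rightarrow> 'k::field) \<Rightarrow> ('k gtilde, 'k, (gen list \<Rightarrow>\<^sub>0 'k laurent) set set) lmodule" where
  "N_module \<phi> = quotient_module (Ind_module \<phi>)
     (THE W. stable_submodule UNIV (Ind_module \<phi>) W \<and>
        irreducible_module (quotient_module (Ind_module \<phi>) W))"


section \<open>Characters\<close>

text \<open>A functional \<open>\<chi>\<close> on the span of \<open>h\<close> and \<open>d\<close> is given by the pair \<open>(\<chi>(h), \<chi>(d))\<close>;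
  the element \<open>h\<close> is the basis vector \<open>gen_h 0\<close>.\<close>

type_synonym 'k weight = "'k \<times> 'k"

definition \<alpha>_wt :: "'k::field weight" where "\<alpha>_wt = (2, 0)"

definition \<delta>_wt :: "'k::field weight" where "\<delta>_wt = (0, 1)"

definition wscale :: "'k::field \<Rightarrow> 'k weight \<Rightarrow> 'k weight" where
  "wscale c \<chi> = (c * fst \<chi>, c * snd \<chi>)"

definition weight_space ::
    "('k::field gtilde, 'k, 'v) lmodule \<Rightarrow> 'k weight \<Rightarrow> 'v set" where
  "weight_space N \<chi> = {v \<in> carrier N.
     act N (Poly_Mapping.single (gen_h 0) 1) v = fst \<chi> \<odot>\<^bsub>N\<^esub> v \<and>
     act N (Poly_Mapping.single gen_d 1) v = snd \<chi> \<odot>\<^bsub>N\<^esub> v}"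

definition weight_module :: "('k::field gtilde, 'k, 'v) lmodule \<Rightarrow> bool" where
  "weight_module N \<longleftrightarrow>
     (\<forall>v\<in>carrier N. \<exists>!f. (\<forall>\<chi>. f \<chi> \<in> weight_space N \<chi>) \<and> finite {\<chi>. f \<chi> \<noteq> \<zero>\<^bsub>N\<^esub>} \<and>
        v = finsum N f {\<chi>. f \<chi> \<noteq> \<zero>\<^bsub>N\<^esub>})"

definition finite_weight_spaces :: "('k::field gtilde, 'k, 'v) lmodule \<Rightarrow> bool" where
  "finite_weight_spaces N \<longleftrightarrow>
     (\<forall>\<chi>. vectorspace.fin_dim class_ring (N\<lparr>carrier := weight_space N \<chi>\<rparr>))"

text \<open>A formal sum of symbols \<open>Z\<^sup>\<chi>\<close> is its family of coefficients.\<close>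

definition character :: "('k::field gtilde, 'k, 'v) lmodule \<Rightarrow> 'k weight \<Rightarrow> rat" where
  "character N \<chi> =
     of_nat (vectorspace.dim class_ring (N\<lparr>carrier := weight_space N \<chi>\<rparr>))"

text \<open>The formal sum over all \<open>i\<close> of \<open>c i\<close> times the symbol with exponent \<open>w i\<close>; it is meant for families in which every
  weight occurs only finitely often.\<close>

definition formal_sum :: "('i \<Rightarrow> 'k weight) \<Rightarrow> ('i \<Rightarrow> rat) \<Rightarrow> 'k weight \<Rightarrow> rat" where
  "formal_sum w c = (\<lambda>\<chi>. \<Sum>i | w i = \<chi>. c i)"

definition moebius :: "nat \<Rightarrow> int" where
  "moebius n = (if squarefree n then (- 1) ^ card (prime_factors n) else 0)"

definition ramanujan_sum :: "nat \<Rightarrow> int \<Rightarrow> rat" where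
  "ramanujan_sum d n =
     (let d' = d div nat (gcd (int d) n)
      in of_nat (totient d) * of_int (moebius d') / of_nat (totient d'))"

text \<open>The power series expansion of the rational function \<open>P\<close>; the product is over the indices
  for which \<open>a i\<close> is a constant with value a natural number, and \<open>k\<close> is that number.\<close>

definition P_series :: "'i set \<Rightarrow> ('i \<Rightarrow> 'k::field_char_0 poly) \<Rightarrow> rat fps" where
  "P_series I a =
     (\<Prod>i | i \<in> I \<and> (\<exists>k::nat. a i = [:of_nat k:]).
        1 - fps_X ^ ((THE k::nat. a i = [:of_nat k:]) + 1))
     / (1 - fps_X) ^ (\<Sum>i\<in>I. Polynomial.degree (a i) + 1)"

end

theory Submission
  imports Defs
begin

text \<open>Record a vector of the module by its matrix coefficients: the function sending \<open>[k\<^sub>1, \<dots>, k\<^sub>m]\<close>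
  to the coefficient of the highest-weight line in \<open>e(k\<^sub>m) \<cdots> e(k\<^sub>1)\<close> applied to it. Such functions form a
  commutative ring under the shuffle product, on which \<open>e(k)\<close> acts as a derivation and \<open>h(n)\<close>, \<open>f(n)\<close> as
  explicit operators of order one. The kernel of the resulting map on \<open>T \<otimes> H\<close> consists of the vectors
  that no sequence of raising operators brings back to the top, hence is the largest proper submodule,
  and \<open>N(\<phi>)\<close> is its image.

  Expanding \<open>\<phi>\<close> over its exponents \<open>w\<^sup>j\<lambda>\<^sub>i\<close>, where \<open>w\<close> is a primitive \<open>r\<close>-th root of unity, gives generators
  \<open>X\<close> of degree one, one for each exponent and each \<open>c \<le> deg a\<^sub>i\<close>. The vectors of depth \<open>m\<close> are spanned by
  the monomials of degree \<open>m\<close> in them whose exponent at a node with constant value \<open>k \<in> \<int>\<^sub>+\<close> is at most \<open>k\<close>,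
  because there \<open>f\<close> multiplies \<open>X\<^sup>p\<close> by \<open>(k - p) X\<close>. Multiplication of the exponents by \<open>w\<close> permutes
  these monomials, and the \<open>d\<close>-grading cuts out an isotypic component of this permutation
  representation of \<open>\<int>/r\<close>, whose dimension is \<open>(1/r) \<Sum>\<^sub>j w\<^sup>j\<^sup>n |Fix(j)|\<close>. If \<open>j\<close> has order \<open>d\<close>, the fixed
  monomials are counted by \<open>P(Z\<^sup>d)\<^sup>r\<^sup>/\<^sup>d\<close>, and summing \<open>w\<^sup>j\<^sup>n\<close> over such \<open>j\<close> gives \<open>c\<^sub>d(n)\<close>.\<close>

section \<open>Modules over the loop algebra and their quotients\<close>

text \<open>The space of all functions on integer lists is too large to carry the Lie algebra:
  \<open>E k\<close> and \<open>E l\<close> commute only on functions that do not depend on the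
  order of the list. The other relations hold on every function, since \<open>E k\<close> can be
  moved past \<open>H\<close> and \<open>F\<close>, which leaves an assertion about shorter lists.
  So symmetry is carried along for the sake of the pair e, e. The shuffle product is dual to the
  coproduct for which the e(k) are primitive. This is why f(n) becomes multiplication by a linear
  function minus a derivation, and why it can be computed on monomials. On a constant node this
  derivation sends X to X^2, hence X^p to p X^(p+1), which is the origin of the factor k - p. The
  obstacle is that all admissible monomials must be reached. On a node with deg a_i > 0 the
  operators mix generators with different c and add quadratic terms. The nonzero leading coefficient
  of a_i allows solving for one generator, and a double induction controls the remaining terms.
  Characteristic zero separates the eigenvalues \<phi>(0) - 2m of h and n of d.\<close>

locale gmod = Module.module class_ring M
  for M :: "('g, 'k::field, 'v) lmodule" (structure) +
  assumes act_closed: "u \<in> carrier M \<Longrightarrow> act M x u \<in> carrier M"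
    and act_add: "u \<in> carrier M \<Longrightarrow> v \<in> carrier M \<Longrightarrow>
      act M x (u \<oplus> v) = act M x u \<oplus> act M x v"
    and act_smult: "u \<in> carrier M \<Longrightarrow> act M x (c \<odot> u) = c \<odot> act M x u"

lemma gmodI:
  fixes M :: "('g, 'k::field, 'v) lmodule" (structure)
  assumes "\<zero> \<in> carrier M"
    and "\<And>u v. u \<in> carrier M \<Longrightarrow> v \<in> carrier M \<Longrightarrow> u \<oplus> v \<in> carrier M"
    and "\<And>u. u \<in> carrier M \<Longrightarrow> \<exists>v\<in>carrier M. u \<oplus> v = \<zero>"
    and "\<And>c u. u \<in> carrier M \<Longrightarrow> c \<odot> u \<in> carrier M"
    and "\<And>u v. u \<in> carrier M \<Longrightarrow> v \<in> carrier M \<Longrightarrow> u \<oplus> v = v \<oplus> u"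
    and "\<And>u v w. u \<in> carrier M \<Longrightarrow> v \<in> carrier M \<Longrightarrow> w \<in> carrier M \<Longrightarrow>
      (u \<oplus> v) \<oplus> w = u \<oplus> (v \<oplus> w)"
    and "\<And>u. u \<in> carrier M \<Longrightarrow> u \<oplus> \<zero> = u"
    and "\<And>c d u. u \<in> carrier M \<Longrightarrow> (c * d) \<odot> u = c \<odot> (d \<odot> u)"
    and "\<And>u. u \<in> carrier M \<Longrightarrow> 1 \<odot> u = u"
    and "\<And>c d u. u \<in> carrier M \<Longrightarrow> (c + d) \<odot> u = c \<odot> u \<oplus> d \<odot> u"
    and "\<And>c u v. u \<in> carrier M \<Longrightarrow> v \<in> carrier M \<Longrightarrow> c \<odot> (u \<oplus> v) = c \<odot> u \<oplus> c \<odot> v"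
    and "\<And>x u. u \<in> carrier M \<Longrightarrow> act M x u \<in> carrier M"
    and "\<And>x u v. u \<in> carrier M \<Longrightarrow> v \<in> carrier M \<Longrightarrow>
      act M x (u \<oplus> v) = act M x u \<oplus> act M x v"
    and "\<And>x c u. u \<in> carrier M \<Longrightarrow> act M x (c \<odot> u) = c \<odot> act M x u"
  shows "gmod M"
proof (intro gmod.intro gmod_axioms.intro)
  show "Module.module class_ring M"
  proof (rule module_criteria)
    show "cring (class_ring :: 'k ring)" by (rule field.axioms(1)[OF class_field, THEN domain.axioms(1)])
    show "\<forall>v\<in>carrier M. \<exists>w\<in>carrier M. v \<oplus> w = \<zero>" using assms(3) by blast
    show "\<forall>v w x. v \<in> carrier M \<and> w \<in> carrier M \<and> x \<in> carrier M \<longrightarrow>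
        v \<oplus> w \<oplus> x = v \<oplus> (w \<oplus> x)" using assms(6) by blast
  qed (simp_all add: assms)
qed (fact assms)+

lemma (in gmod) smult_uminus_one:
  assumes "v \<in> carrier M"
  shows "(-1) \<odot> v = \<ominus> v"
proof -
  have "(-1) \<odot> v \<oplus> v = (-1 + 1) \<odot> v"
    using smult_l_distr[of "-1" 1 v] smult_one[of v] assms by simp
  also have "\<dots> = \<zero>" using smult_l_null[of v] assms by simp
  finally show ?thesis using assms smult_closed[of "-1" v] by (simp add: minus_equality)
qed

text \<open>Surjective linear maps commuting with all operators. Compatibility with the bracket is
  not part of \<open>gmod\<close>, because left multiplication on T \<otimes> H respects it only
  after passing to a quotient.\<close>

definition epi :: "('g, 'k::field, 'v) lmodule \<Rightarrow> ('g, 'k, 'w) lmodule \<Rightarrow> ('v \<Rightarrow> 'w) \<Rightarrow> bool" where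
  "epi M K p \<longleftrightarrow> gmod M \<and> gmod K \<and> carrier K = p ` carrier M \<and>
     (\<forall>u\<in>carrier M. \<forall>v\<in>carrier M. p (u \<oplus>\<^bsub>M\<^esub> v) = p u \<oplus>\<^bsub>K\<^esub> p v) \<and>
     (\<forall>c. \<forall>u\<in>carrier M. p (c \<odot>\<^bsub>M\<^esub> u) = c \<odot>\<^bsub>K\<^esub> p u) \<and>
     (\<forall>x. \<forall>u\<in>carrier M. p (act M x u) = act K x (p u))"

lemma epiD:
  assumes "epi M K p"
  shows "gmod M" "gmod K" "carrier K = p ` carrier M"
    "u \<in> carrier M \<Longrightarrow> p u \<in> carrier K"
    "u \<in> carrier M \<Longrightarrow> v \<in> carrier M \<Longrightarrow> p (u \<oplus>\<^bsub>M\<^esub> v) = p u \<oplus>\<^bsub>K\<^esub> p v"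
    "u \<in> carrier M \<Longrightarrow> p (c \<odot>\<^bsub>M\<^esub> u) = c \<odot>\<^bsub>K\<^esub> p u"
    "u \<in> carrier M \<Longrightarrow> p (act M x u) = act K x (p u)"
  using assms unfolding epi_def by auto

lemma epi_zero:
  assumes "epi M K p"
  shows "p \<zero>\<^bsub>M\<^esub> = \<zero>\<^bsub>K\<^esub>"
proof -
  interpret M: gmod M using assms by (rule epiD)
  interpret K: gmod K using assms by (rule epiD)
  have c: "p \<zero>\<^bsub>M\<^esub> \<in> carrier K" by (rule epiD(4)[OF assms]) simp
  have "p \<zero>\<^bsub>M\<^esub> \<oplus>\<^bsub>K\<^esub> p \<zero>\<^bsub>M\<^esub> = p (\<zero>\<^bsub>M\<^esub> \<oplus>\<^bsub>M\<^esub> \<zero>\<^bsub>M\<^esub>)"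
    by (rule epiD(5)[OF assms, symmetric]) simp_all
  then have "p \<zero>\<^bsub>M\<^esub> \<oplus>\<^bsub>K\<^esub> p \<zero>\<^bsub>M\<^esub> = p \<zero>\<^bsub>M\<^esub>" by simp
  then show ?thesis using K.add.l_cancel_one[OF c c] by simp
qed

lemma epi_comp: "epi M K p \<Longrightarrow> epi K L q \<Longrightarrow> epi M L (q \<circ> p)"
  unfolding epi_def by auto

text \<open>Every module axiom is an equation, or an existence statement, that a surjection carries
  from the source to the target. Quotients thereby inherit the axioms without any computation with
  cosets.\<close>

lemma epi_image_gmod:
  fixes M :: "('g, 'k::field, 'v) lmodule" and K :: "('g, 'k, 'w) lmodule"
  assumes M: "gmod M" and car: "carrier K = p ` carrier M"
    and z: "p \<zero>\<^bsub>M\<^esub> = \<zero>\<^bsub>K\<^esub>"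
    and ad: "\<And>u v. u \<in> carrier M \<Longrightarrow> v \<in> carrier M \<Longrightarrow> p (u \<oplus>\<^bsub>M\<^esub> v) = p u \<oplus>\<^bsub>K\<^esub> p v"
    and sm: "\<And>c u. u \<in> carrier M \<Longrightarrow> p (c \<odot>\<^bsub>M\<^esub> u) = c \<odot>\<^bsub>K\<^esub> p u"
    and ac: "\<And>x u. u \<in> carrier M \<Longrightarrow> p (act M x u) = act K x (p u)"
  shows "epi M K p"
proof -
  interpret M: gmod M by fact
  have lift: "\<exists>u'\<in>carrier M. u = p u'" if "u \<in> carrier K" for u
    using that car by auto
  have "gmod K"
  proof (rule gmodI)
    show "\<zero>\<^bsub>K\<^esub> \<in> carrier K" unfolding car z[symmetric] by simp
  next
    fix u assume "u \<in> carrier K"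
    then obtain u' where u: "u' \<in> carrier M" "u = p u'" using lift by blast
    show "\<exists>v\<in>carrier K. u \<oplus>\<^bsub>K\<^esub> v = \<zero>\<^bsub>K\<^esub>"
    proof
      show "p (\<ominus>\<^bsub>M\<^esub> u') \<in> carrier K" using u car by auto
      show "u \<oplus>\<^bsub>K\<^esub> p (\<ominus>\<^bsub>M\<^esub> u') = \<zero>\<^bsub>K\<^esub>"
        using u ad[of u' "\<ominus>\<^bsub>M\<^esub> u'"] z by (simp add: M.r_neg)
    qed
    show "c \<odot>\<^bsub>K\<^esub> u \<in> carrier K" for c
      unfolding car u(2) sm[OF u(1), symmetric] using u by (intro imageI) simp
    show "act K x u \<in> carrier K" for x
      unfolding car u(2) ac[OF u(1), symmetric] using u M.act_closed by (intro imageI) simp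
    show "u \<oplus>\<^bsub>K\<^esub> \<zero>\<^bsub>K\<^esub> = u"
      using u ad[of u' "\<zero>\<^bsub>M\<^esub>"] z by simp
    show "(c * d) \<odot>\<^bsub>K\<^esub> u = c \<odot>\<^bsub>K\<^esub> (d \<odot>\<^bsub>K\<^esub> u)" for c d
      using u sm[of u' "c * d"] sm[of u' d] sm[of "d \<odot>\<^bsub>M\<^esub> u'" c]
        M.smult_assoc1[of c d u'] M.smult_closed[of d u'] by simp
    show "1 \<odot>\<^bsub>K\<^esub> u = u"
      using u sm[of u' 1] M.smult_one[of u'] by simp
    show "(c + d) \<odot>\<^bsub>K\<^esub> u = c \<odot>\<^bsub>K\<^esub> u \<oplus>\<^bsub>K\<^esub> d \<odot>\<^bsub>K\<^esub> u" for c d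
      using u sm[of u' "c + d"] sm[of u' d] sm[of u' c] ad[of "c \<odot>\<^bsub>M\<^esub> u'" "d \<odot>\<^bsub>M\<^esub> u'"]
        M.smult_l_distr[of c d u'] M.smult_closed[of d u'] M.smult_closed[of c u'] by simp
    show "act K x (c \<odot>\<^bsub>K\<^esub> u) = c \<odot>\<^bsub>K\<^esub> act K x u" for x c
      using u sm[of u' c] ac[of "c \<odot>\<^bsub>M\<^esub> u'" x] sm[of "act M x u'" c] ac[of u' x]
        M.act_smult[of u' x c] M.smult_closed[of c u'] M.act_closed[of u' x] by simp
    fix v assume "v \<in> carrier K"
    then obtain v' where v: "v' \<in> carrier M" "v = p v'" using lift by blast
    show "u \<oplus>\<^bsub>K\<^esub> v \<in> carrier K"
      unfolding car u(2) v(2) ad[OF u(1) v(1), symmetric] using u v by (intro imageI) simp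
    show "u \<oplus>\<^bsub>K\<^esub> v = v \<oplus>\<^bsub>K\<^esub> u"
      using u v ad[of u' v'] ad[of v' u'] M.a_comm[of u' v'] by simp
    show "c \<odot>\<^bsub>K\<^esub> (u \<oplus>\<^bsub>K\<^esub> v) = c \<odot>\<^bsub>K\<^esub> u \<oplus>\<^bsub>K\<^esub> c \<odot>\<^bsub>K\<^esub> v" for c
      using u v sm[of u' c] sm[of v' c] sm[of "u' \<oplus>\<^bsub>M\<^esub> v'" c] ad[of u' v']
        ad[of "c \<odot>\<^bsub>M\<^esub> u'" "c \<odot>\<^bsub>M\<^esub> v'"]
        M.smult_r_distr[of c u' v'] M.smult_closed[of c v'] M.smult_closed[of c u'] by simp
    show "act K x (u \<oplus>\<^bsub>K\<^esub> v) = act K x u \<oplus>\<^bsub>K\<^esub> act K x v" for x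
      using u v ac[of u' x] ac[of v' x] ac[of "u' \<oplus>\<^bsub>M\<^esub> v'" x] ad[of u' v']
        ad[of "act M x u'" "act M x v'"]
        M.act_add[of u' v' x] M.act_closed[of u' x] M.act_closed[of v' x] by simp
    fix w assume "w \<in> carrier K"
    then obtain w' where w: "w' \<in> carrier M" "w = p w'" using lift by blast
    show "u \<oplus>\<^bsub>K\<^esub> v \<oplus>\<^bsub>K\<^esub> w = u \<oplus>\<^bsub>K\<^esub> (v \<oplus>\<^bsub>K\<^esub> w)"
      using u v w ad[of u' v'] ad[of v' w'] ad[of "u' \<oplus>\<^bsub>M\<^esub> v'" w'] ad[of u' "v' \<oplus>\<^bsub>M\<^esub> w'"]
        M.a_assoc[of u' v' w'] by simp
  qed
  thus ?thesis using assms unfolding epi_def by blast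
qed

text \<open>A stable submodule is closed under negation, as -1 is a scalar, so it is a subgroup and
  the library theory of cosets applies; the operations of \<open>quotient_module\<close> then have
  to be matched with the induced ones.\<close>

lemma (in gmod) quotient_epi:
  assumes W: "stable_submodule UNIV M W"
  shows "epi M (quotient_module M W) (\<lambda>u. W +> u)"
    and "u \<in> carrier M \<Longrightarrow> W +> u = \<zero>\<^bsub>quotient_module M W\<^esub> \<longleftrightarrow> u \<in> W"
proof -
  have sub: "submodule class_ring W M" and st: "\<And>x w. w \<in> W \<Longrightarrow> act M x w \<in> W"
    using W unfolding stable_submodule_def by auto
  note WM = submodule.subset[OF sub] and Wa = submodule.m_closed[OF sub]
    and W0 = submodule.zero_closed[OF sub] and Ws = submodule.smult_closed[OF sub, simplified]
  have Wn: "\<ominus> w \<in> W" if "w \<in> W" for w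
    using Ws[OF that, of "-1"] that WM smult_uminus_one[of w] by auto
  have "subgroup W (add_monoid M)"
    using WM Wa W0 Wn by (intro add.subgroupI) (auto simp: a_inv_def)
  then have "additive_subgroup W M" by (rule additive_subgroup.intro)
  then interpret W: abelian_subgroup W M
    by (rule abelian_subgroupI3) (rule abelian_group_axioms)
  have z: "W +> \<zero> = W" using W0 by (rule W.a_rcos_const)
  show eq: "W +> u = \<zero>\<^bsub>quotient_module M W\<^esub> \<longleftrightarrow> u \<in> W" if "u \<in> carrier M" for u
    using that by (simp add: quotient_module_def)
      (metis W.a_rcos_self W.a_rcos_const)
  \<comment> \<open>The image of a coset under a linear map may be smaller than a coset, as for the
    zero map. Adding \<open>W\<close> in \<open>quotient_module\<close> completes it to the coset of
    \<open>f u\<close>.\<close>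
  have lin: "set_add M (f ` (W +> u)) W = W +> f u"
    if u: "u \<in> carrier M" and f: "\<And>v. v \<in> carrier M \<Longrightarrow> f v \<in> carrier M"
      and fa: "\<And>v w. v \<in> carrier M \<Longrightarrow> w \<in> carrier M \<Longrightarrow> f (v \<oplus> w) = f v \<oplus> f w"
      and fW: "\<And>v. v \<in> W \<Longrightarrow> f v \<in> W" for f u
  proof -
    have "set_add M (f ` (W +> u)) W = {f (w \<oplus> u) \<oplus> w' |w w'. w \<in> W \<and> w' \<in> W}"
      by (auto simp: set_add_defs a_r_coset_def r_coset_def)
    also have "\<dots> = {w \<oplus> f u |w. w \<in> W}"
    proof (intro equalityI subsetI)
      fix y assume "y \<in> {f (w \<oplus> u) \<oplus> w' |w w'. w \<in> W \<and> w' \<in> W}"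
      then obtain w w' where w: "w \<in> W" "w' \<in> W" and y: "y = f (w \<oplus> u) \<oplus> w'" by blast
      have c: "w \<in> carrier M" "w' \<in> carrier M" using w WM by auto
      have "y = (f w \<oplus> w') \<oplus> f u" unfolding y using c u f fa by (simp add: a_ac)
      then show "y \<in> {w \<oplus> f u |w. w \<in> W}" using Wa[OF fW[OF w(1)] w(2)] by blast
    next
      fix y assume "y \<in> {w \<oplus> f u |w. w \<in> W}"
      then obtain w where w: "w \<in> W" and y: "y = w \<oplus> f u" by blast
      have c: "w \<in> carrier M" using w WM by auto
      have "y = f (\<zero> \<oplus> u) \<oplus> w" unfolding y using c u f by (simp add: a_ac)
      then show "y \<in> {f (w \<oplus> u) \<oplus> w' |w w'. w \<in> W \<and> w' \<in> W}" using W0 w by blast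
    qed
    finally show ?thesis by (auto simp: a_r_coset_def r_coset_def)
  qed
  show "epi M (quotient_module M W) (\<lambda>u. W +> u)"
  proof (rule epi_image_gmod)
    show "gmod M" by (rule gmod_axioms)
    show "carrier (quotient_module M W) = (+>) W ` carrier M"
      by (auto simp: quotient_module_def A_RCOSETS_def RCOSETS_def a_r_coset_def)
    show "W +> \<zero> = \<zero>\<^bsub>quotient_module M W\<^esub>" using z by (simp add: quotient_module_def)
    show "W +> (u \<oplus> v) = (W +> u) \<oplus>\<^bsub>quotient_module M W\<^esub> (W +> v)"
      if "u \<in> carrier M" "v \<in> carrier M" for u v
      using that by (simp add: quotient_module_def W.a_rcos_sum)
    show "W +> c \<odot> u = c \<odot>\<^bsub>quotient_module M W\<^esub> (W +> u)" if "u \<in> carrier M" for c u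
      using lin[OF that, of "\<lambda>v. c \<odot> v"] Ws by (simp add: quotient_module_def smult_r_distr)
    show "W +> act M x u = act (quotient_module M W) x (W +> u)" if "u \<in> carrier M" for x u
      using lin[OF that, of "act M x"] st act_closed act_add by (simp add: quotient_module_def)
  qed
qed

lemma stable_vimage:
  assumes e: "epi M K p" and W: "stable_submodule S K W"
  shows "stable_submodule S M {u \<in> carrier M. p u \<in> W}"
proof -
  interpret M: gmod M using e by (rule epiD)
  have sub: "submodule class_ring W K" and st: "\<And>x w. x \<in> S \<Longrightarrow> w \<in> W \<Longrightarrow> act K x w \<in> W"
    using W unfolding stable_submodule_def by auto
  note Wa = submodule.m_closed[OF sub]
    and W0 = submodule.zero_closed[OF sub] and Ws = submodule.smult_closed[OF sub, simplified]
  show ?thesis unfolding stable_submodule_def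
  proof (intro conjI submodule.intro)
    show "\<zero>\<^bsub>M\<^esub> \<in> {u \<in> carrier M. p u \<in> W}" using epi_zero[OF e] W0 by auto
  qed (use M.module_axioms Wa Ws st epiD[OF e] M.act_closed M.smult_closed in auto)
qed

lemma stable_image:
  assumes e: "epi M K p" and W: "stable_submodule S M W"
  shows "stable_submodule S K (p ` W)"
proof -
  interpret M: gmod M using e by (rule epiD)
  interpret K: gmod K using e by (rule epiD)
  have sub: "submodule class_ring W M" and st: "\<And>x w. x \<in> S \<Longrightarrow> w \<in> W \<Longrightarrow> act M x w \<in> W"
    using W unfolding stable_submodule_def by auto
  note WM = submodule.subset[OF sub] and Wa = submodule.m_closed[OF sub]
    and W0 = submodule.zero_closed[OF sub] and Ws = submodule.smult_closed[OF sub, simplified]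
  show ?thesis unfolding stable_submodule_def
  proof (intro conjI submodule.intro ballI)
    show "\<zero>\<^bsub>K\<^esub> \<in> p ` W" using epi_zero[OF e] W0 by (metis imageI)
    fix v w assume "v \<in> p ` W" "w \<in> p ` W"
    then obtain v' w' where "v' \<in> W" "w' \<in> W" "v = p v'" "w = p w'" by blast
    then show "v \<oplus>\<^bsub>K\<^esub> w \<in> p ` W"
      using epiD(5)[OF e, of v' w'] Wa[of v' w'] WM by (metis imageI subsetD)
  next
    fix c v assume "v \<in> p ` W"
    then obtain v' where "v' \<in> W" "v = p v'" by blast
    then show "c \<odot>\<^bsub>K\<^esub> v \<in> p ` W"
      using epiD(6)[OF e, of v' c] Ws[of v' c] WM by (metis imageI subsetD)
  next
    fix x v assume "x \<in> S" "v \<in> p ` W"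
    then obtain v' where "v' \<in> W" "v = p v'" by blast
    then show "act K x v \<in> p ` W"
      using epiD(7)[OF e, of v' x] st[of x v'] \<open>x \<in> S\<close> WM by (metis imageI subsetD)
  qed (use K.module_axioms WM epiD(4)[OF e] in auto)
qed

text \<open>Correspondence of submodules: those of the image are the submodules of the source above
  the kernel. Irreducibility can thus be tested upstairs, without handling nested cosets.\<close>

lemma irreducible_epi_iff:
  assumes e: "epi M K p" and Z: "Z = {u \<in> carrier M. p u = \<zero>\<^bsub>K\<^esub>}"
  shows "irreducible_module K \<longleftrightarrow> Z \<noteq> carrier M \<and>
    (\<forall>U. stable_submodule UNIV M U \<longrightarrow> Z \<subseteq> U \<longrightarrow> U = Z \<or> U = carrier M)"
    (is "_ \<longleftrightarrow> ?R")
proof -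
  interpret M: gmod M using e by (rule epiD)
  interpret K: gmod K using e by (rule epiD)
  have nz: "carrier K \<noteq> {\<zero>\<^bsub>K\<^esub>} \<longleftrightarrow> Z \<noteq> carrier M"
    unfolding Z epiD(3)[OF e] using imageI[OF M.zero_closed, of p] epi_zero[OF e] by auto
  \<comment> \<open>A submodule above the kernel is saturated: two vectors with the same image
    differ by an element of the kernel.\<close>
  have sat: "{u \<in> carrier M. p u \<in> p ` U} = U" if U: "stable_submodule UNIV M U" "Z \<subseteq> U" for U
  proof (intro equalityI subsetI)
    have sub: "submodule class_ring U M" using U unfolding stable_submodule_def by auto
    note UM = submodule.subset[OF sub]
    fix u assume "u \<in> {u \<in> carrier M. p u \<in> p ` U}"
    then obtain v where v: "v \<in> U" "p u = p v" and u: "u \<in> carrier M" by blast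
    have vM: "v \<in> carrier M" using v UM by auto
    have nv: "-1 \<odot>\<^bsub>M\<^esub> v = \<ominus>\<^bsub>M\<^esub> v" by (rule M.smult_uminus_one[OF vM])
    have "p (u \<oplus>\<^bsub>M\<^esub> (-1) \<odot>\<^bsub>M\<^esub> v) = p (v \<oplus>\<^bsub>M\<^esub> (-1) \<odot>\<^bsub>M\<^esub> v)"
      using u vM v epiD(5)[OF e] M.smult_closed[of "-1" v] by simp
    also have "\<dots> = \<zero>\<^bsub>K\<^esub>" using vM nv epi_zero[OF e] by (simp add: M.r_neg)
    finally have "u \<oplus>\<^bsub>M\<^esub> \<ominus>\<^bsub>M\<^esub> v \<in> U" using U(2) u vM nv Z by auto
    then have "(u \<oplus>\<^bsub>M\<^esub> \<ominus>\<^bsub>M\<^esub> v) \<oplus>\<^bsub>M\<^esub> v \<in> U" using v submodule.m_closed[OF sub] by blast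
    also have "(u \<oplus>\<^bsub>M\<^esub> \<ominus>\<^bsub>M\<^esub> v) \<oplus>\<^bsub>M\<^esub> v = u" using u vM by (simp add: M.a_assoc M.l_neg)
    finally show "u \<in> U" .
  next
    fix u assume "u \<in> U"
    then show "u \<in> {u \<in> carrier M. p u \<in> p ` U}"
      using U unfolding stable_submodule_def submodule_def by auto
  qed
  show ?thesis
  proof
    assume irr: "irreducible_module K"
    show ?R
    proof (intro conjI allI impI)
      show "Z \<noteq> carrier M" using irr nz unfolding irreducible_module_def by auto
      fix U assume U: "stable_submodule UNIV M U" "Z \<subseteq> U"
      have "p ` U = {\<zero>\<^bsub>K\<^esub>} \<or> p ` U = carrier K"
        using irr stable_image[OF e U(1)] unfolding irreducible_module_def by blast
      then show "U = Z \<or> U = carrier M"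
      proof
        assume "p ` U = {\<zero>\<^bsub>K\<^esub>}"
        then show ?thesis using sat[OF U] Z by auto
      next
        assume "p ` U = carrier K"
        then show ?thesis using sat[OF U] epiD(4)[OF e] by auto
      qed
    qed
  next
    assume R: ?R
    show "irreducible_module K" unfolding irreducible_module_def
    proof (intro conjI allI impI)
      show "carrier K \<noteq> {\<zero>\<^bsub>K\<^esub>}" using R nz by auto
      fix W assume W: "stable_submodule UNIV K W"
      let ?U = "{u \<in> carrier M. p u \<in> W}"
      have W': "W \<subseteq> carrier K" "\<zero>\<^bsub>K\<^esub> \<in> W" using W unfolding stable_submodule_def submodule_def by auto
      have im: "W = p ` ?U" using W' epiD(3)[OF e] by auto
      have "?U = Z \<or> ?U = carrier M" using R stable_vimage[OF e W] W' Z by auto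
      then show "W = {\<zero>\<^bsub>K\<^esub>} \<or> W = carrier K"
      proof
        assume "?U = Z"
        then have "p ` ?U \<subseteq> {\<zero>\<^bsub>K\<^esub>}" using Z by auto
        then show ?thesis using im W' by auto
      next
        assume "?U = carrier M"
        then show ?thesis using im epiD(3)[OF e] by auto
      qed
    qed
  qed
qed

section \<open>The shuffle ring of functions on integer lists\<close>

text \<open>A separate type makes room for a ring structure whose multiplication is the shuffle
  product instead of the pointwise one.\<close>

typedef 'k lfun = "UNIV :: (int list \<Rightarrow> 'k) set" morphisms ev Lf ..
setup_lifting type_definition_lfun

lemma lfun_eqI: "(\<And>ks. ev s ks = ev t ks) \<Longrightarrow> s = t"
  by (metis ev_inject ext)

text \<open>The recursion is the Leibniz rule for removing the first entry; it says at once that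
  every \<open>E k\<close> will be a derivation.\<close>

fun shuffle :: "(int list \<Rightarrow> 'k::comm_ring_1) \<Rightarrow> (int list \<Rightarrow> 'k) \<Rightarrow> int list \<Rightarrow> 'k" where
  "shuffle s t [] = s [] * t []"
| "shuffle s t (k # ks) = shuffle (\<lambda>l. s (k # l)) t ks + shuffle s (\<lambda>l. t (k # l)) ks"

lemma shuffle_add: "shuffle (\<lambda>l. s l + t l) u ks = shuffle s u ks + shuffle t u ks"
  by (induction ks arbitrary: s t u) (simp_all add: algebra_simps)

lemma shuffle_commute: "shuffle s t ks = shuffle t s ks"
  by (induction ks arbitrary: s t) (simp_all add: algebra_simps)

lemma shuffle_zero: "shuffle (\<lambda>l. 0) u ks = 0"
  by (induction ks arbitrary: u) simp_all

lemma shuffle_const: "shuffle (\<lambda>l. if l = [] then c else 0) u ks = c * u ks"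
  by (induction ks arbitrary: u) (simp_all add: shuffle_zero)

lemma shuffle_assoc: "shuffle (shuffle s t) u ks = shuffle s (shuffle t u) ks"
proof (induction ks arbitrary: s t u)
  case (Cons k ks)
  have *: "shuffle s (\<lambda>l. t l + t' l) ks = shuffle s t ks + shuffle s t' ks" for s t t' :: "int list \<Rightarrow> 'a"
    by (simp add: shuffle_commute[of s] shuffle_add)
  show ?case by (simp add: shuffle_add * Cons.IH add.assoc)
qed (simp add: mult.assoc)

instantiation lfun :: (comm_ring_1) comm_ring_1
begin
lift_definition zero_lfun :: "'a lfun" is "\<lambda>_. 0" .
lift_definition one_lfun :: "'a lfun" is "\<lambda>ks. if ks = [] then 1 else 0" .
lift_definition plus_lfun :: "'a lfun \<Rightarrow> 'a lfun \<Rightarrow> 'a lfun" is "\<lambda>s t ks. s ks + t ks" .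
lift_definition minus_lfun :: "'a lfun \<Rightarrow> 'a lfun \<Rightarrow> 'a lfun" is "\<lambda>s t ks. s ks - t ks" .
lift_definition uminus_lfun :: "'a lfun \<Rightarrow> 'a lfun" is "\<lambda>s ks. - s ks" .
lift_definition times_lfun :: "'a lfun \<Rightarrow> 'a lfun \<Rightarrow> 'a lfun" is shuffle .
instance
proof
  fix a b c :: "'a lfun"
  show "a * b * c = a * (b * c)" by transfer (rule ext, rule shuffle_assoc)
  show "a * b = b * a" by transfer (rule ext, rule shuffle_commute)
  show "1 * a = a" by transfer (rule ext, simp add: shuffle_const)
  show "(a + b) * c = a * c + b * c" by transfer (rule ext, rule shuffle_add)
  show "a + b + c = a + (b + c)" by transfer (simp add: add.assoc)
  show "a + b = b + a" by transfer (simp add: add.commute)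
  show "0 + a = a" by transfer simp
  show "- a + a = 0" by transfer simp
  show "a - b = a + - b" by transfer simp
  show "(0 :: 'a lfun) \<noteq> 1" by transfer (metis zero_neq_one)
qed
end

lift_definition cst :: "'k \<Rightarrow> 'k::comm_ring_1 lfun" is "\<lambda>c ks. if ks = [] then c else 0" .
lift_definition E :: "int \<Rightarrow> 'k lfun \<Rightarrow> 'k::comm_ring_1 lfun" is "\<lambda>k s l. s (k # l)" .

lemma ev_simps [simp]:
  "ev 0 ks = 0" "ev (s + t) ks = ev s ks + ev t ks" "ev (s - t) ks = ev s ks - ev t ks"
  "ev (- s) ks = - ev s ks" "ev (cst c * s) ks = c * ev s ks" "ev (s * t) [] = ev s [] * ev t []"
  "ev (cst c) [] = c" "ev 1 [] = 1"
  by (transfer, simp add: shuffle_const)+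

lemma ev_sum [simp]: "ev (\<Sum>i\<in>A. f i) ks = (\<Sum>i\<in>A. ev (f i) ks)"
  by (induction A rule: infinite_finite_induct) simp_all

lemma ev_Cons: "ev s (k # ks) = ev (E k s) ks"
  by transfer simp

lemma cst_simps [simp]: "cst 0 = 0" "cst 1 = 1"
  by (transfer, simp)+

lemma cst_add: "cst (a + b) = cst a + cst b"
  by transfer auto

lemma cst_uminus: "cst (- a) = - cst a"
  by transfer auto

lemma cst_diff: "cst (a - b) = cst a - cst b"
  by transfer auto

lemma cst_mult: "cst (a * b) = cst a * cst b"
  by (rule lfun_eqI) (simp, transfer, simp)

lemma cst_sum: "cst (\<Sum>i\<in>A. f i) = (\<Sum>i\<in>A. cst (f i))"
  by (induction A rule: infinite_finite_induct) (simp_all add: cst_add)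

lemma cst_of_nat: "cst (of_nat n) = of_nat n"
  by (induction n) (simp_all add: cst_add)

lemma cst_numeral: "cst (numeral n) = numeral n"
  by (metis cst_of_nat of_nat_numeral)

lemma E_simps [simp]:
  "E k 0 = 0" "E k (s + t) = E k s + E k t" "E k (s - t) = E k s - E k t"
  "E k (- s) = - E k s" "E k (cst c) = 0" "E k 1 = 0"
  by (transfer, simp)+

lemma E_mult [simp]: "E k (s * t) = E k s * t + s * E k t"
  by transfer simp

lemma E_numeral [simp]: "E k (numeral n) = 0"
  by (metis E_simps(5) cst_numeral)

section \<open>The derivations and the linear function behind h(n) and f(n)\<close>

fun dh :: "int \<Rightarrow> (int list \<Rightarrow> 'k::comm_ring_1) \<Rightarrow> int list \<Rightarrow> 'k" where
  "dh n s [] = 0"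
| "dh n s (k # ks) = dh n (\<lambda>l. s (k # l)) ks + s ((n + k) # ks)"

text \<open>Unfolded, \<open>dh n s\<close> adds n to one entry of the list and sums over the
  entries. \<open>df n s\<close> deletes one entry and adds it together with n to a later entry,
  summed over the pairs and doubled, so it lengthens the lists on which a function lives by
  one.\<close>

fun df :: "int \<Rightarrow> (int list \<Rightarrow> 'k::comm_ring_1) \<Rightarrow> int list \<Rightarrow> 'k" where
  "df n s [] = 0"
| "df n s (k # ks) = df n (\<lambda>l. s (k # l)) ks + (dh (n + k) s ks + dh (n + k) s ks)"

lift_definition DH :: "int \<Rightarrow> 'k lfun \<Rightarrow> 'k::comm_ring_1 lfun" is dh .
lift_definition DF :: "int \<Rightarrow> 'k lfun \<Rightarrow> 'k::comm_ring_1 lfun" is df .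
text \<open>The matrix coefficients of f(n) applied to a top vector: e(k) f(n) acts there as h(n +
  k), that is, by the scalar \<open>\<phi> (n + k)\<close>.\<close>

lift_definition PF :: "(int \<Rightarrow> 'k) \<Rightarrow> int \<Rightarrow> 'k::comm_ring_1 lfun" is
  "\<lambda>\<phi> n ks. case ks of [k] \<Rightarrow> \<phi> (n + k) | _ \<Rightarrow> 0" .

lemma ev_D_Nil [simp]: "ev (DH n s) [] = 0" "ev (DF n s) [] = 0" "ev (PF \<phi> n) [] = 0"
  by (transfer, simp)+

lemma E_DH [simp]: "E k (DH n s) = DH n (E k s) + E (n + k) s"
  by transfer simp

lemma E_DF [simp]: "E k (DF n s) = DF n (E k s) + 2 * DH (n + k) s"
proof -
  have "E k (DF n s) = DF n (E k s) + (DH (n + k) s + DH (n + k) s)" by transfer simp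
  then show ?thesis by (simp only: mult_2)
qed

lemma E_PF [simp]: "E k (PF \<phi> n) = cst (\<phi> (n + k))"
  by transfer (auto split: list.splits)

lemma DH_add: "DH n (s + t) = DH n s + DH n t"
proof (rule lfun_eqI)
  show "ev (DH n (s + t)) ks = ev (DH n s + DH n t) ks" for ks
    by (induction ks arbitrary: s t) (simp_all add: ev_Cons)
qed

lemma DH_mult: "DH n (s * t) = DH n s * t + s * DH n t"
proof (rule lfun_eqI)
  show "ev (DH n (s * t)) ks = ev (DH n s * t + s * DH n t) ks" for ks
  proof (induction ks arbitrary: s t)
    case (Cons k ks)
    show ?case using Cons.IH[of "E k s" t] Cons.IH[of s "E k t"]
      by (simp add: ev_Cons DH_add algebra_simps)
  qed simp
qed

lemma DH_cst [simp]: "DH n (cst c) = 0"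
proof (rule lfun_eqI)
  have z: "ev (DH n (0 :: 'a lfun)) ks = 0" for ks
    by (induction ks) (simp_all add: ev_Cons)
  show "ev (DH n (cst c)) ks = ev 0 ks" for ks
    by (cases ks) (simp_all add: ev_Cons z)
qed

lemma DF_add: "DF n (s + t) = DF n s + DF n t"
proof (rule lfun_eqI)
  show "ev (DF n (s + t)) ks = ev (DF n s + DF n t) ks" for ks
    by (induction ks arbitrary: s t) (simp_all add: ev_Cons DH_add algebra_simps)
qed

lemma DF_mult: "DF n (s * t) = DF n s * t + s * DF n t"
proof (rule lfun_eqI)
  show "ev (DF n (s * t)) ks = ev (DF n s * t + s * DF n t) ks" for ks
  proof (induction ks arbitrary: s t)
    case (Cons k ks)
    show ?case using Cons.IH[of "E k s" t] Cons.IH[of s "E k t"]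
      by (simp add: ev_Cons DF_add DH_mult algebra_simps)
  qed simp
qed

lemma DF_cst [simp]: "DF n (cst c) = 0"
proof (rule lfun_eqI)
  have h: "DH m (0 :: 'a lfun) = 0" for m using DH_cst[of m 0] by simp
  have z: "ev (DF n (0 :: 'a lfun)) ks = 0" for ks
    by (induction ks) (simp_all add: ev_Cons h)
  show "ev (DF n (cst c)) ks = ev 0 ks" for ks
    by (cases ks) (simp_all add: ev_Cons z)
qed

text \<open>The operators by which \<open>h(n)\<close> and \<open>f(n)\<close> act on matrix coefficients. The derivations \<open>DH n\<close> and
  \<open>DF n\<close> and the function \<open>PF \<phi> n\<close> are forced by the commutation
  rules with \<open>E k\<close> together with the values at the empty list.\<close>

definition H :: "(int \<Rightarrow> 'k::comm_ring_1) \<Rightarrow> int \<Rightarrow> 'k lfun \<Rightarrow> 'k lfun" where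
  "H \<phi> n s = cst (\<phi> n) * s - 2 * DH n s"

definition F :: "(int \<Rightarrow> 'k::comm_ring_1) \<Rightarrow> int \<Rightarrow> 'k lfun \<Rightarrow> 'k lfun" where
  "F \<phi> n s = PF \<phi> n * s - DF n s"

text \<open>This and \<open>E_F\<close> are the brackets of e(k) with h(n) and f(n). They hold on
  all functions and drive the inductions for the remaining relations.\<close>

lemma E_H: "E k (H \<phi> n s) = H \<phi> n (E k s) - 2 * E (n + k) s"
  by (simp add: H_def algebra_simps)

lemma E_F: "E k (F \<phi> n s) = F \<phi> n (E k s) + H \<phi> (n + k) s"
  by (simp add: F_def H_def algebra_simps)

lemma ev_HF_Nil [simp]: "ev (H \<phi> n s) [] = \<phi> n * ev s []" "ev (F \<phi> n s) [] = 0"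
proof -
  have "ev (2 * t) [] = 2 * ev t []" for t :: "'a lfun" by (simp only: mult_2 ev_simps)
  then show "ev (H \<phi> n s) [] = \<phi> n * ev s []" by (simp add: H_def)
qed (simp add: F_def)

lemma HF_linear:
  "H \<phi> n (s + t) = H \<phi> n s + H \<phi> n t" "H \<phi> n (cst c * s) = cst c * H \<phi> n s"
  "F \<phi> n (s + t) = F \<phi> n s + F \<phi> n t" "F \<phi> n (cst c * s) = cst c * F \<phi> n s"
  "E n (cst c * s) = cst c * E n s"
  by (simp_all add: H_def F_def DH_add DF_add DH_mult DF_mult algebra_simps)

lemma HF_linear2:
  "H \<phi> n (s - t) = H \<phi> n s - H \<phi> n t" "H \<phi> n (2 * s) = 2 * H \<phi> n s"
  "F \<phi> n (s - t) = F \<phi> n s - F \<phi> n t" "F \<phi> n (2 * s) = 2 * F \<phi> n s"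
proof -
  show "H \<phi> n (s - t) = H \<phi> n s - H \<phi> n t"
    by (simp only: eq_diff_eq HF_linear(1)[symmetric] diff_add_cancel)
  show "F \<phi> n (s - t) = F \<phi> n s - F \<phi> n t"
    by (simp only: eq_diff_eq HF_linear(3)[symmetric] diff_add_cancel)
qed (simp_all only: mult_2 HF_linear)

text \<open>Both sides agree at the empty list. On a longer list \<open>E k\<close> is moved past
  the two operators, and what remains is the same relation on a shorter list or terms that cancel.
  \<open>H_F\<close> and \<open>F_F\<close> follow the same scheme, each using the previous
  relation.\<close>

lemma H_H: "H \<phi> n (H \<phi> m s) = H \<phi> m (H \<phi> n s)"
proof (rule lfun_eqI)
  show "ev (H \<phi> n (H \<phi> m s)) ks = ev (H \<phi> m (H \<phi> n s)) ks" for ks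
  proof (induction ks arbitrary: s)
    case (Cons k ks)
    show ?case using Cons.IH[of "E k s"]
      by (simp add: ev_Cons E_H HF_linear HF_linear2 algebra_simps)
  qed simp
qed

lemma H_F: "H \<phi> n (F \<phi> m s) = F \<phi> m (H \<phi> n s) - 2 * F \<phi> (n + m) s"
proof (rule lfun_eqI)
  have "ev (2 * t) [] = 2 * ev t []" for t :: "'a lfun" by (simp only: mult_2 ev_simps)
  then show "ev (H \<phi> n (F \<phi> m s)) ks = ev (F \<phi> m (H \<phi> n s) - 2 * F \<phi> (n + m) s) ks" for ks
  proof (induction ks arbitrary: s)
    case (Cons k ks)
    show ?case using Cons.IH[OF Cons.prems, of "E k s"]
      by (simp add: ev_Cons E_H E_F HF_linear HF_linear2 H_H[of \<phi> "k + m" n] algebra_simps)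
  qed simp
qed

lemma F_F: "F \<phi> n (F \<phi> m s) = F \<phi> m (F \<phi> n s)"
proof (rule lfun_eqI)
  show "ev (F \<phi> n (F \<phi> m s)) ks = ev (F \<phi> m (F \<phi> n s)) ks" for ks
  proof (induction ks arbitrary: s)
    case (Cons k ks)
    show ?case using Cons.IH[of "E k s"]
      by (simp add: ev_Cons E_F HF_linear HF_linear2 H_F algebra_simps)
  qed simp
qed

section \<open>Functions on which the raising operators commute\<close>

fun symm_upto :: "nat \<Rightarrow> 'k::comm_ring_1 lfun \<Rightarrow> bool" where
  "symm_upto 0 s = True"
| "symm_upto (Suc d) s =
     ((\<forall>k l. E k (E l s) = E l (E k s)) \<and> (\<forall>k. symm_upto d (E k s)))"

text \<open>This is invariance under permutations of the list, stated through the operators. The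
  condition must persist after every \<open>E k\<close>, so it is built up by depth; a bound on the
  depth allows closure properties to be proved by induction on it.\<close>

definition symm :: "'k::comm_ring_1 lfun \<Rightarrow> bool" where
  "symm s \<longleftrightarrow> (\<forall>d. symm_upto d s)"

lemma symm_upto_add: "symm_upto d s \<Longrightarrow> symm_upto d t \<Longrightarrow> symm_upto d (s + t)"
  by (induction d arbitrary: s t) simp_all

lemma symm_upto_Suc: "symm_upto (Suc d) s \<Longrightarrow> symm_upto d s"
  by (induction d arbitrary: s) simp_all

lemma symm_upto_mult: "symm_upto d s \<Longrightarrow> symm_upto d t \<Longrightarrow> symm_upto d (s * t)"
proof (induction d arbitrary: s t)
  case (Suc d)
  then have "symm_upto d s" "symm_upto d t" by (blast intro: symm_upto_Suc)+
  with Suc show ?case by (auto simp: algebra_simps intro!: symm_upto_add)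
qed simp

lemma symm_upto_0: "symm_upto d 0"
  by (induction d) simp_all

lemma symm_upto_cst: "symm_upto d (cst c)"
  by (cases d) (simp_all add: symm_upto_0)

lemma symm_upto_numeral: "symm_upto d (numeral n)"
  by (metis symm_upto_cst cst_numeral)

lemma symm_upto_DH: "symm_upto d s \<Longrightarrow> symm_upto d (DH n s)"
proof (induction d arbitrary: s)
  case (Suc d)
  then show ?case by (auto simp: algebra_simps intro!: symm_upto_add)
qed simp

lemma symm_upto_DF: "symm_upto d s \<Longrightarrow> symm_upto d (DF n s)"
proof (induction d arbitrary: s)
  case (Suc d)
  then have "symm_upto d s" by (blast intro: symm_upto_Suc)
  with Suc show ?case
    by (auto simp: algebra_simps intro!: symm_upto_add symm_upto_mult symm_upto_numeral symm_upto_DH)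
qed simp

lemma symm_upto_PF: "symm_upto d (PF \<phi> n)"
  by (cases d) (simp_all add: symm_upto_cst)

lemma symm_closed:
  fixes s t :: "'k::comm_ring_1 lfun"
  shows "symm (1 :: 'k lfun)" "symm (0 :: 'k lfun)" "symm s \<Longrightarrow> symm t \<Longrightarrow> symm (s + t)" "symm s \<Longrightarrow> symm (cst c * s)"
  "symm s \<Longrightarrow> symm (E k s)" "symm s \<Longrightarrow> symm (H \<phi> n s)" "symm s \<Longrightarrow> symm (F \<phi> n s)"
proof -
  have sub: "symm_upto d (u - v)" if "symm_upto d u" "symm_upto d v" for d and u v :: "'k lfun"
    using symm_upto_add[OF that(1) symm_upto_mult[OF symm_upto_cst[of d "- 1"] that(2)]]
    by (simp add: cst_uminus)
  show "symm (1::'k lfun)" using symm_upto_cst[of _ "1::'k"] by (simp add: symm_def)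
  show "symm (0::'k lfun)" by (simp add: symm_def symm_upto_0)
  show "symm (s + t)" if "symm s" "symm t" using that by (simp add: symm_def symm_upto_add)
  show "symm (cst c * s)" if "symm s"
    using that by (simp add: symm_def symm_upto_mult symm_upto_cst)
  show "symm (E k s)" if "symm s" using that unfolding symm_def by (metis symm_upto.simps(2))
  show "symm (H \<phi> n s)" if "symm s"
    using that by (simp add: symm_def H_def sub symm_upto_mult symm_upto_cst symm_upto_numeral
        symm_upto_DH)
  show "symm (F \<phi> n s)" if "symm s"
    using that by (simp add: symm_def F_def sub symm_upto_mult symm_upto_PF symm_upto_DF)
qed

lemma symm_E_E: "symm s \<Longrightarrow> E k (E l s) = E l (E k s)"
  unfolding symm_def by (metis symm_upto.simps(2))

section \<open>The tensor module\<close>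

abbreviation (input) "lookup \<equiv> Poly_Mapping.lookup"
abbreviation (input) "keys \<equiv> Poly_Mapping.keys"

lemma vector_space_cst: "vector_space (\<lambda>c (s::'k::field lfun). cst c * s)"
  by unfold_locales (simp_all add: algebra_simps cst_add cst_mult)

lemma lookup_pscale [simp]: "lookup (pscale c p) x = c * lookup p x"
  by (simp add: pscale_def Poly_Mapping.map.rep_eq when_def)

lemma pscale_zero [simp]: "pscale c 0 = 0" "pscale 0 p = 0"
  by (rule poly_mapping_eqI, simp)+

lemma vector_space_pscale: "vector_space pscale"
  by unfold_locales (rule poly_mapping_eqI, simp add: lookup_add algebra_simps)+

definition tscale :: "'k::field \<Rightarrow> (gen list \<Rightarrow>\<^sub>0 'k laurent) \<Rightarrow> (gen list \<Rightarrow>\<^sub>0 'k laurent)" where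
  "tscale c = Poly_Mapping.map (pscale c)"

lemma lookup_tscale [simp]: "lookup (tscale c u) w = pscale c (lookup u w)"
  by (simp add: tscale_def Poly_Mapping.map.rep_eq when_def)

lemma vector_space_tscale: "vector_space tscale"
  by unfold_locales ((rule poly_mapping_eqI, simp add: lookup_add algebra_simps)+)

global_interpretation pscale: vector_space pscale by (rule vector_space_pscale)

global_interpretation tscale: vector_space tscale by (rule vector_space_tscale)

text \<open>The usual separation of eigenvectors with distinct eigenvalues, carried out modulo a
  stable subspace: \<open>D - e j\<close> removes one summand and rescales each of the others by a
  nonzero scalar.\<close>

lemma eigen_split:
  fixes sc :: "'k::field \<Rightarrow> 'v::ab_group_add \<Rightarrow> 'v"
  assumes "vector_space sc" and sub: "module.subspace sc W"
    and D: "\<And>x y. D (x + y) = D x + D y"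
    and Ds: "\<And>c x. D (sc c x) = sc c (D x)" and DW: "\<And>w. w \<in> W \<Longrightarrow> D w \<in> W"
    and "finite A" and "inj_on e A" and "(\<Sum>i\<in>A. v i) \<in> W"
    and "\<And>i. i \<in> A \<Longrightarrow> D (v i) - sc (e i) (v i) \<in> W"
    and "i \<in> A"
  shows "v i \<in> W"
proof -
  interpret V: vector_space sc by fact
  have D0: "D 0 = 0" using D[of 0 0] by simp
  have "\<forall>i\<in>A. v i \<in> W" using assms(6-9)
  proof (induction A arbitrary: v)
    case (insert j A)
    \<comment> \<open>Modulo \<open>W\<close> this is what \<open>D - e j\<close> makes of
      \<open>v i\<close>. Working with the scalar multiple keeps the summands eigenvectors for the
      induction hypothesis.\<close>
    define v' where "v' = (\<lambda>i. sc (e i - e j) (v i))"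
    have DS: "D (\<Sum>i\<in>B. v i) = (\<Sum>i\<in>B. D (v i))" for B
      by (induction B rule: infinite_finite_induct) (simp_all add: D D0)
    let ?s = "\<Sum>i\<in>insert j A. v i"
    have "D ?s - sc (e j) ?s - (\<Sum>i\<in>insert j A. D (v i) - sc (e i) (v i)) \<in> W"
      by (intro V.subspace_diff[OF sub] DW insert.prems(2) V.subspace_scale[OF sub insert.prems(2)]
          V.subspace_sum[OF sub] insert.prems(3))
    also have "D ?s - sc (e j) ?s - (\<Sum>i\<in>insert j A. D (v i) - sc (e i) (v i)) =
        (\<Sum>i\<in>insert j A. v' i)"
      unfolding DS V.scale_sum_right sum_subtractf[symmetric]
      by (intro sum.cong) (simp_all add: v'_def V.scale_left_diff_distrib)
    finally have s: "(\<Sum>i\<in>A. v' i) \<in> W" using insert.hyps by (simp add: v'_def)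
    have e': "D (v' i) - sc (e i) (v' i) \<in> W" if "i \<in> A" for i
    proof -
      have "D (v' i) - sc (e i) (v' i) = sc (e i - e j) (D (v i) - sc (e i) (v i))"
        by (simp add: v'_def Ds V.scale_right_diff_distrib mult.commute)
      then show ?thesis using insert.prems(3)[of i] that V.subspace_scale[OF sub] by simp
    qed
    have "v' i \<in> W" if "i \<in> A" for i
      using insert.IH[of v'] e' s insert.prems(1) that by (simp add: inj_on_insert)
    then have "sc (inverse (e i - e j)) (v' i) \<in> W" if "i \<in> A" for i
      using that V.subspace_scale[OF sub] by blast
    moreover have "sc (inverse (e i - e j)) (v' i) = v i" if "i \<in> A" for i
    proof -
      have "e i \<noteq> e j" using that insert.prems(1) insert.hyps by (auto simp: inj_on_def)
      then show ?thesis by (simp add: v'_def)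
    qed
    ultimately have "\<forall>i\<in>A. v i \<in> W" by metis
    moreover from this have "v j \<in> W"
      using V.subspace_diff[OF sub insert.prems(2), of "\<Sum>i\<in>A. v i"] V.subspace_sum[OF sub, of A v]
        insert.hyps by simp
    ultimately show ?case by simp
  qed simp
  then show ?thesis using assms(10) by blast
qed

lemma lookup_left_mult:
  "lookup (left_mult x u) [] = 0"
  "lookup (left_mult x u) (a # w) = pscale (lookup x a) (lookup u w)"
proof -
  show "lookup (left_mult x u) [] = 0"
    by (simp add: left_mult_def lookup_sum lookup_single)
  have "lookup (left_mult x u) (a # w) =
      (\<Sum>b\<in>keys x. \<Sum>w'\<in>keys u. (pscale (lookup x b) (lookup u w') when w' = w) when b = a)"
    by (auto simp: left_mult_def lookup_sum lookup_single when_def intro!: sum.cong)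
  also have "\<dots> = (\<Sum>b\<in>keys x. (pscale (lookup x b) (lookup u w)) when b = a)"
    by (intro sum.cong refl) (auto simp: when_def sum.delta in_keys_iff)
  also have "\<dots> = pscale (lookup x a) (lookup u w)"
    by (auto simp: when_def sum.delta in_keys_iff)
  finally show "lookup (left_mult x u) (a # w) = pscale (lookup x a) (lookup u w)" .
qed

lemma left_mult_linear:
  "left_mult x (u + v) = left_mult x u + left_mult x v"
  "left_mult x (tscale c u) = tscale c (left_mult x u)"
  "left_mult (x + y) u = left_mult x u + left_mult y u"
  "left_mult (pscale c x) u = tscale c (left_mult x u)"
  "left_mult 0 u = 0" "left_mult x 0 = 0"
  by (rule poly_mapping_eqI; rename_tac w, case_tac w;
      simp add: lookup_left_mult lookup_add pscale.scale_right_distrib pscale.scale_left_distrib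
        mult.commute)+

lemma left_mult_diff: "left_mult x (u - v) = left_mult x u - left_mult x v"
  by (simp add: eq_diff_eq flip: left_mult_linear(1))

lemma left_mult_single:
  "left_mult (Poly_Mapping.single a c) (Poly_Mapping.single w v) =
    Poly_Mapping.single (a # w) (pscale c v)"
  by (rule poly_mapping_eqI; rename_tac w', case_tac w';
      simp add: lookup_left_mult lookup_single when_def)

lemma left_mult_keys:
  "left_mult x u = (\<Sum>a\<in>keys x. tscale (lookup x a) (left_mult (Poly_Mapping.single a 1) u))"
proof (rule poly_mapping_eqI)
  fix w
  show "lookup (left_mult x u) w =
    lookup (\<Sum>a\<in>keys x. tscale (lookup x a) (left_mult (Poly_Mapping.single a 1) u)) w"
  proof (cases w)
    case (Cons b w')
    have "(\<Sum>a\<in>keys x. pscale (lookup x a) (pscale (lookup (Poly_Mapping.single a 1) b) (lookup u w')))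
       = (\<Sum>a\<in>keys x. if a = b then pscale (lookup x a) (lookup u w') else 0)"
      by (intro sum.cong refl) (simp add: lookup_single when_def)
    then show ?thesis
      by (simp add: Cons lookup_left_mult lookup_sum sum.delta in_keys_iff)
  qed (simp add: lookup_left_mult lookup_sum)
qed

lemma poly_mapping_sum_singles: "p = (\<Sum>k\<in>keys p. Poly_Mapping.single k (lookup p k))"
  by (rule poly_mapping_eqI) (simp add: lookup_sum lookup_single when_def sum.delta in_keys_iff)

definition lact :: "(int \<Rightarrow> 'k::field) \<Rightarrow> gen \<Rightarrow> 'k laurent \<Rightarrow> 'k laurent" where
  "lact \<phi> a p = (\<Sum>n\<in>keys p. pscale (lookup p n) (gen_laurent_act \<phi> a n))"

lemma act_laurent_module:
  "act (laurent_module \<phi>) x p = (\<Sum>a\<in>keys x. pscale (lookup x a) (lact \<phi> a p))"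
  by (simp add: laurent_module_def lact_def pscale.scale_sum_right)

lemma lookup_lact [simp]:
  "lookup (lact \<phi> (gen_h m) p) n = \<phi> m * lookup p (n - m)"
  "lookup (lact \<phi> gen_d p) n = of_int n * lookup p n"
  "lact \<phi> (gen_e m) p = 0" "lact \<phi> (gen_f m) p = 0"
proof -
  have "lookup (lact \<phi> (gen_h m) p) n = (\<Sum>i\<in>keys p. if i = n - m then lookup p i * \<phi> m else 0)"
    unfolding lact_def lookup_sum
    by (intro sum.cong refl) (auto simp: lookup_single when_def)
  then show "lookup (lact \<phi> (gen_h m) p) n = \<phi> m * lookup p (n - m)"
    by (simp add: sum.delta in_keys_iff)
  have "lookup (lact \<phi> gen_d p) n = (\<Sum>i\<in>keys p. if i = n then lookup p i * of_int i else 0)"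
    unfolding lact_def lookup_sum
    by (intro sum.cong refl) (auto simp: lookup_single when_def)
  then show "lookup (lact \<phi> gen_d p) n = of_int n * lookup p n"
    by (simp add: sum.delta in_keys_iff)
qed (simp_all add: lact_def)

lemma lact_linear:
  "lact \<phi> a (p + q) = lact \<phi> a p + lact \<phi> a q"
  "lact \<phi> a (pscale c p) = pscale c (lact \<phi> a p)"
  by (cases a; rule poly_mapping_eqI; simp add: lookup_add algebra_simps)+

lemma gmod_laurent: "gmod (laurent_module \<phi>)"
proof (rule gmodI)
  fix u :: "'a laurent"
  show "\<exists>v\<in>carrier (laurent_module \<phi>). u \<oplus>\<^bsub>laurent_module \<phi>\<^esub> v = \<zero>\<^bsub>laurent_module \<phi>\<^esub>"
    by (rule bexI[of _ "- u"]) (simp_all add: laurent_module_def)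
  show "act (laurent_module \<phi>) x (u \<oplus>\<^bsub>laurent_module \<phi>\<^esub> v) =
      act (laurent_module \<phi>) x u \<oplus>\<^bsub>laurent_module \<phi>\<^esub> act (laurent_module \<phi>) x v" for x v
    unfolding act_laurent_module
    by (simp add: laurent_module_def lact_linear pscale.scale_right_distrib sum.distrib)
  show "act (laurent_module \<phi>) x (c \<odot>\<^bsub>laurent_module \<phi>\<^esub> u) =
      c \<odot>\<^bsub>laurent_module \<phi>\<^esub> act (laurent_module \<phi>) x u" for x c
    unfolding act_laurent_module
    by (simp add: laurent_module_def lact_linear pscale.scale_sum_right mult.commute)
qed (simp_all add: laurent_module_def algebra_simps pscale.scale_left_distrib
      pscale.scale_right_distrib)

locale sl2_loop =
  fixes \<phi> :: "int \<Rightarrow> 'k::field_char_0" and r :: nat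
  assumes r_pos: "r > 0"
    and support: "add_submonoid {m. \<phi> m \<noteq> 0} = {int r * k |k. True}"
begin

lemma phi_dvd: "\<phi> m \<noteq> 0 \<Longrightarrow> int r dvd m"
  using add_submonoid.base[of m "{m. \<phi> m \<noteq> 0}"] support by auto

text \<open>The Laurent polynomials in t^r; \<open>carrier_H\<close> identifies them with
  H(\<phi>).\<close>

definition C :: "'k laurent set" where
  "C = {p. \<forall>n. lookup p n \<noteq> 0 \<longrightarrow> int r dvd n}"

lemma C_zero [simp]: "0 \<in> C"
  by (simp add: C_def)

lemma C_add [simp]: "p \<in> C \<Longrightarrow> q \<in> C \<Longrightarrow> p + q \<in> C"
  unfolding C_def by (auto simp: lookup_add) (metis add.right_neutral)

lemma C_pscale [simp]: "p \<in> C \<Longrightarrow> pscale c p \<in> C"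
  by (auto simp: C_def)

lemma C_sum [simp]: "(\<And>i. i \<in> A \<Longrightarrow> f i \<in> C) \<Longrightarrow> (\<Sum>i\<in>A. f i) \<in> C"
  by (induction A rule: infinite_finite_induct) simp_all

lemma C_single [simp]: "int r dvd n \<Longrightarrow> Poly_Mapping.single n c \<in> C"
  by (auto simp: C_def lookup_single when_def split: if_splits)

lemma C_lact [simp]: "p \<in> C \<Longrightarrow> lact \<phi> a p \<in> C"
proof (cases a)
  case (gen_h m)
  assume p: "p \<in> C"
  show ?thesis unfolding gen_h C_def
  proof (clarsimp)
    fix n assume "\<phi> m \<noteq> 0" "lookup p (n - m) \<noteq> 0"
    then have "int r dvd m" "int r dvd n - m" using phi_dvd p by (auto simp: C_def)
    then show "int r dvd n" using dvd_add by fastforce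
  qed
qed (auto simp: C_def)

text \<open>The eigenvalues of d on the powers of t are distinct, so a nonzero vector of
  \<open>W\<close> yields a single power. From there h(x) with \<open>\<phi> x\<close> nonzero
  shifts the exponent by x, and these shifts reach every multiple of r.\<close>

lemma laurent_irreducible:
  assumes W: "pscale.subspace W" and h: "\<And>m p. p \<in> W \<Longrightarrow> lact \<phi> (gen_h m) p \<in> W"
    and d: "\<And>p. p \<in> W \<Longrightarrow> lact \<phi> gen_d p \<in> W"
    and v: "v \<in> W" "v \<in> C" "v \<noteq> 0"
  shows "C \<subseteq> W"
proof -
  obtain n where n: "lookup v n \<noteq> 0" using v(3) by (metis poly_mapping_eqI lookup_zero)
  have nv: "int r dvd n" using v(2) n by (simp add: C_def)
  have "Poly_Mapping.single n (lookup v n) \<in> W"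
  proof (rule eigen_split[of pscale W "lact \<phi> gen_d" "keys v" of_int "\<lambda>i. Poly_Mapping.single i (lookup v i)"])
    show "lact \<phi> gen_d (Poly_Mapping.single i (lookup v i)) -
        pscale (of_int i) (Poly_Mapping.single i (lookup v i)) \<in> W" for i
    proof -
      have "lact \<phi> gen_d (Poly_Mapping.single i (lookup v i)) -
        pscale (of_int i) (Poly_Mapping.single i (lookup v i)) = 0"
        by (rule poly_mapping_eqI) (simp add: lookup_minus lookup_single when_def)
      then show ?thesis using pscale.subspace_0[OF W] by simp
    qed
  qed (use W d v n in \<open>simp_all add: vector_space_pscale lact_linear in_keys_iff inj_on_def
        flip: poly_mapping_sum_singles\<close>)
  then have "pscale (inverse (lookup v n)) (Poly_Mapping.single n (lookup v n)) \<in> W"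
    by (rule pscale.subspace_scale[OF W])
  also have "pscale (inverse (lookup v n)) (Poly_Mapping.single n (lookup v n)) =
      Poly_Mapping.single n 1"
    using n by (intro poly_mapping_eqI) (auto simp: lookup_single when_def)
  finally have n1: "Poly_Mapping.single n 1 \<in> W" .
  \<comment> \<open>Sums of support elements suffice, without inverses: the support generates all of
    r\<int> already as a monoid, so shifts in both directions are available.\<close>
  have step: "Poly_Mapping.single (n + x) 1 \<in> W"
    if "x \<in> add_submonoid {m. \<phi> m \<noteq> 0}" "Poly_Mapping.single n 1 \<in> W" for x n
    using that
  proof (induction x arbitrary: n)
    case (base x)
    have "pscale (inverse (\<phi> x)) (lact \<phi> (gen_h x) (Poly_Mapping.single n 1)) \<in> W"
      using base h by (intro pscale.subspace_scale[OF W]) auto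
    also have "pscale (inverse (\<phi> x)) (lact \<phi> (gen_h x) (Poly_Mapping.single n 1)) =
        Poly_Mapping.single (n + x) 1"
      using base by (intro poly_mapping_eqI) (auto simp: lookup_single when_def)
    finally show ?case .
  next
    case (add x y)
    then show ?case by (metis add.assoc)
  qed simp
  have all: "Poly_Mapping.single m 1 \<in> W" if "int r dvd m" for m
  proof -
    have "m - n \<in> add_submonoid {m. \<phi> m \<noteq> 0}"
      unfolding support using that nv by (auto elim!: dvdE simp flip: right_diff_distrib)
    from step[OF this n1] show ?thesis by simp
  qed
  show "C \<subseteq> W"
  proof
    fix p assume p: "p \<in> C"
    have "(\<Sum>k\<in>keys p. pscale (lookup p k) (Poly_Mapping.single k 1)) \<in> W"
      using p by (intro pscale.subspace_sum[OF W] pscale.subspace_scale[OF W] all)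
        (auto simp: C_def in_keys_iff)
    also have "(\<Sum>k\<in>keys p. pscale (lookup p k) (Poly_Mapping.single k 1)) =
        (\<Sum>k\<in>keys p. Poly_Mapping.single k (lookup p k))"
      by (intro sum.cong refl poly_mapping_eqI) (simp add: lookup_single when_def)
    finally show "p \<in> W" by (simp flip: poly_mapping_sum_singles)
  qed
qed

lemma stable_laurent_iff:
  "stable_submodule t_sub (laurent_module \<phi>) W \<longleftrightarrow> pscale.subspace W \<and>
    (\<forall>p\<in>W. lact \<phi> gen_d p \<in> W \<and> (\<forall>m. lact \<phi> (gen_h m) p \<in> W))" (is "?L = ?R")
proof
  assume L: ?L
  have s: "act (laurent_module \<phi>) (Poly_Mapping.single a 1) p = lact \<phi> a p" for a p
    by (simp add: act_laurent_module)
  have "lact \<phi> a p \<in> W" if "p \<in> W" "a \<in> range gen_h \<union> {gen_d}" for a p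
    using L that unfolding stable_submodule_def
    by (auto simp: t_sub_def simp flip: s)
  moreover have "pscale.subspace W"
    using L unfolding stable_submodule_def
    by (intro pscale.subspaceI) (auto simp: laurent_module_def dest: submodule.m_closed
       submodule.zero_closed submodule.smult_closed)
  ultimately show ?R by auto
next
  assume R: ?R
  then have W: "pscale.subspace W" by simp
  interpret L: gmod "laurent_module \<phi>" by (rule gmod_laurent)
  show ?L unfolding stable_submodule_def
  proof (intro conjI submodule.intro ballI)
    fix x :: "'k gtilde" and w assume x: "x \<in> t_sub" and w: "w \<in> W"
    show "act (laurent_module \<phi>) x w \<in> W" unfolding act_laurent_module
      by (intro pscale.subspace_sum[OF W] pscale.subspace_scale[OF W])
        (use R x w in \<open>auto simp: t_sub_def\<close>)
  qed (use L.module_axioms pscale.subspace_0[OF W] pscale.subspace_add[OF W]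
      pscale.subspace_scale[OF W] in \<open>auto simp: laurent_module_def\<close>)
qed

lemma one_C: "1 \<in> C"
  by (metis C_single dvd_0_right single_one)

lemma carrier_H: "carrier (H_module \<phi>) = C"
proof -
  have "stable_submodule t_sub (laurent_module \<phi>) C"
    unfolding stable_laurent_iff by (auto intro: pscale.subspaceI)
  moreover have "C \<subseteq> W" if "stable_submodule t_sub (laurent_module \<phi>) W" "1 \<in> W" for W
    using that one_C unfolding stable_laurent_iff
    by (intro laurent_irreducible[of W 1]) auto
  ultimately show ?thesis
    using one_C by (auto simp: H_module_def generated_submodule_def)
qed

lemma act_H: "act (H_module \<phi>) = act (laurent_module \<phi>)"
  by (simp add: H_module_def)

abbreviation "T \<equiv> tensor_module \<phi>"

lemma carrier_T: "carrier T = {u. \<forall>w. lookup u w \<in> C}"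
  by (simp add: tensor_module_def carrier_H)

lemma T_simps [simp]:
  "\<zero>\<^bsub>T\<^esub> = 0" "u \<oplus>\<^bsub>T\<^esub> v = u + v" "c \<odot>\<^bsub>T\<^esub> u = tscale c u" "act T = left_mult"
  by (simp_all add: tensor_module_def tscale_def)

lemma T_closed:
  "0 \<in> carrier T" "u \<in> carrier T \<Longrightarrow> v \<in> carrier T \<Longrightarrow> u + v \<in> carrier T"
  "u \<in> carrier T \<Longrightarrow> tscale c u \<in> carrier T"
  "u \<in> carrier T \<Longrightarrow> left_mult x u \<in> carrier T"
  "p \<in> C \<Longrightarrow> Poly_Mapping.single w p \<in> carrier T"
proof -
  show "left_mult x u \<in> carrier T" if "u \<in> carrier T"
    unfolding carrier_T
  proof clarify
    show "lookup (left_mult x u) w \<in> C" for w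
      using that by (cases w) (simp_all add: lookup_left_mult carrier_T)
  qed
qed (auto simp: carrier_T lookup_add lookup_single when_def)

lemma gmod_T: "gmod T"
proof (rule gmodI)
  fix u assume "u \<in> carrier T"
  then show "\<exists>v\<in>carrier T. u \<oplus>\<^bsub>T\<^esub> v = \<zero>\<^bsub>T\<^esub>"
    using T_closed(3)[of u "- 1"] by (intro bexI[of _ "tscale (- 1) u"]) simp_all
qed (simp_all add: T_closed algebra_simps left_mult_linear tscale.scale_left_distrib
    tscale.scale_right_distrib)

lemma stable_T_iff:
  "stable_submodule UNIV T U \<longleftrightarrow> U \<subseteq> carrier T \<and> tscale.subspace U \<and>
    (\<forall>x. \<forall>u\<in>U. left_mult x u \<in> U)"
proof -
  interpret gmod T by (rule gmod_T)
  show ?thesis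
    unfolding stable_submodule_def submodule_def tscale.subspace_def
    using module_axioms by auto
qed

end

text \<open>In each case the bracket is a multiple of a single generator, so commuting a letter past
  an f leaves one letter in front of a shorter word.\<close>

lemma gen_bracket_f:
  assumes "a = gen_d \<or> a \<in> range gen_e \<union> range gen_h"
  shows "\<exists>b c. gen_bracket a (gen_f i) = Poly_Mapping.single b (c :: 'k::field) \<and>
    (b \<in> range gen_f \<union> range gen_h)"
proof -
  consider "a = gen_d" | k where "a = gen_e k" | k where "a = gen_h k" using assms by auto
  then show ?thesis
  proof cases
    case 1
    then show ?thesis by (intro exI[of _ "gen_f i"] exI[of _ "of_int i"]) simp
  next
    case (2 k)
    then show ?thesis by (intro exI[of _ "gen_h (k + i)"] exI[of _ 1]) simp
  next
    case (3 k)
    then show ?thesis by (intro exI[of _ "gen_f (k + i)"] exI[of _ "- 2"]) simp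
  qed
qed

lemma bracket_single:
  "bracket (Poly_Mapping.single a 1) (Poly_Mapping.single b 1) = (gen_bracket a b :: 'k::field gtilde)"
  by (simp add: bracket_def)

section \<open>The maximal submodule\<close>

text \<open>The argument \<open>n\<close> of \<open>S\<close> keeps track of the degree with respect to \<open>gen_d\<close>, so that \<open>S\<close> stands for
  \<open>\<Sum>\<^sub>n S n \<otimes> t\<^sup>n\<close>.\<close>

fun gact :: "(int \<Rightarrow> 'k::field_char_0) \<Rightarrow> gen \<Rightarrow> (int \<Rightarrow> 'k lfun) \<Rightarrow> int \<Rightarrow> 'k lfun" where
  "gact \<phi> (gen_e k) S n = E k (S (n - k))"
| "gact \<phi> (gen_h k) S n = H \<phi> k (S (n - k))"
| "gact \<phi> (gen_f k) S n = F \<phi> k (S (n - k))"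
| "gact \<phi> gen_d S n = cst (of_int n) * S n"

fun wact :: "(int \<Rightarrow> 'k::field_char_0) \<Rightarrow> gen list \<Rightarrow> (int \<Rightarrow> 'k lfun) \<Rightarrow> int \<Rightarrow> 'k lfun" where
  "wact \<phi> [] S = S"
| "wact \<phi> (a # w) S = gact \<phi> a (wact \<phi> w S)"

lemma gact_linear:
  "gact \<phi> a (\<lambda>n. S n + S' n) n = gact \<phi> a S n + gact \<phi> a S' n"
  "gact \<phi> a (\<lambda>n. cst c * S n) n = cst c * gact \<phi> a S n"
  by (cases a; simp add: HF_linear algebra_simps)+

lemma gact_add: "gact \<phi> a (\<lambda>n. S n + S' n) = (\<lambda>n. gact \<phi> a S n + gact \<phi> a S' n)"
  and gact_scale: "gact \<phi> a (\<lambda>n. cst c * S n) = (\<lambda>n. cst c * gact \<phi> a S n)"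
  by (rule ext, rule gact_linear)+

lemma gact_sum: "gact \<phi> a (\<lambda>n. \<Sum>i\<in>A. cst (c i) * S i n) n = (\<Sum>i\<in>A. cst (c i) * gact \<phi> a (S i) n)"
proof (induction A rule: infinite_finite_induct)
  case (insert i A)
  then show ?case by (simp add: gact_linear)
next
  case empty
  show ?case using gact_linear(2)[of \<phi> a 0 "\<lambda>_. 0" n] by simp
next
  case (infinite A)
  then show ?case using gact_linear(2)[of \<phi> a 0 "\<lambda>_. 0" n] by simp
qed

lemma wact_add: "wact \<phi> w (\<lambda>n. S n + S' n) = (\<lambda>n. wact \<phi> w S n + wact \<phi> w S' n)"
  and wact_scale: "wact \<phi> w (\<lambda>n. cst c * S n) = (\<lambda>n. cst c * wact \<phi> w S n)"
  by (induction w) (simp_all add: gact_add gact_scale)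

definition vac :: "'k::field_char_0 laurent \<Rightarrow> int \<Rightarrow> 'k lfun" where
  "vac p = (\<lambda>n. cst (lookup p n))"

text \<open>The map from T \<otimes> H to matrix coefficients. Each e(k) raises the degree by k, so
  \<open>ev (rep \<phi> u n) ks\<close> is the coefficient of t^(n + \<open>sum_list ks\<close>) in
  the top component after raising by the entries of \<open>ks\<close>.\<close>

definition rep :: "(int \<Rightarrow> 'k::field_char_0) \<Rightarrow> (gen list \<Rightarrow>\<^sub>0 'k laurent) \<Rightarrow> int \<Rightarrow> 'k lfun" where
  "rep \<phi> u n = (\<Sum>w\<in>keys u. wact \<phi> w (vac (lookup u w)) n)"

definition xact :: "(int \<Rightarrow> 'k::field_char_0) \<Rightarrow> 'k gtilde \<Rightarrow> (int \<Rightarrow> 'k lfun) \<Rightarrow> int \<Rightarrow> 'k lfun" where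
  "xact \<phi> x S n = (\<Sum>a\<in>keys x. cst (lookup x a) * gact \<phi> a S n)"

lemma vac_add: "vac (p + q) = (\<lambda>n. vac p n + vac q n)"
  and vac_pscale: "vac (pscale c p) = (\<lambda>n. cst c * vac p n)"
  and vac_zero: "vac 0 = (\<lambda>n. 0)"
  by (simp_all add: vac_def lookup_add cst_add cst_mult)

lemma wact_vac_zero: "wact \<phi> w (vac 0) = (\<lambda>n. 0)"
  using wact_scale[of \<phi> w 0 "\<lambda>n. 0"] by (simp add: vac_zero)

lemma rep_superset:
  "finite A \<Longrightarrow> keys u \<subseteq> A \<Longrightarrow> rep \<phi> u n = (\<Sum>w\<in>A. wact \<phi> w (vac (lookup u w)) n)"
  unfolding rep_def by (rule sum.mono_neutral_left) (auto simp: in_keys_iff wact_vac_zero)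

lemma rep_add: "rep \<phi> (u + v) n = rep \<phi> u n + rep \<phi> v n"
proof -
  have "keys (u + v) \<subseteq> keys u \<union> keys v" by (rule keys_add)
  then show ?thesis
    by (simp add: rep_superset[of "keys u \<union> keys v"] lookup_add vac_add wact_add sum.distrib)
qed

lemma rep_tscale: "rep \<phi> (tscale c u) n = cst c * rep \<phi> u n"
proof -
  have "keys (tscale c u) \<subseteq> keys u" by (auto simp: in_keys_iff)
  then have "rep \<phi> (tscale c u) n = (\<Sum>w\<in>keys u. wact \<phi> w (vac (lookup (tscale c u) w)) n)"
    by (rule rep_superset[rotated]) simp
  then show ?thesis by (simp add: rep_def vac_pscale wact_scale sum_distrib_left)
qed

lemma rep_zero: "rep \<phi> 0 n = 0"
  by (simp add: rep_def)

lemma rep_diff: "rep \<phi> (u - v) n = rep \<phi> u n - rep \<phi> v n"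
  using rep_add[of \<phi> "u - v" v n] by (simp add: eq_diff_eq)

lemma rep_sum: "rep \<phi> (\<Sum>i\<in>A. f i) n = (\<Sum>i\<in>A. rep \<phi> (f i) n)"
  by (induction A rule: infinite_finite_induct) (simp_all add: rep_add rep_zero)

lemma rep_single: "rep \<phi> (Poly_Mapping.single w p) n = wact \<phi> w (vac p) n"
  by (simp add: rep_def wact_vac_zero)

lemma rep_left_mult: "rep \<phi> (left_mult x u) n = xact \<phi> x (rep \<phi> u) n"
proof -
  have gen: "rep \<phi> (left_mult (Poly_Mapping.single a 1) u) n = gact \<phi> a (rep \<phi> u) n" for a
  proof -
    have "left_mult (Poly_Mapping.single a 1) u =
        (\<Sum>w\<in>keys u. left_mult (Poly_Mapping.single a 1) (Poly_Mapping.single w (lookup u w)))"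
    proof -
      have "left_mult x (\<Sum>w\<in>A. f w) = (\<Sum>w\<in>A. left_mult x (f w))" for x :: "'a gtilde" and A and f :: "gen list \<Rightarrow> _"
        by (induction A rule: infinite_finite_induct) (simp_all add: left_mult_linear)
      then show ?thesis by (metis poly_mapping_sum_singles)
    qed
    then have "rep \<phi> (left_mult (Poly_Mapping.single a 1) u) n =
        (\<Sum>w\<in>keys u. gact \<phi> a (wact \<phi> w (vac (lookup u w))) n)"
      by (simp add: rep_sum left_mult_single rep_single)
    also have "\<dots> = gact \<phi> a (rep \<phi> u) n"
      using gact_sum[of \<phi> a "\<lambda>_. 1" "\<lambda>w. wact \<phi> w (vac (lookup u w))" "keys u" n]
      by (simp add: rep_def[abs_def])
    finally show ?thesis .
  qed
  show ?thesis
    by (subst left_mult_keys) (simp add: rep_sum rep_tscale gen xact_def)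
qed

lemma xact_superset:
  "finite A \<Longrightarrow> keys x \<subseteq> A \<Longrightarrow> xact \<phi> x S n = (\<Sum>a\<in>A. cst (lookup x a) * gact \<phi> a S n)"
  unfolding xact_def by (rule sum.mono_neutral_left) (auto simp: in_keys_iff)

lemma xact_add: "xact \<phi> (x + y) S n = xact \<phi> x S n + xact \<phi> y S n"
proof -
  have "keys (x + y) \<subseteq> keys x \<union> keys y" by (rule keys_add)
  then show ?thesis
    by (simp add: xact_superset[of "keys x \<union> keys y"] lookup_add cst_add algebra_simps sum.distrib)
qed

lemma xact_pscale: "xact \<phi> (pscale c x) S n = cst c * xact \<phi> x S n"
proof -
  have "keys (pscale c x) \<subseteq> keys x" by (auto simp: in_keys_iff)
  then have "xact \<phi> (pscale c x) S n = (\<Sum>a\<in>keys x. cst (lookup (pscale c x) a) * gact \<phi> a S n)"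
    by (rule xact_superset[rotated]) simp
  then show ?thesis by (simp add: xact_def cst_mult sum_distrib_left mult.assoc)
qed

lemma xact_zero: "xact \<phi> 0 S n = 0"
  by (simp add: xact_def)

lemma xact_sum: "xact \<phi> (\<Sum>i\<in>A. f i) S n = (\<Sum>i\<in>A. xact \<phi> (f i) S n)"
  by (induction A rule: infinite_finite_induct) (simp_all add: xact_add xact_zero)

lemma xact_single: "xact \<phi> (Poly_Mapping.single a c) S n = cst c * gact \<phi> a S n"
  by (simp add: xact_def)

text \<open>Symmetry of \<open>S\<close> enters in the case of two raising generators; the other
  cases are the relations already established for \<open>E\<close>, \<open>H\<close> and
  \<open>F\<close>.\<close>

lemma gact_commutator:
  assumes "\<And>n. symm (S n)"
  shows "gact \<phi> a (gact \<phi> b S) n - gact \<phi> b (gact \<phi> a S) n = xact \<phi> (gen_bracket a b) S n"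
proof -
  have c2: "cst 2 = (2 :: 'a lfun)" by (rule cst_numeral)
  have c1: "cst (- 1) = (- 1 :: 'a lfun)" "cst (- 2) = (- 2 :: 'a lfun)"
    by (simp_all add: cst_uminus c2)
  note EE = symm_E_E[OF assms]
  show ?thesis
    by (cases a; cases b;
      simp add: xact_single xact_zero E_H E_F H_F c1 c2 HF_linear HF_linear2 EE cst_uminus cst_diff cst_add
        algebra_simps H_H F_F)
qed

lemma symm_gact: "(\<And>n. symm (S n)) \<Longrightarrow> symm (gact \<phi> a S n)"
  by (cases a) (simp_all add: symm_closed)

lemma symm_wact: "(\<And>n. symm (S n)) \<Longrightarrow> symm (wact \<phi> w S n)"
  by (induction w arbitrary: n) (simp_all add: symm_gact)

lemma symm_rep: "symm (rep \<phi> u n)"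
proof -
  have "symm (cst c)" for c :: 'a
    using symm_closed(4)[OF symm_closed(1), of c] by simp
  then have t: "symm (vac p n)" for p :: "'a laurent" and n by (simp add: vac_def)
  have "symm (\<Sum>i\<in>A. f i)" if "\<And>i. symm (f i)" for A and f :: "gen list \<Rightarrow> 'a lfun"
    using that by (induction A rule: infinite_finite_induct) (simp_all add: symm_closed)
  then show ?thesis unfolding rep_def using t by (simp add: symm_wact)
qed

lemma xact_commutator:
  assumes "\<And>n. symm (S n)"
  shows "xact \<phi> x (xact \<phi> y S) n - xact \<phi> y (xact \<phi> x S) n = xact \<phi> (bracket x y) S n"
proof -
  have xx: "xact \<phi> x (xact \<phi> y S) n = (\<Sum>a\<in>keys x. \<Sum>b\<in>keys y.
      cst (lookup x a * lookup y b) * gact \<phi> a (gact \<phi> b S) n)" for x y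
    by (simp add: xact_def[abs_def] gact_sum sum_distrib_left cst_mult mult.assoc)
  have "xact \<phi> y (xact \<phi> x S) n = (\<Sum>a\<in>keys x. \<Sum>b\<in>keys y.
      cst (lookup x a * lookup y b) * gact \<phi> b (gact \<phi> a S) n)"
    unfolding xx by (subst sum.swap) (simp add: mult.commute)
  then have "xact \<phi> x (xact \<phi> y S) n - xact \<phi> y (xact \<phi> x S) n =
      (\<Sum>a\<in>keys x. \<Sum>b\<in>keys y. cst (lookup x a * lookup y b) * xact \<phi> (gen_bracket a b) S n)"
    unfolding xx by (simp add: sum_subtractf[symmetric] right_diff_distrib[symmetric]
        gact_commutator[OF assms])
  then show ?thesis by (simp add: bracket_def xact_sum xact_pscale)
qed

text \<open>Constants are annihilated by every \<open>E k\<close> and every \<open>DH n\<close>, so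
  h(n) contributes the scalar \<open>\<phi> n\<close> together with the shift of the degree, as on
  Laurent polynomials.\<close>

lemma xact_parabolic:
  assumes "x \<in> parabolic"
  shows "xact \<phi> x (vac p) n = vac (act (laurent_module \<phi>) x p) n"
proof -
  have "gact \<phi> a (vac p) n = vac (lact \<phi> a p) n" if "a \<in> range gen_e \<union> range gen_h \<union> {gen_d}" for a
    using that by (auto simp: vac_def H_def cst_mult vac_zero)
  then have "xact \<phi> x (vac p) n = (\<Sum>a\<in>keys x. vac (pscale (lookup x a) (lact \<phi> a p)) n)"
    using assms unfolding xact_def parabolic_def vac_pscale
    by (intro sum.cong refl arg_cong2[where f = "(*)"]) blast
  moreover have "vac (\<Sum>a\<in>A. f a) n = (\<Sum>a\<in>A. vac (f a) n)" for A and f :: "gen \<Rightarrow> 'a laurent"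
    by (induction A rule: infinite_finite_induct) (simp_all add: vac_add vac_zero)
  ultimately show ?thesis by (simp add: act_laurent_module)
qed

section \<open>The kernel of the map to matrix coefficients and the defining relations\<close>

context sl2_loop
begin

definition Z :: "(gen list \<Rightarrow>\<^sub>0 'k laurent) set" where
  "Z = {u \<in> carrier T. \<forall>n. rep \<phi> u n = 0}"

lemma stable_Z: "stable_submodule UNIV T Z"
proof -
  have "xact \<phi> x S n = 0" if "\<And>n. S n = 0" for x S n
  proof -
    have "S = (\<lambda>n. 0)" using that by auto
    then have "gact \<phi> a S n = 0" for a
      using gact_scale[of \<phi> a 0 "\<lambda>n. 0"] by simp
    then show ?thesis by (simp add: xact_def)
  qed
  then show ?thesis unfolding stable_T_iff
    by (auto simp: Z_def T_closed rep_add rep_tscale rep_zero rep_left_mult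
        intro: tscale.subspaceI)
qed

definition R :: "(gen list \<Rightarrow>\<^sub>0 'k laurent) set" where
  "R = generated_submodule UNIV T (induction_relations \<phi>)"

text \<open>With this, the map to matrix coefficients factors through the induced module. The first
  family of relations is respected because every \<open>rep \<phi> u n\<close> is symmetric.\<close>

lemma relations_Z: "induction_relations \<phi> \<subseteq> Z"
proof
  fix u assume "u \<in> induction_relations \<phi>"
  then consider x y v where "v \<in> carrier T"
      "u = left_mult x (left_mult y v) - left_mult y (left_mult x v) - left_mult (bracket x y) v"
    | x p where "x \<in> parabolic" "p \<in> C"
      "u = left_mult x (Poly_Mapping.single [] p) - Poly_Mapping.single [] (act (laurent_module \<phi>) x p)"
    unfolding induction_relations_def carrier_H act_H by blast
  then show "u \<in> Z"
  proof cases
    case 1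
    have d: "u - v \<in> carrier T" if "u \<in> carrier T" "v \<in> carrier T" for u v
      using T_closed(2)[OF that(1) T_closed(3)[OF that(2), of "- 1"]] by simp
    have "rep \<phi> u n = 0" for n
      using xact_commutator[of "rep \<phi> v" \<phi> x y n] symm_rep[of \<phi> v]
      unfolding 1(2) rep_diff rep_left_mult
      by (simp add: rep_left_mult[abs_def])
    then show ?thesis using 1 by (auto simp: Z_def intro!: d T_closed)
  next
    case 2
    have d: "u - v \<in> carrier T" if "u \<in> carrier T" "v \<in> carrier T" for u v
      using T_closed(2)[OF that(1) T_closed(3)[OF that(2), of "- 1"]] by simp
    have "rep \<phi> u n = 0" for n
      using xact_parabolic[OF 2(1), of \<phi> p n]
      unfolding 2(3) rep_diff rep_left_mult
      by (simp add: rep_single[abs_def])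
    moreover have "act (laurent_module \<phi>) x p \<in> C"
      using 2(2) unfolding act_laurent_module by simp
    ultimately show ?thesis using 2 by (auto simp: Z_def intro!: d T_closed)
  qed
qed

lemma R_Z: "R \<subseteq> Z"
  unfolding R_def generated_submodule_def using stable_Z relations_Z by blast

lemma relations_R: "induction_relations \<phi> \<subseteq> R"
  unfolding R_def generated_submodule_def by blast

lemma stable_R: "stable_submodule UNIV T R"
proof -
  have "R \<subseteq> Z" by (rule R_Z)
  then have "R \<subseteq> carrier T" by (auto simp: Z_def)
  moreover have "tscale.subspace R"
    unfolding R_def generated_submodule_def
    by (rule tscale.subspace_Inter) (auto simp: stable_T_iff)
  moreover have "left_mult x u \<in> R" if "u \<in> R" for x u
    using that unfolding R_def generated_submodule_def by (auto simp: stable_T_iff)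
  ultimately show ?thesis by (simp add: stable_T_iff)
qed

abbreviation lm :: "gen \<Rightarrow> (gen list \<Rightarrow>\<^sub>0 'k laurent) \<Rightarrow> (gen list \<Rightarrow>\<^sub>0 'k laurent)" where
  "lm a \<equiv> left_mult (Poly_Mapping.single a 1)"

lemma lm_commutator:
  assumes "u \<in> carrier T"
  shows "lm a (lm b u) - lm b (lm a u) - left_mult (gen_bracket a b) u \<in> R"
proof -
  have "lm a (lm b u) - lm b (lm a u) - left_mult (gen_bracket a b) u \<in> induction_relations \<phi>"
    unfolding induction_relations_def bracket_single[symmetric] using assms by blast
  then show ?thesis using relations_R by blast
qed

lemma lm_Nil:
  assumes "p \<in> C" "a \<in> range gen_e \<union> range gen_h \<union> {gen_d}"
  shows "lm a (Poly_Mapping.single [] p) - Poly_Mapping.single [] (lact \<phi> a p) \<in> R"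
proof -
  have "Poly_Mapping.single a 1 \<in> (parabolic :: 'k gtilde set)"
    using assms(2) by (auto simp: parabolic_def)
  moreover have "act (H_module \<phi>) (Poly_Mapping.single a 1) p = lact \<phi> a p"
    by (simp add: act_H act_laurent_module)
  ultimately have "lm a (Poly_Mapping.single [] p) - Poly_Mapping.single [] (lact \<phi> a p)
      \<in> induction_relations \<phi>"
    using assms(1) unfolding induction_relations_def carrier_H
    by (intro UnI2 CollectI exI[of _ "Poly_Mapping.single a 1"] exI[of _ p]) simp
  then show ?thesis using relations_R by blast
qed

lemma R_subspace: "tscale.subspace R" and R_closed: "u \<in> R \<Longrightarrow> left_mult x u \<in> R"
  and R_carrier: "u \<in> R \<Longrightarrow> u \<in> carrier T"
  using stable_R by (auto simp: stable_T_iff)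

section \<open>Straightening words into products of f's\<close>

definition fspan :: "(gen list \<Rightarrow>\<^sub>0 'k laurent) set" where
  "fspan = {u \<in> carrier T. keys u \<subseteq> lists (range gen_f)}"

text \<open>Vectors congruent, modulo the relations, to a combination of words in the f's alone.
  This is the spanning half of the triangular decomposition of the induced module.\<close>

definition tri :: "(gen list \<Rightarrow>\<^sub>0 'k laurent) set" where
  "tri = {u \<in> carrier T. \<exists>u'\<in>fspan. u - u' \<in> R}"

lemma fspan_add: "u \<in> fspan \<Longrightarrow> v \<in> fspan \<Longrightarrow> u + v \<in> fspan"
  unfolding fspan_def using T_closed(2) keys_add[of u v] by blast

lemma fspan_tscale: "u \<in> fspan \<Longrightarrow> tscale c u \<in> fspan"
  by (auto simp: fspan_def T_closed in_keys_iff subset_iff)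

lemma fspan_zero: "0 \<in> fspan"
  by (simp add: fspan_def T_closed)

lemma fspan_single: "p \<in> C \<Longrightarrow> w \<in> lists (range gen_f) \<Longrightarrow> Poly_Mapping.single w p \<in> fspan"
  by (simp add: fspan_def T_closed)

lemma tri_subspace: "tscale.subspace tri"
proof (rule tscale.subspaceI)
  show "0 \<in> tri" using fspan_zero tscale.subspace_0[OF R_subspace] by (force simp: tri_def T_closed)
  fix u v assume "u \<in> tri" "v \<in> tri"
  then obtain u' v' where *: "u' \<in> fspan" "u - u' \<in> R" "v' \<in> fspan" "v - v' \<in> R"
    and "u \<in> carrier T" "v \<in> carrier T" by (auto simp: tri_def)
  moreover have "(u + v) - (u' + v') \<in> R"
    using tscale.subspace_add[OF R_subspace *(2,4)] by (simp add: algebra_simps)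
  ultimately show "u + v \<in> tri" using fspan_add T_closed by (auto simp: tri_def)
next
  fix c u assume "u \<in> tri"
  then obtain u' where *: "u' \<in> fspan" "u - u' \<in> R" "u \<in> carrier T" by (auto simp: tri_def)
  then have "tscale c u - tscale c u' \<in> R"
    using tscale.subspace_scale[OF R_subspace *(2), of c] by (simp add: tscale.scale_right_diff_distrib)
  then show "tscale c u \<in> tri" using * fspan_tscale T_closed by (auto simp: tri_def)
qed

lemma R_tri: "R \<subseteq> tri"
  using fspan_zero R_carrier by (force simp: tri_def)

lemma fspan_tri: "fspan \<subseteq> tri"
  using tscale.subspace_0[OF R_subspace] by (force simp: tri_def fspan_def)

lemma tri_mod: "u \<in> carrier T \<Longrightarrow> u - v \<in> R \<Longrightarrow> v \<in> tri \<Longrightarrow> u \<in> tri"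
  using tscale.subspace_add[OF tri_subspace, of "u - v" v] R_tri by auto

lemma lm_f_fspan:
  assumes "u \<in> fspan"
  shows "lm (gen_f i) u \<in> fspan"
proof -
  have "w \<in> lists (range gen_f)" if "lookup (lm (gen_f i) u) w \<noteq> 0" for w
    using that assms by (cases w)
      (auto simp: lookup_left_mult lookup_single when_def fspan_def in_keys_iff subset_iff
        split: if_splits)
  then show ?thesis using assms by (auto simp: fspan_def T_closed in_keys_iff)
qed

lemma lm_f_tri:
  assumes "u \<in> tri"
  shows "lm (gen_f i) u \<in> tri"
proof -
  obtain u' where *: "u' \<in> fspan" "u - u' \<in> R" "u \<in> carrier T" using assms by (auto simp: tri_def)
  then have "lm (gen_f i) u - lm (gen_f i) u' \<in> R"
    using R_closed[OF *(2)] by (simp add: left_mult_diff)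
  then show ?thesis using * lm_f_fspan T_closed by (auto simp: tri_def)
qed

text \<open>A letter a in front of f_i is moved inwards by a f_i = f_i a + [a, f_i]. The bracket is
  a multiple of one generator, so both terms fall under the induction hypothesis for the shorter
  word; at the empty word a acts on H(\<phi>) itself.\<close>

lemma lm_word_tri:
  assumes "p \<in> C" "w \<in> lists (range gen_f)"
  shows "lm a (Poly_Mapping.single w p) \<in> tri"
  using assms(2)
proof (induction w arbitrary: a)
  case Nil
  show ?case
  proof (cases "a \<in> range gen_f")
    case True
    then show ?thesis using lm_f_tri fspan_tri fspan_single[OF assms(1), of "[]"] by auto
  next
    case False
    then have "a \<in> range gen_e \<union> range gen_h \<union> {gen_d}" by (cases a) auto
    from lm_Nil[OF assms(1) this] show ?thesis
      by (rule tri_mod[rotated])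
        (use assms fspan_single[of _ "[]"] fspan_tri in \<open>auto simp: T_closed\<close>)
  qed
next
  case (Cons b w)
  then obtain i where b: "b = gen_f i" by auto
  have fs: "Poly_Mapping.single w p \<in> fspan" using Cons.hyps assms fspan_single by blast
  then have fsT: "Poly_Mapping.single w p \<in> carrier T" by (simp add: fspan_def)
  have eq: "Poly_Mapping.single (b # w) p = lm b (Poly_Mapping.single w p)"
    by (simp add: left_mult_single)
  show ?case
  proof (cases "a \<in> range gen_f")
    case True
    then obtain k where a: "a = gen_f k" by auto
    have "Poly_Mapping.single w p \<in> tri" using fs fspan_tri by auto
    then show ?thesis unfolding eq a unfolding b by (intro lm_f_tri)
  next
    case False
    then have "a = gen_d \<or> a \<in> range gen_e \<union> range gen_h" by (cases a) auto
    from gen_bracket_f[OF this] obtain b' and c :: 'k where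
      br: "gen_bracket a (gen_f i) = Poly_Mapping.single b' c" by blast
    have sc: "Poly_Mapping.single b' c = pscale c (Poly_Mapping.single b' 1)"
      by (rule poly_mapping_eqI) (simp add: lookup_single when_def)
    let ?u = "Poly_Mapping.single w p"
    have "lm a (lm b ?u) - (lm b (lm a ?u) + left_mult (gen_bracket a b) ?u) \<in> R"
      using lm_commutator[OF fsT, of a b] by (simp add: algebra_simps)
    moreover have "lm b (lm a ?u) + left_mult (gen_bracket a b) ?u \<in> tri"
      unfolding b br sc left_mult_linear(4)
      by (intro tscale.subspace_add[OF tri_subspace] tscale.subspace_scale[OF tri_subspace]
          lm_f_tri Cons.IH)
    ultimately show ?thesis unfolding eq by (rule tri_mod[rotated]) (intro T_closed fsT)
  qed
qed

lemma lm_tri: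
  assumes "u \<in> tri"
  shows "lm a u \<in> tri"
proof -
  obtain u' where *: "u' \<in> fspan" "u - u' \<in> R" "u \<in> carrier T" using assms by (auto simp: tri_def)
  then have "lm a u - lm a u' \<in> R"
    using R_closed[OF *(2)] by (simp add: left_mult_diff)
  moreover have "lm a u' \<in> tri"
  proof -
    have s: "left_mult x (\<Sum>w\<in>A. f w) = (\<Sum>w\<in>A. left_mult x (f w))"
      for x :: "'k gtilde" and A and f :: "gen list \<Rightarrow> _"
      by (induction A rule: infinite_finite_induct) (simp_all add: left_mult_linear)
    have "(\<Sum>w\<in>keys u'. lm a (Poly_Mapping.single w (lookup u' w))) \<in> tri"
      using *(1) by (intro tscale.subspace_sum[OF tri_subspace] lm_word_tri)
        (auto simp: fspan_def carrier_T)
    then show ?thesis by (simp only: s[symmetric] poly_mapping_sum_singles[symmetric])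
  qed
  ultimately show ?thesis using * T_closed by (auto intro: tri_mod)
qed

lemma carrier_tri: "carrier T = tri"
proof
  show "tri \<subseteq> carrier T" by (auto simp: tri_def)
  show "carrier T \<subseteq> tri"
  proof
    fix u assume u: "u \<in> carrier T"
    have "Poly_Mapping.single w p \<in> tri" if "p \<in> C" for w p
    proof (induction w)
      case Nil
      then show ?case using fspan_tri fspan_single[OF that, of "[]"] by auto
    next
      case (Cons a w)
      then show ?case using lm_tri[OF Cons, of a] by (simp add: left_mult_single)
    qed
    then have "(\<Sum>w\<in>keys u. Poly_Mapping.single w (lookup u w)) \<in> tri"
      using u by (intro tscale.subspace_sum[OF tri_subspace]) (auto simp: carrier_T)
    then show "u \<in> tri" by (simp flip: poly_mapping_sum_singles)
  qed
qed

text \<open>The top has h-eigenvalue \<open>\<phi> 0\<close>, and commuting h past each f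
  contributes -2.\<close>

lemma h0_word:
  assumes "p \<in> C" "w \<in> lists (range gen_f)"
  shows "lm (gen_h 0) (Poly_Mapping.single w p) -
    tscale (\<phi> 0 - 2 * of_nat (length w)) (Poly_Mapping.single w p) \<in> R"
  using assms(2)
proof (induction w)
  case Nil
  have "Poly_Mapping.single [] (lact \<phi> (gen_h 0) p) = tscale (\<phi> 0) (Poly_Mapping.single [] p)"
    by (intro poly_mapping_eqI) (simp add: lookup_single when_def)
  then show ?case using lm_Nil[OF assms(1), of "gen_h 0"] by simp
next
  case (Cons b w)
  then obtain i where b: "b = gen_f i" by auto
  let ?u = "Poly_Mapping.single w p" and ?e = "\<phi> 0 - 2 * of_nat (length w)"
  have fsT: "?u \<in> carrier T" using assms T_closed by blast
  have eq: "Poly_Mapping.single (b # w) p = lm b ?u"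
    by (simp add: left_mult_single)
  have br: "left_mult (gen_bracket (gen_h 0) b) ?u = tscale (- 2) (lm b ?u)"
  proof -
    have "gen_bracket (gen_h 0) b = pscale (- 2 :: 'k) (Poly_Mapping.single b 1)"
      by (rule poly_mapping_eqI) (simp add: b lookup_single when_def)
    then show ?thesis by (simp only: left_mult_linear)
  qed
  have "lm (gen_h 0) (lm b ?u) - lm b (lm (gen_h 0) ?u) - tscale (- 2) (lm b ?u)
      + lm b (lm (gen_h 0) ?u - tscale ?e ?u) \<in> R"
    by (intro tscale.subspace_add[OF R_subspace] R_closed Cons.IH)
      (use lm_commutator[OF fsT, of "gen_h 0" b] br in simp)
  also have "lm (gen_h 0) (lm b ?u) - lm b (lm (gen_h 0) ?u) - tscale (- 2) (lm b ?u)
      + lm b (lm (gen_h 0) ?u - tscale ?e ?u) = lm (gen_h 0) (lm b ?u) - tscale (?e - 2) (lm b ?u)"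
    by (simp add: left_mult_diff left_mult_linear tscale.scale_left_diff_distrib)
  finally show ?case by (simp add: eq algebra_simps)
qed

text \<open>Functions in the range of \<open>F\<close> vanish at the empty list, so the value there
  detects the component at the empty word.\<close>

lemma rep_fspan_Nil:
  assumes "u \<in> fspan"
  shows "ev (rep \<phi> u n) [] = lookup (lookup u []) n"
proof -
  have "ev (wact \<phi> w (vac p) n) [] = (if w = [] then lookup p n else 0)"
    if "w \<in> lists (range gen_f)" for w p
    using that by (cases w) (auto simp: vac_def)
  then have "ev (rep \<phi> u n) [] = (\<Sum>w\<in>keys u. if w = [] then lookup (lookup u w) n else 0)"
    using assms unfolding rep_def ev_sum fspan_def by (intro sum.cong refl) blast
  then show ?thesis by (simp add: sum.delta in_keys_iff)
qed

text \<open>A vector outside the kernel can be raised until its top coefficient is nonzero. After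
  straightening, the h-eigenvalues isolate its component in H(\<phi>); irreducibility of H(\<phi>)
  then puts all of H(\<phi>), hence the whole module, into \<open>U\<close>.\<close>

lemma stable_max:
  assumes U: "stable_submodule UNIV T U" and RU: "R \<subseteq> U"
  shows "U = carrier T \<or> U \<subseteq> Z"
proof (cases "U \<subseteq> Z")
  case False
  have UT: "U \<subseteq> carrier T" and sU: "tscale.subspace U" and cU: "\<And>x u. u \<in> U \<Longrightarrow> left_mult x u \<in> U"
    using U by (auto simp: stable_T_iff)
  from False obtain u n where u: "u \<in> U" "rep \<phi> u n \<noteq> 0" using UT by (auto simp: Z_def)
  then obtain ks where "ev (rep \<phi> u n) ks \<noteq> 0" by (metis lfun_eqI ev_simps(1))
  \<comment> \<open>Each entry of the list is consumed by applying the corresponding e(k), which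
    moves the index from n to n + k.\<close>
  then have "\<exists>u n. u \<in> U \<and> ev (rep \<phi> u n) [] \<noteq> 0" using u(1)
  proof (induction ks arbitrary: u n)
    case (Cons k ks)
    have "ev (rep \<phi> (lm (gen_e k) u) (n + k)) ks \<noteq> 0"
      using Cons.prems by (simp add: rep_left_mult xact_single ev_Cons)
    then show ?case using Cons.IH cU Cons.prems by blast
  qed blast
  then obtain u n where u: "u \<in> U" "ev (rep \<phi> u n) [] \<noteq> 0" by blast
  then have "u \<in> tri" using UT carrier_tri by auto
  then obtain u' where u': "u' \<in> fspan" "u - u' \<in> R" by (auto simp: tri_def)
  have u'U: "u' \<in> U" using tscale.subspace_diff[OF sU u(1), of "u - u'"] u' RU by auto
  have "rep \<phi> (u - u') n = 0" using u'(2) R_Z by (auto simp: Z_def)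
  then have "lookup (lookup u' []) n \<noteq> 0"
    using u(2) rep_fspan_Nil[OF u'(1)] by (simp add: rep_diff)
  then have p0: "lookup u' [] \<noteq> 0" by auto
  have pC: "lookup u' w \<in> C" for w using u'(1) by (auto simp: fspan_def carrier_T)
  \<comment> \<open>The part of \<open>u'\<close> on words of a fixed length, which modulo
    \<open>R\<close> is an eigenvector of h. The eigenvalues \<open>e m\<close> differ for different
    lengths in characteristic zero.\<close>
  define g where "g = (\<lambda>m::nat. \<Sum>w | w \<in> keys u' \<and> length w = m. Poly_Mapping.single w (lookup u' w))"
  define e where "e = (\<lambda>m::nat. \<phi> 0 - 2 * of_nat m)"
  have "g 0 \<in> U"
  proof (rule eigen_split[of tscale U "lm (gen_h 0)" "length ` keys u'" e g])
    show "inj_on e (length ` keys u')" by (auto simp: inj_on_def e_def)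
    have "(\<Sum>i\<in>length ` keys u'. g i) = u'"
      unfolding g_def by (subst sum.image_gen[symmetric]) (simp_all flip: poly_mapping_sum_singles)
    then show "(\<Sum>i\<in>length ` keys u'. g i) \<in> U" using u'U by simp
    show "0 \<in> length ` keys u'" using p0 by (force simp: in_keys_iff)
    fix m
    have s: "left_mult x (\<Sum>w\<in>A. f w) = (\<Sum>w\<in>A. left_mult x (f w))"
      for x :: "'k gtilde" and A and f :: "gen list \<Rightarrow> _"
      by (induction A rule: infinite_finite_induct) (simp_all add: left_mult_linear)
    have "(\<Sum>w | w \<in> keys u' \<and> length w = m. lm (gen_h 0) (Poly_Mapping.single w (lookup u' w)) -
       tscale (\<phi> 0 - 2 * of_nat (length w)) (Poly_Mapping.single w (lookup u' w))) \<in> R"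
      using u'(1) by (intro tscale.subspace_sum[OF R_subspace] h0_word pC) (auto simp: fspan_def)
    also have "(\<Sum>w | w \<in> keys u' \<and> length w = m. lm (gen_h 0) (Poly_Mapping.single w (lookup u' w)) -
       tscale (\<phi> 0 - 2 * of_nat (length w)) (Poly_Mapping.single w (lookup u' w)))
       = lm (gen_h 0) (g m) - tscale (e m) (g m)"
      unfolding g_def s tscale.scale_sum_right sum_subtractf[symmetric]
      by (intro sum.cong) (simp_all add: e_def)
    finally show "lm (gen_h 0) (g m) - tscale (e m) (g m) \<in> U" using RU by auto
  qed (use sU cU in \<open>simp_all add: vector_space_tscale left_mult_linear\<close>)
  also have "g 0 = Poly_Mapping.single [] (lookup u' [])"
  proof -
    have "{w. w \<in> keys u' \<and> length w = 0} = {[]}" using p0 by (auto simp: in_keys_iff)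
    then show ?thesis by (simp add: g_def)
  qed
  finally have s0: "Poly_Mapping.single [] (lookup u' []) \<in> U" .
  \<comment> \<open>The part of \<open>U\<close> inside the top; the second family of relations
    makes it stable under the h(m) and d acting on Laurent polynomials.\<close>
  define W where "W = {p \<in> C. Poly_Mapping.single [] p \<in> U}"
  have "C \<subseteq> W"
  proof (rule laurent_irreducible)
    show "pscale.subspace W"
    proof (rule pscale.subspaceI)
      show "0 \<in> W" using tscale.subspace_0[OF sU] by (simp add: W_def)
      show "p + q \<in> W" if "p \<in> W" "q \<in> W" for p q
        using that tscale.subspace_add[OF sU] by (auto simp: W_def single_add)
      show "pscale c p \<in> W" if "p \<in> W" for c p
      proof -
        have "Poly_Mapping.single [] (pscale c p) = tscale c (Poly_Mapping.single [] p)"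
          by (intro poly_mapping_eqI) (simp add: lookup_single when_def)
        then show ?thesis using that tscale.subspace_scale[OF sU] by (auto simp: W_def)
      qed
    qed
    have st: "lact \<phi> a p \<in> W" if "a \<in> range gen_e \<union> range gen_h \<union> {gen_d}" "p \<in> W" for a p
    proof -
      have "lm a (Poly_Mapping.single [] p) - Poly_Mapping.single [] (lact \<phi> a p) \<in> U"
        using lm_Nil[of p a] that RU by (auto simp: W_def)
      then have "Poly_Mapping.single [] (lact \<phi> a p) \<in> U"
        using tscale.subspace_diff[OF sU cU[of "Poly_Mapping.single [] p" "Poly_Mapping.single a 1"]]
          that by (fastforce simp: W_def)
      then show ?thesis using that by (simp add: W_def)
    qed
    show "lact \<phi> (gen_h m) p \<in> W" if "p \<in> W" for m p using st that by blast
    show "lact \<phi> gen_d p \<in> W" if "p \<in> W" for p using st that by blast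
    show "lookup u' [] \<in> W" using s0 pC by (simp add: W_def)
  qed (use pC p0 in auto)
  then have "Poly_Mapping.single w p \<in> U" if "p \<in> C" for w p
  proof (induction w)
    case (Cons a w)
    then show ?case using cU[OF Cons.IH, of "Poly_Mapping.single a 1"] by (simp add: left_mult_single)
  qed (use that in \<open>auto simp: W_def\<close>)
  then have "(\<Sum>w\<in>keys u. Poly_Mapping.single w (lookup u w)) \<in> U" if "u \<in> carrier T" for u
    using that by (intro tscale.subspace_sum[OF sU]) (auto simp: carrier_T)
  then have "carrier T \<subseteq> U" by (simp only: poly_mapping_sum_singles[symmetric] subsetI)
  then show ?thesis using UT by auto
qed simp

lemma Z_proper: "Z \<noteq> carrier T"
proof -
  have "Poly_Mapping.single [] 1 \<in> carrier T" using one_C T_closed by blast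
  moreover have "lookup (1 :: 'k laurent) 0 = 1" by (simp add: lookup_one)
  then have "rep \<phi> (Poly_Mapping.single [] 1) 0 \<noteq> 0"
    by (metis (no_types, lifting) cst_simps(2) rep_single vac_def wact.simps(1) zero_neq_one)
  ultimately show ?thesis by (auto simp: Z_def)
qed

text \<open>The description \<open>THE\<close> in \<open>N_module\<close> requires existence and
  uniqueness of a maximal submodule. Both are transferred to T \<otimes> H, where \<open>Z\<close>
  is the largest proper stable submodule above \<open>R\<close>.\<close>

lemma N_module_epi:
  "\<exists>p. epi T (N_module \<phi>) p \<and> {u \<in> carrier T. p u = \<zero>\<^bsub>N_module \<phi>\<^esub>} = Z"
  and N_module_irreducible: "irreducible_module (N_module \<phi>)"
proof -
  let ?I = "Ind_module \<phi>"
  interpret T: gmod T by (rule gmod_T)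
  obtain q where q: "epi T ?I q" and qR: "\<And>u. u \<in> carrier T \<Longrightarrow> q u = \<zero>\<^bsub>?I\<^esub> \<longleftrightarrow> u \<in> R"
    using T.quotient_epi[OF stable_R] unfolding Ind_module_def R_def[symmetric] by blast
  interpret I: gmod ?I using q by (rule epiD)
  have RT: "R \<subseteq> carrier T" using R_carrier by auto
  let ?W = "q ` Z"
  have W: "stable_submodule UNIV ?I ?W" using q stable_Z by (rule stable_image)
  \<comment> \<open>\<open>Z\<close> contains the kernel \<open>R\<close> of \<open>q\<close>, so
    taking the image and then the preimage loses nothing.\<close>
  have pre: "{u \<in> carrier T. q u \<in> ?W} = Z"
  proof (intro equalityI subsetI CollectI conjI)
    fix u assume "u \<in> {u \<in> carrier T. q u \<in> ?W}"
    then obtain v where u: "u \<in> carrier T" and v: "v \<in> Z" "q u = q v" by auto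
    have vT: "v \<in> carrier T" using v by (simp add: Z_def)
    have "q (u + tscale (- 1) v) = q (v + tscale (- 1) v)"
      using epiD(5)[OF q u, of "tscale (- 1) v"] epiD(5)[OF q vT, of "tscale (- 1) v"]
        v(2) T_closed(3)[OF vT, of "- 1"] by simp
    also have "\<dots> = \<zero>\<^bsub>?I\<^esub>" using epi_zero[OF q] by simp
    finally have "u - v \<in> R" using qR[of "u + tscale (- 1) v"] T_closed(2)[OF u T_closed(3)[OF vT, of "- 1"]] by simp
    then have "u - v \<in> Z" using R_Z by auto
    then have "(u - v) + v \<in> Z" using v(1) stable_Z tscale.subspace_add unfolding stable_T_iff by blast
    then show "u \<in> Z" by simp
  qed (auto simp: Z_def)
  have comp: "\<exists>p. epi T (quotient_module ?I V) p \<and>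
      {u \<in> carrier T. p u = \<zero>\<^bsub>quotient_module ?I V\<^esub>} = {u \<in> carrier T. q u \<in> V}"
    if V: "stable_submodule UNIV ?I V" for V
  proof (intro exI conjI)
    show "epi T (quotient_module ?I V) ((\<lambda>u. V +>\<^bsub>?I\<^esub> u) \<circ> q)"
      by (rule epi_comp[OF q I.quotient_epi(1)[OF V]])
    show "{u \<in> carrier T. ((\<lambda>u. V +>\<^bsub>?I\<^esub> u) \<circ> q) u = \<zero>\<^bsub>quotient_module ?I V\<^esub>} = {u \<in> carrier T. q u \<in> V}"
      using I.quotient_epi(2)[OF V] epiD(4)[OF q] by auto
  qed
  have max: "U = Z \<or> U = carrier T" if "stable_submodule UNIV T U" "Z \<subseteq> U" for U
    using stable_max[OF that(1)] that(2) R_Z by auto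
  have irr: "irreducible_module (quotient_module ?I ?W)"
  proof -
    obtain p where p: "epi T (quotient_module ?I ?W) p"
      "{u \<in> carrier T. p u = \<zero>\<^bsub>quotient_module ?I ?W\<^esub>} = Z" using comp[OF W] pre by auto
    show ?thesis using irreducible_epi_iff[OF p(1) p(2)[symmetric]] Z_proper max by blast
  qed
  \<comment> \<open>The preimage of \<open>V\<close> is proper and contains \<open>R\<close>, hence
    lies in \<open>Z\<close>; maximality of \<open>V\<close> leaves no room between the two.\<close>
  have uniq: "V = ?W" if V: "stable_submodule UNIV ?I V" and
    irrV: "irreducible_module (quotient_module ?I V)" for V
  proof -
    let ?U = "{u \<in> carrier T. q u \<in> V}"
    obtain p where p: "epi T (quotient_module ?I V) p"
      "{u \<in> carrier T. p u = \<zero>\<^bsub>quotient_module ?I V\<^esub>} = ?U" using comp[OF V] by auto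
    have m: "?U \<noteq> carrier T" "\<And>U. stable_submodule UNIV T U \<Longrightarrow> ?U \<subseteq> U \<Longrightarrow> U = ?U \<or> U = carrier T"
      using irreducible_epi_iff[OF p(1) p(2)[symmetric]] irrV by auto
    have st: "stable_submodule UNIV T ?U" by (rule stable_vimage[OF q V])
    have zV: "\<zero>\<^bsub>?I\<^esub> \<in> V"
      using V unfolding stable_submodule_def by (blast dest: submodule.zero_closed)
    have "R \<subseteq> ?U"
    proof
      fix u assume u: "u \<in> R"
      then have "u \<in> carrier T" using RT by blast
      then show "u \<in> ?U" using qR[of u] u zV by simp
    qed
    then have UZ: "?U \<subseteq> Z" using stable_max[OF st] m(1) by blast
    have "Z = ?U" using m(2)[OF stable_Z UZ] Z_proper by blast
    have sV: "submodule class_ring V ?I" using V by (simp add: stable_submodule_def)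
    have VT: "V \<subseteq> q ` carrier T" using submodule.subset[OF sV] epiD(3)[OF q] by simp
    have "V = q ` ?U"
    proof (intro equalityI subsetI)
      fix y assume y: "y \<in> V"
      then obtain u where "u \<in> carrier T" "y = q u" using VT by (elim subsetD[THEN imageE])
      then show "y \<in> q ` ?U" using y by (intro image_eqI[of _ _ u]) simp_all
    qed (elim imageE, simp)
    then show ?thesis using arg_cong[OF \<open>Z = ?U\<close>, of "image q"] by (rule trans[OF _ sym])
  qed
  have the: "(THE V. stable_submodule UNIV ?I V \<and> irreducible_module (quotient_module ?I V)) = ?W"
    by (rule the_equality, rule conjI[OF W irr], elim conjE, rule uniq)
  show "\<exists>p. epi T (N_module \<phi>) p \<and> {u \<in> carrier T. p u = \<zero>\<^bsub>N_module \<phi>\<^esub>} = Z"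
    unfolding N_module_def the using comp[OF W] unfolding pre .
  show "irreducible_module (N_module \<phi>)"
    unfolding N_module_def the by (rule irr)
qed

end

section \<open>Weight spaces\<close>

text \<open>A bridge between two formalisations: weight spaces are records with a carrier, while
  spans of functions live in a type. An injective linear map with image a span pulls a basis
  back.\<close>

lemma dim_via_map:
  fixes M :: "('k::field, 'v, 'x) module_scheme" and g :: "'v \<Rightarrow> 'b::ab_group_add"
  assumes "vectorspace class_ring M" and "vector_space sc"
    and add: "\<And>x y. x \<in> carrier M \<Longrightarrow> y \<in> carrier M \<Longrightarrow> g (x \<oplus>\<^bsub>M\<^esub> y) = g x + g y"
    and sm: "\<And>c x. x \<in> carrier M \<Longrightarrow> g (c \<odot>\<^bsub>M\<^esub> x) = sc c (g x)"
    and inj: "inj_on g (carrier M)" and fin: "finite B"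
    and ind: "\<not> module.dependent sc B" and img: "g ` carrier M = module.span sc B"
  shows "vectorspace.fin_dim class_ring M \<and> vectorspace.dim class_ring M = card B"
proof -
  interpret M: vectorspace class_ring M by fact
  interpret V: vector_space sc by fact
  have g0: "g \<zero>\<^bsub>M\<^esub> = 0" using add[of "\<zero>\<^bsub>M\<^esub>" "\<zero>\<^bsub>M\<^esub>"] by simp
  have gl: "g (M.lincomb a A) = (\<Sum>v\<in>A. sc (a v) (g v))" if "finite A" "A \<subseteq> carrier M" for a A
    using that
  proof (induction A rule: finite_induct)
    case empty
    then show ?case by (simp add: M.lincomb_def g0)
  next
    case (insert x A)
    have c: "(\<lambda>v. a v \<odot>\<^bsub>M\<^esub> v) \<in> A \<rightarrow> carrier M" "a x \<odot>\<^bsub>M\<^esub> x \<in> carrier M"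
      using insert.prems M.smult_closed by auto
    have "M.lincomb a (insert x A) = a x \<odot>\<^bsub>M\<^esub> x \<oplus>\<^bsub>M\<^esub> M.lincomb a A"
      unfolding M.lincomb_def using M.finsum_insert[OF insert.hyps c] .
    moreover have "M.lincomb a A \<in> carrier M" using insert.prems by (intro M.lincomb_closed) auto
    ultimately show ?case using insert add sm c(2) by simp
  qed
  let ?h = "inv_into (carrier M) g"
  have BV: "b \<in> g ` carrier M" if "b \<in> B" for b using that img V.span_base by blast
  define A where "A = ?h ` B"
  have gh: "g (?h b) = b" if "b \<in> B" for b using f_inv_into_f[OF BV[OF that]] .
  have hinj: "inj_on ?h B" by (metis gh inj_onI)
  have AM: "A \<subseteq> carrier M" unfolding A_def using inv_into_into[OF BV] by auto
  have finA: "finite A" using fin by (simp add: A_def)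
  have "M.span A = carrier M"
  proof
    show "M.span A \<subseteq> carrier M" using M.span_is_subset2[OF AM] .
    show "carrier M \<subseteq> M.span A"
    proof
      fix x assume x: "x \<in> carrier M"
      then have "g x \<in> V.span B" using img by auto
      then obtain c where c: "g x = (\<Sum>b\<in>B. sc (c b) b)"
        using V.span_finite[OF fin] by auto
      have "g (M.lincomb (c \<circ> g) A) = (\<Sum>b\<in>B. sc (c b) b)"
        unfolding gl[OF finA AM] unfolding A_def by (subst sum.reindex[OF hinj]) (simp add: gh)
      then have "g (M.lincomb (c \<circ> g) A) = g x" using c by simp
      moreover have "M.lincomb (c \<circ> g) A \<in> carrier M" using AM by (intro M.lincomb_closed) auto
      ultimately have "x = M.lincomb (c \<circ> g) A" using inj x by (auto dest: inj_onD)
      then show "x \<in> M.span A" unfolding M.span_def using finA by auto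
    qed
  qed
  moreover have "M.lin_indpt A"
  proof
    assume "M.lin_dep A"
    then obtain a v where a: "M.lincomb a A = \<zero>\<^bsub>M\<^esub>" "v \<in> A" "a v \<noteq> 0"
      using M.finite_lin_dep[OF finA _ AM] by auto
    have "(\<Sum>v\<in>A. sc (a v) (g v)) = 0" using gl[OF finA AM, of a] a(1) g0 by simp
    then have "(\<Sum>b\<in>B. sc (a (?h b)) b) = 0"
      unfolding A_def by (subst (asm) sum.reindex[OF hinj]) (simp add: gh)
    then have "\<forall>b\<in>B. a (?h b) = 0" using ind V.dependent_finite[OF fin] by auto
    then show False using a by (auto simp: A_def)
  qed
  ultimately have "M.basis A" unfolding M.basis_def using AM by simp
  then have "M.dim = card A" by (rule M.dim_basis[OF finA])
  also have "card A = card B" unfolding A_def by (rule card_image[OF hinj])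
  finally show ?thesis unfolding M.fin_dim_def using finA AM \<open>M.span A = carrier M\<close> by blast
qed

global_interpretation lf: vector_space "\<lambda>c (s::'k::field lfun). cst c * s"
  by (rule vector_space_cst)

lemma HF_zero [simp]: "H \<phi> n 0 = 0" "F \<phi> n 0 = 0"
  using HF_linear(2)[of \<phi> n 0 0] HF_linear(4)[of \<phi> n 0 0] by simp_all

section \<open>Depth of a coefficient function and products of f's\<close>

definition homog :: "nat \<Rightarrow> 'k::comm_ring_1 lfun \<Rightarrow> bool" where
  "homog d s \<longleftrightarrow> (\<forall>ks. length ks \<noteq> d \<longrightarrow> ev s ks = 0)"

lemma homog_E: "homog (Suc d) s \<Longrightarrow> homog d (E k s)" "homog 0 s \<Longrightarrow> E k s = 0"
  by (auto simp: homog_def simp flip: ev_Cons intro: lfun_eqI)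

lemma ev_2 [simp]: "ev (2 * s) ks = 2 * ev s ks"
  by (simp only: mult_2 ev_simps)

lemma homog_H: "homog d s \<Longrightarrow> homog d (H \<phi> n s)"
proof -
  have "ev (H \<phi> n s) ks = 0" if "homog d s" "length ks \<noteq> d" for ks
    using that
  proof (induction ks arbitrary: d s)
    case (Cons k ks)
    show ?case
    proof (cases d)
      case (Suc d')
      then have h: "homog d' (E j s)" for j using Cons.prems homog_E(1) by blast
      then show ?thesis using Cons.IH[OF h, of k] Cons.prems(2) Suc
        by (simp add: ev_Cons E_H) (use h Cons.prems(2) Suc in \<open>simp add: homog_def\<close>)
    qed (use Cons in \<open>simp add: ev_Cons E_H homog_E\<close>)
  qed (simp add: homog_def)
  then show "homog d s \<Longrightarrow> homog d (H \<phi> n s)" by (simp add: homog_def)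
qed

lemma homog_F: "homog d s \<Longrightarrow> homog (Suc d) (F \<phi> n s)"
proof -
  have "ev (F \<phi> n s) ks = 0" if "homog d s" "length ks \<noteq> Suc d" for ks
    using that
  proof (induction ks arbitrary: d s)
    case (Cons k ks)
    have h: "ev (H \<phi> (n + k) s) ks = 0" using homog_H[OF Cons.prems(1)] Cons.prems(2)
      by (simp add: homog_def)
    show ?case
    proof (cases d)
      case (Suc d')
      then show ?thesis using Cons.IH[OF homog_E(1)[of d' s k]] Cons.prems h by (simp add: ev_Cons E_F)
    qed (use Cons h in \<open>simp add: ev_Cons E_F homog_E\<close>)
  qed simp
  then show "homog d s \<Longrightarrow> homog (Suc d) (F \<phi> n s)" by (simp add: homog_def)
qed

text \<open>\<open>DH 0\<close> replaces each entry by itself, so it multiplies by the length of the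
  list.\<close>

lemma ev_H_0: "ev (H \<phi> 0 s) ks = (\<phi> 0 - 2 * of_nat (length ks)) * ev s ks"
proof (induction ks arbitrary: s)
  case (Cons k ks)
  then show ?case by (simp add: ev_Cons E_H algebra_simps)
qed simp

definition unf :: "gen \<Rightarrow> int" where
  "unf a = (case a of gen_f i \<Rightarrow> i | _ \<Rightarrow> 0)"

definition fdeg :: "gen list \<Rightarrow> int" where
  "fdeg w = sum_list (map unf w)"

definition fword :: "(int \<Rightarrow> 'k::comm_ring_1) \<Rightarrow> int list \<Rightarrow> 'k lfun" where
  "fword \<phi> ns = foldr (F \<phi>) ns 1"

lemma homog_fword: "homog (length ns) (fword \<phi> ns)"
proof (induction ns)
  case Nil
  show ?case by (auto simp: homog_def fword_def one_lfun.rep_eq)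
qed (simp add: fword_def homog_F)

lemma wact_fword:
  "w \<in> lists (range gen_f) \<Longrightarrow>
    wact \<phi> w (vac p) n = cst (lookup p (n - fdeg w)) * fword \<phi> (map unf w)"
proof (induction w arbitrary: n)
  case (Cons a w)
  then obtain i where "a = gen_f i" "w \<in> lists (range gen_f)" by auto
  with Cons.IH show ?case by (simp add: fdeg_def fword_def unf_def HF_linear diff_diff_eq)
qed (simp add: vac_def fdeg_def fword_def)

context sl2_loop
begin

text \<open>The weight space at depth m and degree n, seen as functions. The word f(ns) is applied
  to the top vector t^(n - \<open>sum_list ns\<close>), which must lie in H(\<phi>); this is the
  divisibility condition.\<close>

definition G :: "nat \<Rightarrow> int \<Rightarrow> 'k lfun set" where
  "G m n = lf.span {fword \<phi> ns |ns. length ns = m \<and> int r dvd n - sum_list ns}"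

definition wt :: "nat \<Rightarrow> int \<Rightarrow> 'k weight" where
  "wt m n = (\<phi> 0 - 2 * of_nat m, of_int n)"

lemma wt_inj: "wt m n = wt m' n' \<longleftrightarrow> m = m' \<and> n = n'"
  by (simp add: wt_def)

lemma rep_fspan:
  assumes "u \<in> fspan"
  shows "rep \<phi> u n = (\<Sum>w\<in>keys u. cst (lookup (lookup u w) (n - fdeg w)) * fword \<phi> (map unf w))"
  unfolding rep_def using assms
  by (intro sum.cong refl wact_fword) (auto simp: fspan_def)

text \<open>After straightening, a vector is cut up by word length and total degree. The pieces are
  again vectors of T \<otimes> H, so weight components of the quotient have explicit lifts.\<close>

lemma homogeneous_components:
  assumes "u \<in> carrier T"
  shows "\<exists>hc. (\<forall>m n. hc m n \<in> carrier T) \<and>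
    (\<forall>m n n' ks. ev (rep \<phi> (hc m n) n') ks =
      (if n' = n \<and> length ks = m then ev (rep \<phi> u n) ks else 0)) \<and>
    (\<forall>m n. rep \<phi> (hc m n) n \<in> G m n) \<and>
    finite {(m, n). rep \<phi> (hc m n) n \<noteq> 0}"
proof -
  obtain u' where u': "u' \<in> fspan" "u - u' \<in> R" using assms[unfolded carrier_tri] unfolding tri_def by blast
  have "rep \<phi> (u - u') n = 0" for n using u'(2) R_Z by (auto simp: Z_def)
  then have ru: "rep \<phi> u n = rep \<phi> u' n" for n by (simp add: rep_diff)
  have wl: "w \<in> lists (range gen_f)" if "w \<in> keys u'" for w
    using that u'(1) by (auto simp: fspan_def)
  have pC: "lookup u' w \<in> C" for w using u'(1) by (auto simp: fspan_def carrier_T)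
  define c where "c w n = lookup (lookup u' w) (n - fdeg w)" for w n
  define K where "K m = {w \<in> keys u'. length w = m}" for m
  \<comment> \<open>The exponent \<open>n - fdeg w\<close> complements the degree of the word, so
    that every summand sits in degree n.\<close>
  define hc where "hc m n = (\<Sum>w\<in>K m. Poly_Mapping.single w (Poly_Mapping.single (n - fdeg w) (c w n)))" for m n
  have rh: "rep \<phi> (hc m n) n' = (if n' = n then \<Sum>w\<in>K m. cst (c w n) * fword \<phi> (map unf w) else 0)" for m n n'
    unfolding hc_def rep_sum rep_single
    using wl by (auto simp: wact_fword K_def lookup_single intro!: sum.cong sum.neutral)
  show ?thesis
  proof (intro exI[of _ hc] conjI allI)
    show "hc m n \<in> carrier T" for m n
    proof -
      have "Poly_Mapping.single (n - fdeg w) (c w n) \<in> C" for w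
        using pC[of w] by (cases "c w n = 0") (auto simp: C_def c_def lookup_single when_def)
      then have "(\<Sum>w\<in>A. Poly_Mapping.single w (Poly_Mapping.single (n - fdeg w) (c w n))) \<in> carrier T" for A
        by (induction A rule: infinite_finite_induct) (simp_all add: T_closed)
      then show ?thesis by (simp add: hc_def)
    qed
    show "ev (rep \<phi> (hc m n) n') ks = (if n' = n \<and> length ks = m then ev (rep \<phi> u n) ks else 0)"
      for m n n' ks
    proof -
      have fz: "ev (fword \<phi> (map unf w)) ks = 0" if "length ks \<noteq> length w" for w
        using homog_fword[of "map unf w" \<phi>] that by (simp add: homog_def)
      have "ev (rep \<phi> u n) ks = (\<Sum>w\<in>keys u'. c w n * ev (fword \<phi> (map unf w)) ks)"
        unfolding ru rep_fspan[OF u'(1)] by (simp add: c_def)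
      also have "\<dots> = (\<Sum>w\<in>K (length ks). c w n * ev (fword \<phi> (map unf w)) ks)"
        by (rule sum.mono_neutral_right) (auto simp: K_def intro: fz[OF not_sym])
      finally have "ev (rep \<phi> u n) ks = ev (rep \<phi> (hc (length ks) n) n) ks" by (simp add: rh)
      moreover have "ev (rep \<phi> (hc m n) n') ks = 0" if "length ks \<noteq> m"
        using that by (auto simp: rh K_def fz)
      moreover have "ev (rep \<phi> (hc m n) n') ks = 0" if "n' \<noteq> n"
        using that by (simp add: rh)
      ultimately show ?thesis by auto
    qed
    show "rep \<phi> (hc m n) n \<in> G m n" for m n
      unfolding rh G_def if_P[OF refl]
    proof (rule lf.span_sum)
      fix w assume w: "w \<in> K m"
      show "cst (c w n) * fword \<phi> (map unf w) \<in>
        lf.span {fword \<phi> ns |ns. length ns = m \<and> int r dvd n - sum_list ns}"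
      proof (cases "c w n = 0")
        case False
        then have "int r dvd n - fdeg w" using pC[of w] by (auto simp: C_def c_def)
        then show ?thesis using w
          by (intro lf.span_scale lf.span_base) (auto simp: K_def fdeg_def)
      qed (simp add: lf.span_zero)
    qed
    let ?S = "SIGMA w:keys u'. keys (lookup u' w)"
    have "{(m, n). rep \<phi> (hc m n) n \<noteq> 0} \<subseteq> (\<lambda>(w, j). (length w, j + fdeg w)) ` ?S"
    proof clarify
      fix m n assume "rep \<phi> (hc m n) n \<noteq> 0"
      then obtain w where "w \<in> K m" "c w n \<noteq> 0"
        by (auto simp: rh elim!: sum.not_neutral_contains_not_neutral)
      then show "(m, n) \<in> (\<lambda>(w, j). (length w, j + fdeg w)) ` ?S"
        by (intro image_eqI[of _ _ "(w, n - fdeg w)"]) (auto simp: K_def c_def in_keys_iff)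
    qed
    then show "finite {(m, n). rep \<phi> (hc m n) n \<noteq> 0}" by (rule finite_subset) simp
  qed
qed

section \<open>Weights and weight spaces of the irreducible quotient\<close>

context
  fixes p assumes p: "epi T (N_module \<phi>) p" "{u \<in> carrier T. p u = \<zero>\<^bsub>N_module \<phi>\<^esub>} = Z"
begin

abbreviation "N \<equiv> N_module \<phi>"

interpretation N: gmod N by (rule epiD(2)[OF p(1)])

lemma p_eq_iff:
  assumes "u \<in> carrier T" "v \<in> carrier T"
  shows "p u = p v \<longleftrightarrow> (\<forall>n. rep \<phi> u n = rep \<phi> v n)"
proof -
  have pc: "p u \<in> carrier N" "p v \<in> carrier N" using assms epiD(4)[OF p(1)] by auto
  have mT: "tscale (- 1) v \<in> carrier T" using assms T_closed by blast
  have "p u = p v \<longleftrightarrow> p u \<oplus>\<^bsub>N\<^esub> \<ominus>\<^bsub>N\<^esub> p v = \<zero>\<^bsub>N\<^esub>"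
    using N.minus_equality[of "p u" "\<ominus>\<^bsub>N\<^esub> p v"] N.minus_minus[OF pc(2)] N.a_inv_closed[OF pc(2)]
      N.r_neg[OF pc(2)] pc by metis
  also have "\<ominus>\<^bsub>N\<^esub> p v = p (tscale (- 1) v)"
    using N.smult_uminus_one[OF pc(2)] epiD(6)[OF p(1) assms(2), of "- 1"] by simp
  also have "p u \<oplus>\<^bsub>N\<^esub> p (tscale (- 1) v) = p (u - v)"
    using epiD(5)[OF p(1) assms(1) mT] by simp
  also have "p (u - v) = \<zero>\<^bsub>N\<^esub> \<longleftrightarrow> u - v \<in> Z"
    using p(2) T_closed(2)[OF assms(1) mT] by auto
  also have "\<dots> \<longleftrightarrow> (\<forall>n. rep \<phi> u n = rep \<phi> v n)"
    using T_closed(2)[OF assms(1) mT] by (simp add: Z_def rep_diff)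
  finally show ?thesis .
qed

lemma p_finsum:
  assumes "finite A" "\<And>i. i \<in> A \<Longrightarrow> t i \<in> carrier T"
  shows "finsum N (\<lambda>i. p (t i)) A = p (\<Sum>i\<in>A. t i) \<and> (\<Sum>i\<in>A. t i) \<in> carrier T"
  using assms
proof (induction A rule: finite_induct)
  case empty
  then show ?case using epi_zero[OF p(1)] T_closed by simp
next
  case (insert i A)
  then have "finsum N (\<lambda>i. p (t i)) (insert i A) = p (t i) \<oplus>\<^bsub>N\<^esub> finsum N (\<lambda>i. p (t i)) A"
    by (intro N.finsum_insert) (auto intro: epiD(4)[OF p(1)])
  then show ?case using insert epiD(5)[OF p(1), of "t i" "\<Sum>i\<in>A. t i"] T_closed by simp
qed

text \<open>On functions h multiplies the value at \<open>ks\<close> by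
  \<open>\<phi> 0 - 2 * of_nat (length ks)\<close>, and d multiplies the n-th component by n. Being
  a weight vector is therefore a condition on the support.\<close>

lemma weight_space_iff:
  assumes "u \<in> carrier T"
  shows "p u \<in> weight_space N \<chi> \<longleftrightarrow>
    (\<forall>n ks. ev (rep \<phi> u n) ks \<noteq> 0 \<longrightarrow> \<chi> = wt (length ks) n)"
proof -
  have "p u \<in> weight_space N \<chi> \<longleftrightarrow>
      p (lm (gen_h 0) u) = p (tscale (fst \<chi>) u) \<and> p (lm gen_d u) = p (tscale (snd \<chi>) u)"
    using epiD(4,6,7)[OF p(1) assms] by (simp add: weight_space_def)
  also have "\<dots> \<longleftrightarrow> (\<forall>n. rep \<phi> (lm (gen_h 0) u) n = rep \<phi> (tscale (fst \<chi>) u) n) \<and>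
     (\<forall>n. rep \<phi> (lm gen_d u) n = rep \<phi> (tscale (snd \<chi>) u) n)"
    using assms T_closed by (simp add: p_eq_iff)
  also have "\<dots> \<longleftrightarrow> (\<forall>n ks. ev (H \<phi> 0 (rep \<phi> u n)) ks = fst \<chi> * ev (rep \<phi> u n) ks) \<and>
     (\<forall>n ks. of_int n * ev (rep \<phi> u n) ks = snd \<chi> * ev (rep \<phi> u n) ks)"
  proof -
    have e: "s = t \<longleftrightarrow> (\<forall>ks. ev s ks = ev t ks)" for s t :: "'k lfun"
      by (metis lfun_eqI)
    show ?thesis by (simp add: e rep_left_mult rep_tscale xact_single)
  qed
  also have "\<dots> \<longleftrightarrow> (\<forall>n ks. ev (rep \<phi> u n) ks \<noteq> 0 \<longrightarrow> \<chi> = wt (length ks) n)"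
    by (auto simp: ev_H_0 wt_def prod_eq_iff eq_commute[of "fst \<chi>"] eq_commute[of "snd \<chi>"])
  finally show ?thesis .
qed

lemma weight_space_subspace: "submodule class_ring (weight_space N \<chi>) N"
proof (rule submodule.intro)
  show "Module.module class_ring N" by (rule N.module_axioms)
  show "weight_space N \<chi> \<subseteq> carrier N" by (auto simp: weight_space_def)
  have lift: "\<exists>u\<in>carrier T. x = p u" if "x \<in> weight_space N \<chi>" for x
    using that epiD(3)[OF p(1)] by (auto simp: weight_space_def)
  show "\<zero>\<^bsub>N\<^esub> \<in> weight_space N \<chi>"
    using weight_space_iff[of 0] epi_zero[OF p(1)] T_closed by (simp add: rep_zero)
  fix x y assume "x \<in> weight_space N \<chi>" "y \<in> weight_space N \<chi>"
  then obtain u v where u: "u \<in> carrier T" "x = p u" "p u \<in> weight_space N \<chi>"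
    and v: "v \<in> carrier T" "y = p v" "p v \<in> weight_space N \<chi>" using lift by metis
  have "p (u + v) \<in> weight_space N \<chi>"
    using u v weight_space_iff[of u] weight_space_iff[of v] weight_space_iff[of "u + v"] T_closed
    by (auto simp: rep_add) (metis add_0)
  then show "x \<oplus>\<^bsub>N\<^esub> y \<in> weight_space N \<chi>"
    using epiD(5)[OF p(1) u(1) v(1)] u v by simp
next
  have lift: "\<exists>u\<in>carrier T. x = p u" if "x \<in> weight_space N \<chi>" for x
    using that epiD(3)[OF p(1)] by (auto simp: weight_space_def)
  fix c x assume "x \<in> weight_space N \<chi>"
  then obtain u where u: "u \<in> carrier T" "x = p u" "p u \<in> weight_space N \<chi>" using lift by metis
  have "p (tscale c u) \<in> weight_space N \<chi>"
    using u weight_space_iff[of u] weight_space_iff[of "tscale c u"] T_closed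
    by (auto simp: rep_tscale)
  then show "c \<odot>\<^bsub>N\<^esub> x \<in> weight_space N \<chi>"
    using epiD(6)[OF p(1) u(1)] u by simp
qed

lemma weight_vectorspace: "vectorspace class_ring (N\<lparr>carrier := weight_space N \<chi>\<rparr>)"
  unfolding vectorspace_def
  using N.submodule_is_module[OF weight_space_subspace] class_field by auto

lemma weight_module_N: "weight_module N"
  unfolding weight_module_def
proof
  fix v assume "v \<in> carrier N"
  then obtain u where u: "u \<in> carrier T" "v = p u" using epiD(3)[OF p(1)] by auto
  obtain hc where h: "\<forall>m n. hc m n \<in> carrier T"
    "\<forall>m n n' ks. ev (rep \<phi> (hc m n) n') ks =
      (if n' = n \<and> length ks = m then ev (rep \<phi> u n) ks else 0)"
    "\<forall>m n. rep \<phi> (hc m n) n \<in> G m n"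
    "finite {(m, n). rep \<phi> (hc m n) n \<noteq> 0}"
    using homogeneous_components[OF u(1)] by (elim exE conjE) (rule that)
  note hc = h(1)[rule_format] and rh = h(2)[rule_format] and hG = h(3)[rule_format] and fin = h(4)
  let ?P = "\<lambda>f. (\<forall>\<chi>. f \<chi> \<in> weight_space N \<chi>) \<and> finite {\<chi>. f \<chi> \<noteq> \<zero>\<^bsub>N\<^esub>} \<and>
        v = finsum N f {\<chi>. f \<chi> \<noteq> \<zero>\<^bsub>N\<^esub>}"
  \<comment> \<open>The components are relabelled by weights. Since \<open>wt\<close> is injective
    the choice is forced, and weights not of this form receive 0.\<close>
  define t where "t \<chi> = (if \<exists>m n. \<chi> = wt m n then case (SOME (m, n). \<chi> = wt m n) of (m, n) \<Rightarrow> hc m n else 0)" for \<chi>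
  have t_wt: "t (wt m n) = hc m n" for m n
  proof -
    have "(SOME (m', n'). wt m n = wt m' n') = (m, n)"
      by (rule some_equality) (auto simp: wt_inj)
    then show ?thesis by (auto simp: t_def)
  qed
  have t_T: "t \<chi> \<in> carrier T" for \<chi>
    using hc T_closed by (auto simp: t_def split: prod.splits)
  have t0: "t \<chi> = 0" if "\<And>m n. \<chi> \<noteq> wt m n" for \<chi> using that by (simp add: t_def)
  have rt: "ev (rep \<phi> (t \<chi>) n) ks = (if \<chi> = wt (length ks) n then ev (rep \<phi> u n) ks else 0)" for \<chi> n ks
  proof (cases "\<exists>m n. \<chi> = wt m n")
    case True
    then show ?thesis by (auto simp: t_wt rh wt_inj)
  next
    case False
    then show ?thesis by (auto simp: t0 rep_zero)
  qed
  have p0: "p x = \<zero>\<^bsub>N\<^esub> \<longleftrightarrow> (\<forall>n. rep \<phi> x n = 0)" if "x \<in> carrier T" for x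
    using p_eq_iff[OF that T_closed(1)] epi_zero[OF p(1)] by (simp add: rep_zero)
  show "\<exists>!f. ?P f"
  proof (rule ex1I)
    let ?f = "\<lambda>\<chi>. p (t \<chi>)"
    have "{\<chi>. ?f \<chi> \<noteq> \<zero>\<^bsub>N\<^esub>} \<subseteq> (\<lambda>(m, n). wt m n) ` {(m, n). rep \<phi> (hc m n) n \<noteq> 0}"
    proof
      fix \<chi> assume "\<chi> \<in> {\<chi>. ?f \<chi> \<noteq> \<zero>\<^bsub>N\<^esub>}"
      then obtain n where n: "rep \<phi> (t \<chi>) n \<noteq> 0" using p0[OF t_T] by auto
      then obtain ks where ks: "ev (rep \<phi> (t \<chi>) n) ks \<noteq> 0" by (metis lfun_eqI ev_simps(1))
      then have "\<chi> = wt (length ks) n" by (auto simp: rt split: if_splits)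
      then show "\<chi> \<in> (\<lambda>(m, n). wt m n) ` {(m, n). rep \<phi> (hc m n) n \<noteq> 0}"
        using n t_wt by auto
    qed
    then have fin': "finite {\<chi>. ?f \<chi> \<noteq> \<zero>\<^bsub>N\<^esub>}" by (rule finite_subset[OF _ finite_imageI[OF fin]])
    moreover have "?f \<chi> \<in> weight_space N \<chi>" for \<chi>
      unfolding weight_space_iff[OF t_T] by (auto simp: rt split: if_splits)
    moreover have "v = finsum N ?f {\<chi>. ?f \<chi> \<noteq> \<zero>\<^bsub>N\<^esub>}"
    proof -
      let ?S = "{\<chi>. ?f \<chi> \<noteq> \<zero>\<^bsub>N\<^esub>}"
      have s: "finsum N ?f ?S = p (\<Sum>\<chi>\<in>?S. t \<chi>)" "(\<Sum>\<chi>\<in>?S. t \<chi>) \<in> carrier T"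
        using p_finsum[OF fin', of t] t_T by auto
      have "rep \<phi> u n = rep \<phi> (\<Sum>\<chi>\<in>?S. t \<chi>) n" for n
      proof (rule lfun_eqI)
        fix ks
        have "ev (rep \<phi> (\<Sum>\<chi>\<in>?S. t \<chi>) n) ks =
            (\<Sum>\<chi>\<in>?S. if \<chi> = wt (length ks) n then ev (rep \<phi> u n) ks else 0)"
          by (simp add: rep_sum rt)
        also have "\<dots> = (if wt (length ks) n \<in> ?S then ev (rep \<phi> u n) ks else 0)"
          using fin' by (rule sum.delta)
        also have "\<dots> = ev (rep \<phi> u n) ks"
          using p0[OF t_T, of "wt (length ks) n"] rt[of "wt (length ks) n" n ks] by auto
        finally show "ev (rep \<phi> u n) ks = ev (rep \<phi> (\<Sum>\<chi>\<in>?S. t \<chi>) n) ks" by simp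
      qed
      then show ?thesis using p_eq_iff[OF u(1) s(2)] u(2) s(1) by simp
    qed
    ultimately show "?P ?f" by blast
  next
    fix g assume g: "?P g"
    let ?S = "{\<chi>. g \<chi> \<noteq> \<zero>\<^bsub>N\<^esub>}"
    have "g \<chi> \<in> p ` carrier T" for \<chi>
    proof -
      have "g \<chi> \<in> weight_space N \<chi>" using g by blast
      then show ?thesis using epiD(3)[OF p(1)] by (simp add: weight_space_def)
    qed
    then have "\<forall>\<chi>. \<exists>x. x \<in> carrier T \<and> g \<chi> = p x" by blast
    then obtain s where s: "\<And>\<chi>. s \<chi> \<in> carrier T" "\<And>\<chi>. g \<chi> = p (s \<chi>)" by metis
    have rs: "\<chi> = wt (length ks) n" if "ev (rep \<phi> (s \<chi>) n) ks \<noteq> 0" for \<chi> n ks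
      using g that weight_space_iff[OF s(1)] s(2) by metis
    have fS: "finite ?S" using g by blast
    have gs: "(\<lambda>\<chi>. p (s \<chi>)) = g" using s(2) by auto
    have "v = finsum N g ?S" using g by blast
    then have "p u = p (\<Sum>\<chi>\<in>?S. s \<chi>)" "(\<Sum>\<chi>\<in>?S. s \<chi>) \<in> carrier T"
      using p_finsum[OF fS, of s] s(1) unfolding gs u(2) by simp_all
    then have ru: "rep \<phi> u n = (\<Sum>\<chi>\<in>?S. rep \<phi> (s \<chi>) n)" for n
      using p_eq_iff[OF u(1)] by (simp add: rep_sum)
    \<comment> \<open>Uniqueness is checked value by value: at index n and list \<open>ks\<close>
      the single weight \<open>wt (length ks) n\<close> can contribute to a decomposition of
      \<open>u\<close>.\<close>
    show "g = (\<lambda>\<chi>. p (t \<chi>))"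
    proof
      fix \<chi>
      have "rep \<phi> (s \<chi>) n = rep \<phi> (t \<chi>) n" for n
      proof (rule lfun_eqI)
        fix ks
        show "ev (rep \<phi> (s \<chi>) n) ks = ev (rep \<phi> (t \<chi>) n) ks"
        proof (cases "\<chi> = wt (length ks) n")
          case True
          have "ev (rep \<phi> u n) ks = (\<Sum>\<chi>'\<in>?S. if \<chi>' = \<chi> then ev (rep \<phi> (s \<chi>) n) ks else 0)"
            unfolding ru ev_sum by (intro sum.cong refl) (use rs True in auto)
          also have "\<dots> = (if \<chi> \<in> ?S then ev (rep \<phi> (s \<chi>) n) ks else 0)"
            using fS by (rule sum.delta)
          also have "\<dots> = ev (rep \<phi> (s \<chi>) n) ks"
            using p0[OF s(1), of \<chi>] s(2)[of \<chi>] by auto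
          finally show ?thesis using True by (simp add: rt)
        next
          case False
          then show ?thesis using rs[of \<chi> n ks] rt[of \<chi> n ks] by auto
        qed
      qed
      then show "g \<chi> = p (t \<chi>)" using p_eq_iff[OF s(1) t_T] s(2) by simp
    qed
  qed
qed

text \<open>On the weight space of \<open>wt m n\<close> all components of \<open>rep\<close> other
  than the n-th vanish, so the n-th component is injective there; its image is spanned by the
  f-words of the right length and degree.\<close>

lemma weight_space_dim:
  assumes "finite B" "\<not> lf.dependent B" "lf.span B = G m n"
  shows "vectorspace.fin_dim class_ring (N\<lparr>carrier := weight_space N (wt m n)\<rparr>)"
    and "vectorspace.dim class_ring (N\<lparr>carrier := weight_space N (wt m n)\<rparr>) = card B"
proof -
  \<comment> \<open>An arbitrary lift to T \<otimes> H is chosen; \<open>gp\<close> shows that the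
    value does not depend on it.\<close>
  define g where "g x = rep \<phi> (SOME u. u \<in> carrier T \<and> p u = x) n" for x
  have gp: "g (p u) = rep \<phi> u n" if "u \<in> carrier T" for u
  proof -
    let ?v = "SOME v. v \<in> carrier T \<and> p v = p u"
    have "?v \<in> carrier T \<and> p ?v = p u" by (rule someI[of _ u]) (use that in simp)
    then show ?thesis using p_eq_iff[of ?v u] that by (simp add: g_def)
  qed
  let ?W = "weight_space N (wt m n)"
  have lift: "\<exists>u\<in>carrier T. x = p u" if "x \<in> ?W" for x
    using that epiD(3)[OF p(1)] by (auto simp: weight_space_def)
  have off: "rep \<phi> u n' = 0" if "u \<in> carrier T" "p u \<in> ?W" "n' \<noteq> n" for u n'
    using that weight_space_iff[of u "wt m n"] by (intro lfun_eqI) (auto simp: wt_inj)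
  have "vectorspace.fin_dim class_ring (N\<lparr>carrier := ?W\<rparr>) \<and>
    vectorspace.dim class_ring (N\<lparr>carrier := ?W\<rparr>) = card B"
  proof (rule dim_via_map[where g = g and sc = "\<lambda>c s. cst c * s"])
    show "vectorspace class_ring (N\<lparr>carrier := ?W\<rparr>)" by (rule weight_vectorspace)
    show "vector_space (\<lambda>c (s :: 'k lfun). cst c * s)" by (rule vector_space_cst)
    show "inj_on g (carrier (N\<lparr>carrier := ?W\<rparr>))"
    proof (rule inj_onI, simp)
      fix x y assume xy: "x \<in> ?W" "y \<in> ?W" "g x = g y"
      then obtain u v where u: "u \<in> carrier T" "x = p u" and v: "v \<in> carrier T" "y = p v"
        using lift by metis
      have "rep \<phi> u n' = rep \<phi> v n'" for n'
        using xy u v gp off[of u n'] off[of v n'] by (cases "n' = n") auto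
      then show "x = y" using p_eq_iff[OF u(1) v(1)] u v by simp
    qed
    show "g ` carrier (N\<lparr>carrier := ?W\<rparr>) = lf.span B"
      unfolding assms(3)
    proof (intro equalityI subsetI)
      fix s assume "s \<in> g ` carrier (N\<lparr>carrier := ?W\<rparr>)"
      then obtain u where u: "u \<in> carrier T" "p u \<in> ?W" "s = rep \<phi> u n"
        using lift gp by fastforce
      obtain hc where h: "\<forall>m n. hc m n \<in> carrier T"
    "\<forall>m n n' ks. ev (rep \<phi> (hc m n) n') ks =
      (if n' = n \<and> length ks = m then ev (rep \<phi> u n) ks else 0)"
    "\<forall>m n. rep \<phi> (hc m n) n \<in> G m n"
    "finite {(m, n). rep \<phi> (hc m n) n \<noteq> 0}"
    using homogeneous_components[OF u(1)] by (elim exE conjE) (rule that)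
  note hc = h(1)[rule_format] and rh = h(2)[rule_format] and hG = h(3)[rule_format] and fin = h(4)
      have "s = rep \<phi> (hc m n) n"
        using weight_space_iff[OF u(1), of "wt m n"] u(2)
        by (intro lfun_eqI) (auto simp: rh u(3) wt_inj)
      then show "s \<in> G m n" using hG by simp
    next
      fix s assume "s \<in> G m n"
      then have "\<exists>u. u \<in> carrier T \<and> p u \<in> ?W \<and> rep \<phi> u n = s"
        unfolding G_def
      proof (induction rule: lf.span_induct_alt)
        case base
        show ?case using T_closed(1) weight_space_iff[of 0] by (intro exI[of _ 0]) (simp add: rep_zero)
      next
        case (step c b y)
        then obtain ns u where ns: "b = fword \<phi> ns" "length ns = m" "int r dvd n - sum_list ns"
          and u: "u \<in> carrier T" "p u \<in> ?W" "rep \<phi> u n = y" by auto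
        let ?w = "map gen_f ns"
        \<comment> \<open>The power of t makes up the difference between n and the degree of the
          word; condition \<open>ns(3)\<close> says that it lies in H(\<phi>).\<close>
        let ?b = "Poly_Mapping.single ?w (Poly_Mapping.single (n - sum_list ns) 1) :: gen list \<Rightarrow>\<^sub>0 'k laurent"
        have bT: "?b \<in> carrier T" by (intro T_closed(5) C_single ns(3))
        have "unf \<circ> gen_f = id" by (rule ext) (simp add: unf_def)
        then have unf: "map (unf \<circ> gen_f) ns = ns" "fdeg ?w = sum_list ns"
          by (simp_all add: fdeg_def)
        have lw: "?w \<in> lists (range gen_f)" by auto
        have rb: "rep \<phi> ?b n' = (if n' = n then fword \<phi> ns else 0)" for n'
          by (simp add: rep_single wact_fword[OF lw] unf lookup_single when_def)
        have hz: "ev (fword \<phi> ns) ks \<noteq> 0 \<Longrightarrow> m = length ks" for ks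
          using homog_fword[of ns \<phi>] ns(2) unfolding homog_def by metis
        have bW: "p ?b \<in> ?W" unfolding weight_space_iff[OF bT] rb
          using hz by (simp add: wt_inj)
        have T': "tscale c ?b + u \<in> carrier T" using bT u T_closed by blast
        have "p (tscale c ?b + u) = c \<odot>\<^bsub>N\<^esub> p ?b \<oplus>\<^bsub>N\<^esub> p u"
          using epiD(5)[OF p(1), of "tscale c ?b" u] epiD(6)[OF p(1) bT, of c] bT u T_closed by simp
        moreover have "c \<odot>\<^bsub>N\<^esub> p ?b \<oplus>\<^bsub>N\<^esub> p u \<in> ?W"
          using weight_space_subspace[of "wt m n"] bW u
          by (auto intro!: submodule.m_closed submodule.smult_closed)
        ultimately show ?case using T' u ns rb
          by (intro exI[of _ "tscale c ?b + u"]) (simp add: rep_add rep_tscale)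
      qed
      then show "s \<in> g ` carrier (N\<lparr>carrier := ?W\<rparr>)" using gp by force
    qed
  next
    fix x y assume "x \<in> carrier (N\<lparr>carrier := ?W\<rparr>)" "y \<in> carrier (N\<lparr>carrier := ?W\<rparr>)"
    then obtain u v where "u \<in> carrier T" "x = p u" "v \<in> carrier T" "y = p v"
      using lift[of x] lift[of y] by auto
    then show "g (x \<oplus>\<^bsub>N\<lparr>carrier := ?W\<rparr>\<^esub> y) = g x + g y"
      using gp T_closed(2)[of u v] epiD(5)[OF p(1), of u v] gp[of "u + v"] by (simp add: rep_add)
  next
    fix c x assume "x \<in> carrier (N\<lparr>carrier := ?W\<rparr>)"
    then obtain u where "u \<in> carrier T" "x = p u" using lift[of x] by auto
    then show "g (c \<odot>\<^bsub>N\<lparr>carrier := ?W\<rparr>\<^esub> x) = cst c * g x"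
      using gp T_closed(3)[of u c] epiD(6)[OF p(1), of u c] gp[of "tscale c u"] by (simp add: rep_tscale)
  qed (use assms in simp_all)
  then show "vectorspace.fin_dim class_ring (N\<lparr>carrier := weight_space N (wt m n)\<rparr>)"
    and "vectorspace.dim class_ring (N\<lparr>carrier := weight_space N (wt m n)\<rparr>) = card B" by auto
qed

lemma weight_space_trivial:
  assumes "\<And>m n. \<chi> \<noteq> wt m n"
  shows "vectorspace.fin_dim class_ring (N\<lparr>carrier := weight_space N \<chi>\<rparr>)"
    and "vectorspace.dim class_ring (N\<lparr>carrier := weight_space N \<chi>\<rparr>) = 0"
proof -
  have z: "weight_space N \<chi> = {\<zero>\<^bsub>N\<^esub>}"
  proof (intro equalityI subsetI)
    fix x assume x: "x \<in> weight_space N \<chi>"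
    then obtain u where u: "u \<in> carrier T" "x = p u"
      using epiD(3)[OF p(1)] by (auto simp: weight_space_def)
    then have "rep \<phi> u n = 0" for n
      using weight_space_iff[OF u(1), of \<chi>] x assms by (intro lfun_eqI) auto
    then have "p u = p 0" using p_eq_iff[OF u(1) T_closed(1)] by (simp add: rep_zero)
    then show "x \<in> {\<zero>\<^bsub>N\<^esub>}" using u epi_zero[OF p(1)] by simp
  qed (use submodule.zero_closed[OF weight_space_subspace] in simp)
  have "vectorspace.fin_dim class_ring (N\<lparr>carrier := weight_space N \<chi>\<rparr>) \<and>
    vectorspace.dim class_ring (N\<lparr>carrier := weight_space N \<chi>\<rparr>) = card ({} :: 'k lfun set)"
    by (rule dim_via_map[where g = "\<lambda>_. 0" and sc = "\<lambda>c s. cst c * s"])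
      (use weight_vectorspace[of \<chi>] in \<open>auto simp: vector_space_cst z lf.dependent_def\<close>)
  then show "vectorspace.fin_dim class_ring (N\<lparr>carrier := weight_space N \<chi>\<rparr>)"
    and "vectorspace.dim class_ring (N\<lparr>carrier := weight_space N \<chi>\<rparr>) = 0" by auto
qed

end

end

section \<open>Exponential-polynomial functions\<close>

text \<open>The operator that shifts n by one and subtracts \<open>l y\<close> times the original
  lowers the degree of \<open>p y\<close>, while it multiplies the leading coefficient of any other
  \<open>p b\<close> by \<open>l b - l y\<close>. Repeating it eliminates the exponent
  \<open>l y\<close>. Vanishing from some \<open>n0\<close> on is assumed so that one-sided
  information about a function can be exploited.\<close>

lemma exponential_polynomial_zero:
  fixes p :: "'b \<Rightarrow> 'k::field_char_0 poly"
  assumes "finite B" "inj_on l B" "\<And>b. b \<in> B \<Longrightarrow> l b \<noteq> 0"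
    and "\<And>n::nat. n \<ge> n0 \<Longrightarrow> (\<Sum>b\<in>B. poly (p b) (of_nat n) * l b ^ n) = 0"
    and "b \<in> B"
  shows "p b = 0"
proof -
  have "\<forall>b\<in>B. p b = 0" using assms(1-4)
  proof (induction B arbitrary: p rule: finite_induct)
    case (insert y B)
    have yB: "l b \<noteq> l y" if "b \<in> B" for b
      using insert.prems(1) insert.hyps that by (auto simp: inj_on_def)
    have main: "\<forall>b\<in>B. p b = 0"
      if "p y = 0 \<or> degree (p y) < d"
        "\<And>n::nat. n \<ge> n0 \<Longrightarrow> (\<Sum>b\<in>insert y B. poly (p b) (of_nat n) * l b ^ n) = 0" for d p
      using that
    proof (induction d arbitrary: p)
      case 0
      then show ?case using insert by (intro insert.IH) (auto simp: inj_on_insert)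
    next
      case (Suc d)
      \<comment> \<open>The coefficient polynomials after applying that operator;
        \<open>pcompose\<close> with \<open>[:1, 1:]\<close> is the shift of the argument by
        one.\<close>
      define q where "q b = Polynomial.smult (l b) (pcompose (p b) [:1, 1:]) - Polynomial.smult (l y) (p b)" for b
      have s: "(\<Sum>b\<in>insert y B. poly (q b) (of_nat n) * l b ^ n) = 0" if "n \<ge> n0" for n
      proof -
        have "(\<Sum>b\<in>insert y B. poly (q b) (of_nat n) * l b ^ n) =
          (\<Sum>b\<in>insert y B. poly (p b) (of_nat (Suc n)) * l b ^ Suc n) -
          l y * (\<Sum>b\<in>insert y B. poly (p b) (of_nat n) * l b ^ n)"
          unfolding sum_distrib_left sum_subtractf[symmetric]
          by (intro sum.cong refl) (simp add: q_def poly_pcompose algebra_simps)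
        then show ?thesis using Suc.prems(2)[of n] Suc.prems(2)[of "Suc n"] that by (simp del: of_nat_Suc)
      qed
      have "q y = 0 \<or> degree (q y) < d"
      proof (cases "degree (p y) = 0")
        case True
        then obtain c where "p y = [:c:]" by (rule degree_eq_zeroE)
        then show ?thesis by (simp add: q_def pcompose_const)
      next
        case False
        have lc: "coeff (pcompose (p y) [:1, 1:]) (degree (p y)) = lead_coeff (p y)"
          using lead_coeff_comp[of "[:1, 1:]" "p y"] by (simp add: degree_pcompose)
        have "degree (q y) \<le> degree (p y)"
          unfolding q_def by (rule degree_diff_le) (simp_all add: degree_pcompose)
        moreover have "coeff (q y) (degree (p y)) = 0" by (simp add: q_def lc)
        ultimately have "q y = 0 \<or> degree (q y) < degree (p y)" by (rule eq_zero_or_degree_less)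
        then show ?thesis using Suc.prems(1) False by auto
      qed
      then have q0: "\<forall>b\<in>B. q b = 0" using s by (rule Suc.IH)
      show ?case
      proof
        fix b assume b: "b \<in> B"
        have "coeff (pcompose (p b) [:1, 1:]) (degree (p b)) = lead_coeff (p b)"
          using lead_coeff_comp[of "[:1, 1:]" "p b"] by (simp add: degree_pcompose)
        then have "(l b - l y) * lead_coeff (p b) = coeff (q b) (degree (p b))"
          by (simp add: q_def algebra_simps)
        then show "p b = 0" using q0 yB[OF b] b by simp
      qed
    qed
    have B0: "\<forall>b\<in>B. p b = 0" using insert.prems(3) by (intro main[of p "Suc (degree (p y))"]) auto
    then have "poly (p y) (of_nat n) * l y ^ n = 0" if "n \<ge> n0" for n
      using insert.prems(3)[OF that] insert.hyps by simp
    then have "poly (p y) (of_nat n) = 0" if "n \<ge> n0" for n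
      using that insert.prems(2)[of y] by simp
    then have "of_nat ` {n0..} \<subseteq> {x. poly (p y) x = 0}" by auto
    moreover have "infinite (of_nat ` {n0..} :: 'k set)"
      by (subst finite_image_iff) (auto simp: inj_on_def infinite_Ici)
    ultimately have "p y = 0" using poly_roots_finite finite_subset by blast
    then show ?case using B0 by simp
  qed simp
  then show ?thesis using assms(5) by blast
qed

text \<open>Linearly independent functions are separated by finite combinations of evaluations. Such
  combinations extract the coefficient of one function without inverting a matrix.\<close>

lemma dual_weights:
  fixes f :: "'b \<Rightarrow> 'n \<Rightarrow> 'k::field"
  assumes "finite J" and "\<And>c. (\<And>k. (\<Sum>\<beta>\<in>J. c \<beta> * f \<beta> k) = 0) \<Longrightarrow> (\<forall>\<beta>\<in>J. c \<beta> = 0)"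
  shows "\<exists>A w. finite A \<and>
    (\<forall>\<beta>\<in>J. \<forall>\<gamma>\<in>J. (\<Sum>n\<in>A. w \<beta> n * f \<gamma> n) = (if \<beta> = \<gamma> then 1 else 0))"
  using assms
proof (induction J rule: finite_induct)
  case empty
  then show ?case by (intro exI[of _ "{}"]) simp
next
  case (insert y J)
  have "\<forall>\<beta>\<in>J. c \<beta> = 0" if "\<And>k. (\<Sum>\<beta>\<in>J. c \<beta> * f \<beta> k) = 0" for c
  proof -
    have "(\<Sum>\<beta>\<in>insert y J. (c(y := 0)) \<beta> * f \<beta> k) = (\<Sum>\<beta>\<in>J. c \<beta> * f \<beta> k)" for k
      using insert.hyps by (auto intro!: sum.cong)
    then have "\<forall>\<beta>\<in>insert y J. (c(y := 0)) \<beta> = 0" using that by (intro insert.prems) simp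
    then show ?thesis using insert.hyps by (metis fun_upd_apply insertCI)
  qed
  then have "\<exists>A w. finite A \<and>
      (\<forall>\<beta>\<in>J. \<forall>\<gamma>\<in>J. (\<Sum>n\<in>A. w \<beta> n * f \<gamma> n) = (if \<beta> = \<gamma> then 1 else 0))"
    by (rule insert.IH)
  then obtain A w where A: "finite A"
    and "\<forall>\<beta>\<in>J. \<forall>\<gamma>\<in>J. (\<Sum>n\<in>A. w \<beta> n * f \<gamma> n) = (if \<beta> = \<gamma> then 1 else 0)"
    by (elim exE conjE) (rule that)
  note w = this(2)[rule_format]
  define L where "L \<beta> g = (\<Sum>n\<in>A. w \<beta> n * g n)" for \<beta> g
  \<comment> \<open>The part of \<open>f y\<close> not accounted for by the functions in
    \<open>J\<close>. Independence gives a point k where it is nonzero; evaluation at k, corrected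
    by the old functionals and divided by \<open>h k\<close>, is dual to \<open>f y\<close>.\<close>
  define h where "h k = f y k - (\<Sum>\<beta>\<in>J. L \<beta> (f y) * f \<beta> k)" for k
  have "\<exists>k. h k \<noteq> 0"
  proof (rule ccontr)
    assume "\<not> (\<exists>k. h k \<noteq> 0)"
    then have "(\<Sum>\<beta>\<in>insert y J. (if \<beta> = y then 1 else - L \<beta> (f y)) * f \<beta> k) = 0" for k
    proof -
      have "(\<Sum>\<beta>\<in>J. (if \<beta> = y then 1 else - L \<beta> (f y)) * f \<beta> k) = - (\<Sum>\<beta>\<in>J. L \<beta> (f y) * f \<beta> k)"
        unfolding sum_negf[symmetric] using insert.hyps by (intro sum.cong) auto
      then show ?thesis using \<open>\<not> (\<exists>k. h k \<noteq> 0)\<close> insert.hyps by (simp add: h_def)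
    qed
    then have "\<forall>\<beta>\<in>insert y J. (if \<beta> = y then 1 else - L \<beta> (f y)) = (0::'k)"
      by (rule insert.prems)
    then show False by (metis insertI1 zero_neq_one)
  qed
  then obtain k where k: "h k \<noteq> 0" by blast
  define A' where "A' = insert k A"
  define ext where "ext v n = (if n \<in> A then v n else (0::'k))" for v :: "'n \<Rightarrow> 'k" and n
  have extS: "(\<Sum>n\<in>A'. ext v n * g n) = (\<Sum>n\<in>A. v n * g n)" for v g
    unfolding A'_def using A by (intro sum.mono_neutral_cong_right) (auto simp: ext_def)
  have atk: "(\<Sum>n\<in>A'. (if n = k then 1 else 0) * g n) = g k" for g :: "'n \<Rightarrow> 'k"
    using A by (simp add: A'_def if_distrib[of "\<lambda>x. x * _"] sum.delta cong: if_cong)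
  define wy where "wy n = ((if n = k then 1 else 0) - (\<Sum>\<beta>\<in>J. f \<beta> k * ext (w \<beta>) n)) / h k" for n
  define w' where "w' \<beta> n = (if \<beta> = y then wy n else ext (w \<beta>) n - L \<beta> (f y) * wy n)" for \<beta> n
  have Wy: "(\<Sum>n\<in>A'. wy n * g n) = (g k - (\<Sum>\<beta>\<in>J. f \<beta> k * L \<beta> g)) / h k" for g
  proof -
    have "(\<Sum>n\<in>A'. wy n * g n) =
      ((\<Sum>n\<in>A'. (if n = k then 1 else 0) * g n) - (\<Sum>n\<in>A'. \<Sum>\<beta>\<in>J. f \<beta> k * (ext (w \<beta>) n * g n))) / h k"
      unfolding sum_subtractf[symmetric] sum_divide_distrib
      by (intro sum.cong refl) (simp add: wy_def sum_distrib_right left_diff_distrib mult.assoc)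
    also have "(\<Sum>n\<in>A'. \<Sum>\<beta>\<in>J. f \<beta> k * (ext (w \<beta>) n * g n)) = (\<Sum>\<beta>\<in>J. f \<beta> k * L \<beta> g)"
      by (subst sum.swap) (simp add: sum_distrib_left[symmetric] extS L_def)
    finally show ?thesis by (simp only: atk)
  qed
  have LJ: "L \<beta> (f \<gamma>) = (if \<beta> = \<gamma> then 1 else 0)" if "\<beta> \<in> J" "\<gamma> \<in> J" for \<beta> \<gamma>
    using w that by (simp add: L_def)
  have wyJ: "(\<Sum>n\<in>A'. wy n * f \<gamma> n) = 0" if "\<gamma> \<in> J" for \<gamma>
  proof -
    have "(\<Sum>\<beta>\<in>J. f \<beta> k * L \<beta> (f \<gamma>)) = (\<Sum>\<beta>\<in>J. if \<beta> = \<gamma> then f \<beta> k else 0)"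
      by (intro sum.cong) (auto simp: LJ that)
    then show ?thesis using insert.hyps that by (simp add: Wy sum.delta)
  qed
  have wyy: "(\<Sum>n\<in>A'. wy n * f y n) = 1"
  proof -
    have "f y k - (\<Sum>\<beta>\<in>J. f \<beta> k * L \<beta> (f y)) = h k" by (simp add: h_def mult.commute)
    then show ?thesis using k by (simp add: Wy)
  qed
  have "(\<Sum>n\<in>A'. w' \<beta> n * f \<gamma> n) = (if \<beta> = \<gamma> then 1 else 0)"
    if "\<beta> \<in> insert y J" "\<gamma> \<in> insert y J" for \<beta> \<gamma>
  proof (cases "\<beta> = y")
    case True
    then show ?thesis using wyJ wyy that insert.hyps by (auto simp: w'_def)
  next
    case False
    have "(\<Sum>n\<in>A'. w' \<beta> n * f \<gamma> n) = L \<beta> (f \<gamma>) - L \<beta> (f y) * (\<Sum>n\<in>A'. wy n * f \<gamma> n)"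
      using False
      by (simp add: w'_def left_diff_distrib sum_subtractf extS mult.assoc flip: sum_distrib_left)
        (simp add: L_def)
    then show ?thesis using False that wyJ wyy LJ by auto
  qed
  moreover have "finite A'" using A by (simp add: A'_def)
  ultimately show ?case by blast
qed

section \<open>The span of the f-words in terms of monomials\<close>

lemma lfun_eq_step: "ev s [] = ev t [] \<Longrightarrow> (\<And>k. E k s = E k t) \<Longrightarrow> s = t"
proof (rule lfun_eqI)
  fix ks assume "ev s [] = ev t []" "\<And>k. E k s = E k t"
  then show "ev s ks = ev t ks" by (cases ks) (simp_all add: ev_Cons)
qed

lemma E_sum: "E n (\<Sum>i\<in>A. f i) = (\<Sum>i\<in>A. E n (f i))"
  by (induction A rule: infinite_finite_induct) simp_all

lemma E_lincomb: "E k (\<Sum>e\<in>A. cst (c e) * f e) = (\<Sum>e\<in>A. cst (c e) * E k (f e))"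
  by (simp add: E_sum)

lemma sum_mset_sum_swap: "(\<Sum>x\<in>#M. \<Sum>y\<in>A. f x y) = (\<Sum>y\<in>A. \<Sum>x\<in>#M. f x y)"
  by (induction M) (simp_all add: sum.distrib)

lemma triangle_sum:
  fixes f :: "nat \<Rightarrow> nat \<Rightarrow> 'a::comm_monoid_add"
  shows "(\<Sum>e\<le>c. \<Sum>g\<le>c - e. f e g) = (\<Sum>e\<le>c. \<Sum>g\<le>e. f g (e - g))"
proof -
  have "(\<Sum>e\<le>c. \<Sum>g\<le>c - e. f e g) = (\<Sum>(e, g)\<in>(SIGMA e:{..c}. {..c - e}). f e g)"
    by (simp add: sum.Sigma)
  also have "(SIGMA e:{..c}. {..c - e}) = {(e, g). e + g \<le> c}" by auto
  also have "(\<Sum>(e, g)\<in>{(e, g). e + g \<le> c}. f e g) = (\<Sum>e\<le>c. \<Sum>g\<le>e. f g (e - g))"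
    by (rule sum.triangle_reindex_eq)
  finally show ?thesis .
qed

text \<open>\<open>q b c\<close> is c! times a polynomial coefficient. The leading one must be
  nonzero only for \<open>D b > 0\<close>: a constant node may have the value 0, and then its
  generator may not occur at all in an admissible monomial.\<close>

locale expoly =
  fixes \<phi> :: "int \<Rightarrow> 'k::field_char_0" and \<Lambda> :: "'b set" and l :: "'b \<Rightarrow> 'k"
    and D :: "'b \<Rightarrow> nat" and q :: "'b \<Rightarrow> nat \<Rightarrow> 'k"
  assumes fin_L: "finite \<Lambda>" and inj_l: "inj_on l \<Lambda>" and l_nz: "\<And>b. b \<in> \<Lambda> \<Longrightarrow> l b \<noteq> 0"
    and q_top: "\<And>b. b \<in> \<Lambda> \<Longrightarrow> D b > 0 \<Longrightarrow> q b (D b) \<noteq> 0"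
    and phi: "\<And>m. \<phi> m = (\<Sum>b\<in>\<Lambda>. \<Sum>c\<le>D b. q b c * (l b powi m * of_int m ^ c / fact c))"
begin

definition J :: "('b \<times> nat) set" where
  "J = (SIGMA b:\<Lambda>. {..D b})"

text \<open>The division by \<open>fact c\<close> makes \<open>chi (b, c) (m + n) = \<Sum>\<^sub>j chi (b, j) m * chi (b, c - j) n\<close>, without
  binomial coefficients.\<close>

definition chi :: "'b \<times> nat \<Rightarrow> int \<Rightarrow> 'k" where
  "chi \<beta> k = l (fst \<beta>) powi k * of_int k ^ snd \<beta> / fact (snd \<beta>)"

lemma fin_J: "finite J"
  using fin_L by (simp add: J_def)

lemma sum_J: "(\<Sum>\<beta>\<in>J. f \<beta>) = (\<Sum>b\<in>\<Lambda>. \<Sum>j\<le>D b. f (b, j))"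
  unfolding J_def using fin_L by (subst sum.Sigma) auto

lemma chi_add:
  assumes "b \<in> \<Lambda>"
  shows "chi (b, c) (m + k) = (\<Sum>e\<le>c. chi (b, e) m * chi (b, c - e) k)"
proof -
  have "(of_int (m + k) :: 'k) ^ c / fact c =
      (\<Sum>e\<le>c. (of_int m ^ e / fact e) * (of_int k ^ (c - e) / fact (c - e)))"
    unfolding of_int_add binomial_ring sum_divide_distrib
    by (intro sum.cong refl) (simp add: binomial_fact)
  then show ?thesis using l_nz[OF assms]
    by (simp add: chi_def power_int_add sum_distrib_left mult_ac times_divide_eq_right[symmetric]
        del: times_divide_eq_right of_int_add)
qed

lemma chi_independent:
  assumes "\<And>k. (\<Sum>\<beta>\<in>J. c \<beta> * chi \<beta> k) = 0"
  shows "\<forall>\<beta>\<in>J. c \<beta> = 0"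
proof clarify
  fix b j assume bj: "(b, j) \<in> J"
  define p where "p b = (\<Sum>j\<le>D b. Polynomial.monom (c (b, j) / fact j) j)" for b
  have "p b = 0"
  proof (rule exponential_polynomial_zero[of \<Lambda> l 0 p])
    fix n :: nat
    have "(\<Sum>b\<in>\<Lambda>. poly (p b) (of_nat n) * l b ^ n) = (\<Sum>\<beta>\<in>J. c \<beta> * chi \<beta> (int n))"
      unfolding sum_J sum_distrib_right
      by (simp add: p_def poly_sum poly_monom sum_distrib_left chi_def mult_ac)
    then show "(\<Sum>b\<in>\<Lambda>. poly (p b) (of_nat n) * l b ^ n) = 0" using assms by simp
  qed (use fin_L inj_l l_nz bj in \<open>auto simp: J_def\<close>)
  then have "coeff (p b) j = 0" by simp
  moreover have "coeff (p b) j = c (b, j) / fact j"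
    using bj by (simp add: p_def coeff_sum J_def sum.delta)
  ultimately show "c (b, j) = 0" by simp
qed

definition X :: "'b \<times> nat \<Rightarrow> 'k lfun" where
  "X \<beta> = Lf (\<lambda>ks. case ks of [k] \<Rightarrow> chi \<beta> k | _ \<Rightarrow> 0)"

lemma ev_X: "ev (X \<beta>) ks = (case ks of [k] \<Rightarrow> chi \<beta> k | _ \<Rightarrow> 0)"
  by (simp add: X_def Lf_inverse)

lemma ev_X_Nil [simp]: "ev (X \<beta>) [] = 0"
  by (simp add: ev_X)

lemma E_X [simp]: "E k (X \<beta>) = cst (chi \<beta> k)"
proof (rule lfun_eqI)
  fix ks
  have "ev (cst c) ks = (if ks = [] then c else 0)" for c :: 'k by transfer simp
  then show "ev (E k (X \<beta>)) ks = ev (cst (chi \<beta> k)) ks"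
    by (simp flip: ev_Cons) (simp add: ev_X split: list.splits)
qed

lemma DH_X:
  assumes "b \<in> \<Lambda>"
  shows "DH n (X (b, c)) = (\<Sum>e\<le>c. cst (chi (b, e) n) * X (b, c - e))"
  by (rule lfun_eq_step) (simp_all add: E_sum chi_add[OF assms] cst_sum cst_mult)

text \<open>A derivation that lengthens lists by one sends a linear function to a quadratic one. The
  convolution is found by comparing \<open>E k\<close> of both sides, which the addition formula for
  \<open>chi\<close> reduces to \<open>DH_X\<close>.\<close>

lemma DF_X:
  assumes "b \<in> \<Lambda>"
  shows "DF n (X (b, c)) = (\<Sum>e\<le>c. cst (chi (b, e) n) * (\<Sum>g\<le>c - e. X (b, g) * X (b, c - e - g)))"
proof (rule lfun_eq_step)
  fix k
  have "E k (\<Sum>g\<le>m. X (b, g) * X (b, m - g)) = 2 * (\<Sum>g\<le>m. cst (chi (b, g) k) * X (b, m - g))" for m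
  proof -
    have "(\<Sum>g\<le>m. X (b, g) * cst (chi (b, m - g) k)) = (\<Sum>g\<le>m. X (b, m - g) * cst (chi (b, g) k))"
      by (rule sum.reindex_bij_witness[of _ "\<lambda>g. m - g" "\<lambda>g. m - g"]) auto
    then show ?thesis by (simp add: E_sum sum.distrib mult.commute)
  qed
  then have "E k (\<Sum>e\<le>c. cst (chi (b, e) n) * (\<Sum>g\<le>c - e. X (b, g) * X (b, c - e - g))) =
      (\<Sum>e\<le>c. cst (chi (b, e) n) * (2 * (\<Sum>g\<le>c - e. cst (chi (b, g) k) * X (b, c - e - g))))"
    by (simp only: E_lincomb)
  also have "\<dots> = 2 * (\<Sum>e\<le>c. \<Sum>g\<le>c - e. cst (chi (b, e) n) * cst (chi (b, g) k) * X (b, c - e - g))"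
    by (simp add: sum_distrib_left mult_ac)
  also have "\<dots> = 2 * (\<Sum>e\<le>c. \<Sum>g\<le>e. cst (chi (b, g) n) * cst (chi (b, e - g) k) * X (b, c - e))"
    by (subst triangle_sum) (intro arg_cong[of _ _ "(*) 2"] sum.cong refl, auto)
  also have "\<dots> = 2 * DH (n + k) (X (b, c))"
    by (simp add: DH_X[OF assms] chi_add[OF assms] cst_sum cst_mult sum_distrib_right)
  finally show "E k (DF n (X (b, c))) =
    E k (\<Sum>e\<le>c. cst (chi (b, e) n) * (\<Sum>g\<le>c - e. X (b, g) * X (b, c - e - g)))" by simp
qed simp

text \<open>The dependence of f(n) on n is expanded in the independent functions
  \<open>chi \<beta>\<close>. The coefficient of \<open>chi \<beta> n\<close> is
  \<open>PB \<beta>\<close> in \<open>PF \<phi> n\<close>, \<open>DX \<beta> \<gamma>\<close> in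
  \<open>DF n (X \<gamma>)\<close>, and \<open>FB \<beta> M\<close> in
  \<open>F \<phi> n (mon M)\<close>.\<close>

definition PB :: "'b \<times> nat \<Rightarrow> 'k lfun" where
  "PB \<beta> = (\<Sum>c=snd \<beta>..D (fst \<beta>). cst (q (fst \<beta>) c) * X (fst \<beta>, c - snd \<beta>))"

lemma PF_eq: "PF \<phi> n = (\<Sum>\<beta>\<in>J. cst (chi \<beta> n) * PB \<beta>)"
proof -
  have "PF \<phi> n = (\<Sum>b\<in>\<Lambda>. \<Sum>c\<le>D b. cst (q b c) * (\<Sum>e\<le>c. cst (chi (b, e) n) * X (b, c - e)))"
  proof (rule lfun_eq_step)
    fix k
    have "\<phi> (n + k) = (\<Sum>b\<in>\<Lambda>. \<Sum>c\<le>D b. q b c * chi (b, c) (n + k))"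
      by (simp add: phi chi_def)
    then have "\<phi> (n + k) = (\<Sum>b\<in>\<Lambda>. \<Sum>c\<le>D b. q b c * (\<Sum>e\<le>c. chi (b, e) n * chi (b, c - e) k))"
      by (simp add: chi_add)
    then show "E k (PF \<phi> n) =
        E k (\<Sum>b\<in>\<Lambda>. \<Sum>c\<le>D b. cst (q b c) * (\<Sum>e\<le>c. cst (chi (b, e) n) * X (b, c - e)))"
      by (simp add: E_sum cst_sum cst_mult)
  qed simp
  also have "\<dots> = (\<Sum>b\<in>\<Lambda>. \<Sum>e\<le>D b. cst (chi (b, e) n) * PB (b, e))"
  proof (rule sum.cong[OF refl])
    fix b
    have "(\<Sum>c\<le>D b. cst (q b c) * (\<Sum>e\<le>c. cst (chi (b, e) n) * X (b, c - e))) =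
      (\<Sum>c\<le>D b. \<Sum>e\<le>D b. if e \<le> c then cst (chi (b, e) n) * (cst (q b c) * X (b, c - e)) else 0)"
      by (intro sum.cong refl) (auto simp: sum_distrib_left mult_ac sum.If_cases Int_absorb1 intro!: sum.cong)
    also have "\<dots> = (\<Sum>e\<le>D b. \<Sum>c\<le>D b. if e \<le> c then cst (chi (b, e) n) * (cst (q b c) * X (b, c - e)) else 0)"
      by (rule sum.swap)
    also have "\<dots> = (\<Sum>e\<le>D b. cst (chi (b, e) n) * PB (b, e))"
      unfolding PB_def sum_distrib_left
      by (intro sum.cong refl sum.mono_neutral_cong_right) auto
    finally show "(\<Sum>c\<le>D b. cst (q b c) * (\<Sum>e\<le>c. cst (chi (b, e) n) * X (b, c - e))) =
      (\<Sum>e\<le>D b. cst (chi (b, e) n) * PB (b, e))" .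
  qed
  also have "\<dots> = (\<Sum>\<beta>\<in>J. cst (chi \<beta> n) * PB \<beta>)"
    by (simp only: sum_J)
  finally show ?thesis .
qed

definition DX :: "'b \<times> nat \<Rightarrow> 'b \<times> nat \<Rightarrow> 'k lfun" where
  "DX \<beta> \<gamma> = (if fst \<beta> = fst \<gamma> \<and> snd \<beta> \<le> snd \<gamma>
    then \<Sum>g\<le>snd \<gamma> - snd \<beta>. X (fst \<beta>, g) * X (fst \<beta>, snd \<gamma> - snd \<beta> - g) else 0)"

lemma DF_X_DX:
  assumes "\<gamma> \<in> J"
  shows "DF n (X \<gamma>) = (\<Sum>\<beta>\<in>J. cst (chi \<beta> n) * DX \<beta> \<gamma>)"
proof -
  obtain b c where \<gamma>: "\<gamma> = (b, c)" by (cases \<gamma>)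
  have b: "b \<in> \<Lambda>" "c \<le> D b" using assms by (auto simp: J_def \<gamma>)
  have "(\<Sum>\<beta>\<in>J. cst (chi \<beta> n) * DX \<beta> \<gamma>) = (\<Sum>\<beta>\<in>(\<lambda>e. (b, e)) ` {..c}. cst (chi \<beta> n) * DX \<beta> \<gamma>)"
    using b fin_J by (intro sum.mono_neutral_right) (auto simp: J_def DX_def \<gamma>)
  also have "\<dots> = (\<Sum>e\<le>c. cst (chi (b, e) n) * DX (b, e) \<gamma>)"
    by (subst sum.reindex) (auto simp: inj_on_def)
  also have "\<dots> = DF n (X \<gamma>)"
    unfolding \<gamma> DF_X[OF b(1)] by (intro sum.cong) (auto simp: DX_def)
  finally show ?thesis by simp
qed

section \<open>Monomials and their images under the f(n)\<close>

definition mon :: "('b \<times> nat) multiset \<Rightarrow> 'k lfun" where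
  "mon M = (\<Prod>\<beta>\<in>#M. X \<beta>)"

lemma mon_simps [simp]: "mon {#} = 1" "mon (add_mset \<beta> M) = X \<beta> * mon M"
  by (simp_all add: mon_def)

lemma derivation_mon:
  fixes d :: "'k lfun \<Rightarrow> 'k lfun"
  assumes "d 1 = 0" and "\<And>s t. d (s * t) = d s * t + s * d t"
  shows "d (mon M) = (\<Sum>\<gamma>\<in>#M. d (X \<gamma>) * mon (M - {#\<gamma>#}))"
proof (induction M)
  case (add \<beta> M)
  have "X \<beta> * (\<Sum>\<gamma>\<in>#M. d (X \<gamma>) * mon (M - {#\<gamma>#})) =
      (\<Sum>\<gamma>\<in>#M. d (X \<gamma>) * mon (add_mset \<beta> M - {#\<gamma>#}))"
    unfolding sum_mset_distrib_left
    by (intro arg_cong[of _ _ sum_mset] image_mset_cong)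
      (auto simp: mult_ac dest!: multi_member_split)
  then show ?case by (simp add: assms add)
qed (simp add: assms)

definition FB :: "'b \<times> nat \<Rightarrow> ('b \<times> nat) multiset \<Rightarrow> 'k lfun" where
  "FB \<beta> M = PB \<beta> * mon M - (\<Sum>\<gamma>\<in>#M. DX \<beta> \<gamma> * mon (M - {#\<gamma>#}))"

lemma F_mon:
  assumes "set_mset M \<subseteq> J"
  shows "F \<phi> n (mon M) = (\<Sum>\<beta>\<in>J. cst (chi \<beta> n) * FB \<beta> M)"
proof -
  have d1: "DF n 1 = 0" using DF_cst[of n 1] by simp
  have "DF n (mon M) = (\<Sum>\<gamma>\<in>#M. DF n (X \<gamma>) * mon (M - {#\<gamma>#}))"
    by (rule derivation_mon) (simp_all add: d1 DF_mult)
  also have "\<dots> = (\<Sum>\<gamma>\<in>#M. \<Sum>\<beta>\<in>J. cst (chi \<beta> n) * (DX \<beta> \<gamma> * mon (M - {#\<gamma>#})))"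
    using assms by (intro arg_cong[of _ _ sum_mset] image_mset_cong)
      (auto simp: DF_X_DX sum_distrib_right mult.assoc)
  also have "\<dots> = (\<Sum>\<beta>\<in>J. cst (chi \<beta> n) * (\<Sum>\<gamma>\<in>#M. DX \<beta> \<gamma> * mon (M - {#\<gamma>#})))"
    unfolding sum_mset_distrib_left by (rule sum_mset_sum_swap)
  finally show ?thesis
    by (simp add: F_def PF_eq FB_def sum_distrib_right right_diff_distrib sum_subtractf mult.assoc)
qed

definition Gm :: "nat \<Rightarrow> 'k lfun set" where
  "Gm m = lf.span {fword \<phi> ns |ns. length ns = m}"

lemma Gm_subspace: "lf.subspace (Gm m)"
  unfolding Gm_def by (rule lf.subspace_span)

lemma F_Gm: "s \<in> Gm m \<Longrightarrow> F \<phi> n s \<in> Gm (Suc m)"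
  unfolding Gm_def
proof (induction rule: lf.span_induct_alt)
  case (step c x y)
  then obtain ns where "x = fword \<phi> ns" "length ns = m" by auto
  then have "F \<phi> n x \<in> lf.span {fword \<phi> ns |ns. length ns = Suc m}"
    by (intro lf.span_base CollectI exI[of _ "n # ns"]) (simp add: fword_def)
  then show ?case using step by (simp add: HF_linear lf.span_add lf.span_scale)
qed (simp add: lf.span_zero)

lemma duals: "\<exists>A w. finite A \<and> (\<forall>\<beta>\<in>J. \<forall>\<gamma>\<in>J.
    (\<Sum>n\<in>A. w \<beta> n * chi \<gamma> n) = (if \<beta> = \<gamma> then 1 else 0))"
  by (rule dual_weights[OF fin_J]) (rule chi_independent)

text \<open>The dual weights invert the expansion of \<open>F_mon\<close>: each
  \<open>FB \<beta> M\<close> is a finite combination of the functions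
  \<open>F \<phi> n (mon M)\<close>.\<close>

lemma FB_Gm:
  assumes "set_mset M \<subseteq> J" "mon M \<in> Gm m" "\<beta> \<in> J"
  shows "FB \<beta> M \<in> Gm (Suc m)"
proof -
  obtain A w where A: "finite A" and "\<forall>\<beta>\<in>J. \<forall>\<gamma>\<in>J.
    (\<Sum>n\<in>A. w \<beta> n * chi \<gamma> n) = (if \<beta> = \<gamma> then 1 else 0)"
    using duals by (elim exE conjE) (rule that)
  note w = this(2)[rule_format]
  have "(\<Sum>n\<in>A. cst (w \<beta> n) * F \<phi> n (mon M)) =
      (\<Sum>n\<in>A. \<Sum>\<gamma>\<in>J. cst (w \<beta> n * chi \<gamma> n) * FB \<gamma> M)"
    by (simp only: F_mon[OF assms(1)] sum_distrib_left cst_mult mult.assoc)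
  also have "\<dots> = (\<Sum>\<gamma>\<in>J. cst (\<Sum>n\<in>A. w \<beta> n * chi \<gamma> n) * FB \<gamma> M)"
    by (subst sum.swap) (simp add: cst_sum sum_distrib_right)
  also have "\<dots> = (\<Sum>\<gamma>\<in>J. if \<beta> = \<gamma> then FB \<gamma> M else 0)"
    using assms(3) by (intro sum.cong refl) (simp add: w)
  also have "\<dots> = FB \<beta> M" using fin_J assms(3) by (simp add: sum.delta')
  finally have "FB \<beta> M = (\<Sum>n\<in>A. cst (w \<beta> n) * F \<phi> n (mon M))" by simp
  then show ?thesis using F_Gm[OF assms(2)]
    by (simp add: lf.subspace_sum[OF Gm_subspace] lf.subspace_scale[OF Gm_subspace])
qed

definition adm :: "('b \<times> nat) multiset \<Rightarrow> bool" where
  "adm M \<longleftrightarrow> set_mset M \<subseteq> J \<and>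
     (\<forall>b\<in>\<Lambda>. \<forall>k::nat. D b = 0 \<and> q b 0 = of_nat k \<longrightarrow> count M (b, 0) \<le> k)"

lemma adm_add: "adm M \<Longrightarrow> b \<in> \<Lambda> \<Longrightarrow> D b > 0 \<Longrightarrow> c \<le> D b \<Longrightarrow> adm (add_mset (b, c) M)"
  by (auto simp: adm_def J_def)

lemma adm_diff: "adm M \<Longrightarrow> adm (M - N)"
  by (auto simp: adm_def dest: in_diffD intro: le_trans[OF diff_le_self])

text \<open>On a constant node \<open>PB\<close> is a multiple of X and \<open>DX\<close> is X^2.
  Each of the \<open>count M (b, 0)\<close> copies of X, replaced by X^2, gives the same monomial as
  one additional factor X.\<close>

lemma FB_simple:
  assumes "set_mset M \<subseteq> J" "b \<in> \<Lambda>" "D b = 0"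
  shows "FB (b, 0) M = cst (q b 0 - of_nat (count M (b, 0))) * mon (add_mset (b, 0) M)"
proof -
  have "(\<Sum>\<gamma>\<in>#M. DX (b, 0) \<gamma> * mon (M - {#\<gamma>#})) =
      (\<Sum>\<gamma>\<in>#M. if \<gamma> = (b, 0) then X (b, 0) * mon M else 0)"
  proof (intro arg_cong[of _ _ sum_mset] image_mset_cong)
    fix \<gamma> assume g: "\<gamma> \<in># M"
    then have "\<gamma> \<in> J" using assms(1) by auto
    then show "DX (b, 0) \<gamma> * mon (M - {#\<gamma>#}) = (if \<gamma> = (b, 0) then X (b, 0) * mon M else 0)"
      using g assms(3) by (auto simp: DX_def J_def mult_ac dest!: multi_member_split)
  qed
  also have "\<dots> = X (b, 0) * mon M * of_nat (count M (b, 0))"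
    by (rule sum_mset_delta)
  finally show ?thesis using assms(3)
    by (simp add: FB_def PB_def cst_diff cst_of_nat algebra_simps)
qed

lemma sum_mset_span: "(\<And>x. x \<in># M \<Longrightarrow> f x \<in> lf.span S) \<Longrightarrow> (\<Sum>x\<in>#M. f x) \<in> lf.span S"
  by (induction M) (auto simp: lf.span_zero lf.span_add)

text \<open>Monomials exceeding a bound are never produced, because the scalar in
  \<open>FB_simple\<close> vanishes exactly at the bound. Nodes with \<open>D b > 0\<close> carry no
  bound, and the terms there involve only generators of the same node.\<close>

lemma FB_adm:
  assumes M: "adm M" "size M = m" and \<beta>: "\<beta> \<in> J"
  shows "FB \<beta> M \<in> lf.span (mon ` {M. adm M \<and> size M = Suc m})" (is "_ \<in> lf.span ?S")
proof -
  obtain b e where be: "\<beta> = (b, e)" by (cases \<beta>)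
  have b: "b \<in> \<Lambda>" "e \<le> D b" using \<beta> by (auto simp: J_def be)
  have MJ: "set_mset M \<subseteq> J" using M by (simp add: adm_def)
  show ?thesis
  proof (cases "D b = 0")
    case True
    then have e0: "e = 0" using b by simp
    show ?thesis
    proof (cases "adm (add_mset (b, 0) M)")
      case True
      then have "mon (add_mset (b, 0) M) \<in> ?S" using M(2) by (intro imageI) simp
      then show ?thesis unfolding be e0 FB_simple[OF MJ b(1) \<open>D b = 0\<close>]
        by (intro lf.span_scale lf.span_base)
    next
      case False
      have "(b, 0) \<in> J" using b by (simp add: J_def)
      then obtain b' k where k: "b' \<in> \<Lambda>" "D b' = 0" "q b' 0 = of_nat k" "\<not> count (add_mset (b, 0) M) (b', 0) \<le> k"
        using False MJ unfolding adm_def by auto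
      moreover have "count M (b', 0) \<le> k" using M(1) k unfolding adm_def by blast
      \<comment> \<open>One multiplicity has changed, so the violated bound is the one at
        \<open>b\<close>, and it was attained before.\<close>
      ultimately have "b' = b" "count M (b, 0) = k" by (auto split: if_splits)
      then show ?thesis unfolding be e0 FB_simple[OF MJ b(1) \<open>D b = 0\<close>] using k
        by (simp add: lf.span_zero)
    qed
  next
    case False
    then have D: "D b > 0" by simp
    have "PB \<beta> * mon M \<in> lf.span ?S"
      unfolding be PB_def sum_distrib_right
    proof (rule lf.span_sum)
      fix c assume c: "c \<in> {snd (b, e)..D (fst (b, e))}"
      have "adm (add_mset (b, c - e) M)" using adm_add[OF M(1) b(1) D, of "c - e"] c by auto
      then have "cst (q b c) * mon (add_mset (b, c - e) M) \<in> lf.span ?S"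
        using M(2) by (intro lf.span_scale lf.span_base imageI) simp
      then show "cst (q (fst (b, e)) c) * X (fst (b, e), c - snd (b, e)) * mon M \<in> lf.span ?S"
        by (simp add: mult.assoc)
    qed
    moreover have "(\<Sum>\<gamma>\<in>#M. DX \<beta> \<gamma> * mon (M - {#\<gamma>#})) \<in> lf.span ?S"
    proof (rule sum_mset_span)
      fix \<gamma> assume g: "\<gamma> \<in># M"
      show "DX \<beta> \<gamma> * mon (M - {#\<gamma>#}) \<in> lf.span ?S"
      proof (cases "fst \<gamma> = b \<and> e \<le> snd \<gamma>")
        case True
        have "snd \<gamma> \<le> D b" using g MJ True by (auto simp: J_def)
        then have a: "adm (add_mset (b, i) (add_mset (b, snd \<gamma> - e - i) (M - {#\<gamma>#})))"
          if "i \<le> snd \<gamma> - e" for i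
          using that by (intro adm_add adm_diff M(1) b(1) D) auto
        have "(\<Sum>i\<le>snd \<gamma> - e. mon (add_mset (b, i) (add_mset (b, snd \<gamma> - e - i) (M - {#\<gamma>#})))) \<in> lf.span ?S"
          using g M(2) by (intro lf.span_sum lf.span_base imageI CollectI conjI a)
            (auto simp: size_Diff_singleton dest!: multi_member_split)
        then show ?thesis using True by (simp add: be DX_def sum_distrib_right mult.assoc)
      qed (auto simp: be DX_def lf.span_zero)
    qed
    ultimately show ?thesis unfolding FB_def by (rule lf.span_diff)
  qed
qed

lemma Gm_subset: "Gm m \<subseteq> lf.span (mon ` {M. adm M \<and> size M = m})"
proof (induction m)
  case 0
  have "adm {#}" by (simp add: adm_def)
  then have "1 \<in> mon ` {M. adm M \<and> size M = 0}" by force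
  then show ?case unfolding Gm_def
    by (intro lf.span_minimal lf.subspace_span) (auto simp: fword_def intro: lf.span_base)
next
  case (Suc m)
  have step: "F \<phi> n s \<in> lf.span (mon ` {M. adm M \<and> size M = Suc m})"
    if "s \<in> lf.span (mon ` {M. adm M \<and> size M = m})" for n s
    using that
  proof (induction rule: lf.span_induct_alt)
    case (step c x y)
    then obtain M where M: "x = mon M" "adm M" "size M = m" by auto
    then have "set_mset M \<subseteq> J" by (simp add: adm_def)
    then have "F \<phi> n x \<in> lf.span (mon ` {M. adm M \<and> size M = Suc m})"
      unfolding M(1) by (simp only: F_mon) (intro lf.span_sum lf.span_scale FB_adm M)
    then show ?case using step by (simp add: HF_linear lf.span_add lf.span_scale)
  qed (simp add: lf.span_zero)
  have "fword \<phi> ns \<in> lf.span (mon ` {M. adm M \<and> size M = Suc m})" if len: "length ns = Suc m" for ns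
  proof -
    obtain n ns' where ns: "ns = n # ns'" using len by (cases ns) auto
    then have "length ns' = m" using len by simp
    then have "fword \<phi> ns' \<in> Gm m" unfolding Gm_def by (intro lf.span_base) auto
    then show ?thesis using step[of "fword \<phi> ns'" n] Suc ns by (auto simp: fword_def)
  qed
  then show ?case unfolding Gm_def by (intro lf.span_minimal lf.subspace_span) auto
qed

text \<open>\<open>FB (b, D b - j) M\<close> is solved for the term with \<open>X (b, j)\<close>,
  whose scalar is the nonzero leading coefficient. The linear terms left over have a smaller index,
  and so has one factor of each quadratic term, except when j = 0: then X_0^2 replaces a factor of
  top index. Hence the induction on j with an inner induction on the multiplicity of the top
  generator.\<close>

lemma X_mon_Gm:
  assumes IH: "\<And>M. adm M \<Longrightarrow> size M = m \<Longrightarrow> mon M \<in> Gm m"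
    and b: "b \<in> \<Lambda>" "D b > 0"
  shows "j \<le> D b \<Longrightarrow> adm M \<Longrightarrow> size M = m \<Longrightarrow> X (b, j) * mon M \<in> Gm (Suc m)"
proof (induction j arbitrary: M rule: less_induct)
  case (less j)
  note IHj = less.IH
  from less.prems show ?case
  proof (induction "count M (b, D b)" arbitrary: M rule: less_induct)
    case less
    note IHc = less.hyps
    \<comment> \<open>With this choice the top summand c = D b of \<open>PB\<close> contains the
      generator with index j.\<close>
    let ?e = "D b - j"
    have MJ: "set_mset M \<subseteq> J" using less.prems by (simp add: adm_def)
    have PB: "PB (b, ?e) * mon M - cst (q b (D b)) * (X (b, j) * mon M) \<in> Gm (Suc m)"
    proof -
      have "PB (b, ?e) = cst (q b (D b)) * X (b, j) + (\<Sum>c\<in>{?e..<D b}. cst (q b c) * X (b, c - ?e))"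
        using less.prems(1) by (simp add: PB_def sum.last_plus)
      then have "PB (b, ?e) * mon M - cst (q b (D b)) * (X (b, j) * mon M) =
          (\<Sum>c\<in>{?e..<D b}. cst (q b c) * (X (b, c - ?e) * mon M))"
        by (simp add: algebra_simps sum_distrib_left)
      also have "\<dots> \<in> Gm (Suc m)"
        using less.prems by (intro lf.subspace_sum[OF Gm_subspace] lf.subspace_scale[OF Gm_subspace] IHj) auto
      finally show ?thesis .
    qed
    have "DX (b, ?e) \<gamma> * mon (M - {#\<gamma>#}) \<in> Gm (Suc m)" if g: "\<gamma> \<in># M" for \<gamma>
    proof (cases "fst \<gamma> = b \<and> ?e \<le> snd \<gamma>")
      case True
      then obtain c where c: "\<gamma> = (b, c)" "?e \<le> c" by (cases \<gamma>) auto
      have cD: "c \<le> D b" using g MJ c by (auto simp: J_def)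
      have szM: "size (add_mset x (M - {#\<gamma>#})) = m" for x
        using g less.prems(3) by (auto dest!: multi_member_split)
      have t: "X (b, i) * X (b, i') * mon (M - {#\<gamma>#}) \<in> Gm (Suc m)" if i: "i + i' = c - ?e" for i i'
      proof -
        have le: "i \<le> D b" "i' \<le> D b" "i + i' \<le> j" using i cD less.prems(1) by auto
        have adm: "adm (add_mset (b, x) (M - {#\<gamma>#}))" if "x \<le> D b" for x
          using that by (intro adm_add adm_diff less.prems b)
        have eq: "X (b, i) * X (b, i') * mon (M - {#\<gamma>#}) = X (b, i) * mon (add_mset (b, i') (M - {#\<gamma>#}))"
          "X (b, i) * X (b, i') * mon (M - {#\<gamma>#}) = X (b, i') * mon (add_mset (b, i) (M - {#\<gamma>#}))"
          by (simp_all add: mult_ac)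
        \<comment> \<open>The indices satisfy i + i' \<le> j, so both can reach j only if all three
          are 0.\<close>
        consider "i < j" | "i' < j" | "j = 0" "i = 0" "i' = 0" using le by linarith
        then show ?thesis
        proof cases
          case 1
          then show ?thesis unfolding eq(1) by (intro IHj le adm szM)
        next
          case 2
          then show ?thesis unfolding eq(2) by (intro IHj le adm szM)
        next
          case 3
          \<comment> \<open>The removed factor is the top generator; because D b > 0 it differs from
            the inserted one, so its multiplicity drops.\<close>
          then have cDb: "c = D b" using c cD i by simp
          have "count (add_mset (b, 0) (M - {#\<gamma>#})) (b, D b) < count M (b, D b)"
            using g b(2) c(1) cDb by (auto dest!: multi_member_split)
          from IHc[OF this less.prems(1) adm szM] show ?thesis unfolding eq(1) using 3 by simp
        qed
      qed
      have "(\<Sum>i\<le>c - ?e. X (b, i) * X (b, c - ?e - i) * mon (M - {#\<gamma>#})) \<in> Gm (Suc m)"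
        by (intro lf.subspace_sum[OF Gm_subspace] t) auto
      then show ?thesis using c by (simp add: DX_def sum_distrib_right)
    qed (auto simp: DX_def lf.subspace_0[OF Gm_subspace])
    then have sm: "(\<Sum>\<gamma>\<in>#M. DX (b, ?e) \<gamma> * mon (M - {#\<gamma>#})) \<in> Gm (Suc m)"
      unfolding Gm_def by (rule sum_mset_span)
    have "FB (b, ?e) M \<in> Gm (Suc m)"
      using b by (intro FB_Gm[OF MJ IH[OF less.prems(2,3)]]) (simp add: J_def)
    then have "FB (b, ?e) M + (\<Sum>\<gamma>\<in>#M. DX (b, ?e) \<gamma> * mon (M - {#\<gamma>#})) -
       (PB (b, ?e) * mon M - cst (q b (D b)) * (X (b, j) * mon M)) \<in> Gm (Suc m)"
      by (intro lf.subspace_diff[OF Gm_subspace] lf.subspace_add[OF Gm_subspace] sm PB)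
    then have "cst (q b (D b)) * (X (b, j) * mon M) \<in> Gm (Suc m)"
      by (simp add: FB_def)
    then have "cst (inverse (q b (D b))) * (cst (q b (D b)) * (X (b, j) * mon M)) \<in> Gm (Suc m)"
      by (rule lf.subspace_scale[OF Gm_subspace])
    then show ?case using q_top[OF b] by (simp add: mult.assoc[symmetric] cst_mult[symmetric])
  qed
qed

text \<open>At a constant node the scalar of \<open>FB_simple\<close> can be inverted: if it were
  zero, the new factor would exceed the bound for \<open>M\<close>. Other nodes are the previous
  lemma.\<close>

lemma mon_Gm: "adm M \<Longrightarrow> size M = m \<Longrightarrow> mon M \<in> Gm m"
proof (induction m arbitrary: M)
  case 0
  have "1 = fword \<phi> []" by (simp add: fword_def)
  then show ?case using 0 unfolding Gm_def by (auto intro!: lf.span_base)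
next
  case (Suc m)
  then obtain b j M' where M: "M = add_mset (b, j) M'" by (metis size_eq_Suc_imp_eq_union surj_pair)
  have M': "adm M'" "size M' = m" using Suc.prems adm_diff[of M "{#(b, j)#}"] by (auto simp: M)
  have bj: "b \<in> \<Lambda>" "j \<le> D b" using Suc.prems by (auto simp: adm_def J_def M)
  show ?case
  proof (cases "D b = 0")
    case True
    let ?c = "q b 0 - of_nat (count M' (b, 0))"
    have j: "j = 0" using True bj by simp
    have "?c \<noteq> 0"
    proof
      assume "?c = 0"
      then have "q b 0 = of_nat (count M' (b, 0))" by simp
      then have "count M (b, 0) \<le> count M' (b, 0)" using Suc.prems(1) bj True unfolding adm_def by blast
      then show False by (simp add: M j)
    qed
    have "FB (b, 0) M' \<in> Gm (Suc m)"
      using M' bj by (intro FB_Gm Suc.IH) (auto simp: adm_def J_def)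
    then have "cst (inverse ?c) * FB (b, 0) M' \<in> Gm (Suc m)"
      by (rule lf.subspace_scale[OF Gm_subspace])
    also have "cst (inverse ?c) * FB (b, 0) M' = mon M"
    proof -
      have "FB (b, 0) M' = cst ?c * mon M"
        using FB_simple[of M' b] M' bj True by (simp add: adm_def M j)
      then show ?thesis using \<open>?c \<noteq> 0\<close> by (simp add: mult.assoc[symmetric] cst_mult[symmetric] del: mult.assoc)
    qed
    finally show ?thesis .
  next
    case False
    then show ?thesis using X_mon_Gm[OF Suc.IH bj(1) _ bj(2) M'] by (simp add: M)
  qed
qed

lemma Gm_eq: "Gm m = lf.span (mon ` {M. adm M \<and> size M = m})"
proof
  show "lf.span (mon ` {M. adm M \<and> size M = m}) \<subseteq> Gm m"
    by (rule lf.span_minimal[OF _ Gm_subspace]) (auto intro: mon_Gm)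
qed (rule Gm_subset)

text \<open>A dual combination of the derivations \<open>E n\<close> acts as the partial derivative
  in one generator. Applying those for all factors of \<open>M\<close> and evaluating at the empty
  list annihilates every other monomial; on \<open>M\<close> it gives a product of positive
  integers, nonzero in characteristic zero.\<close>

lemma mon_coefficient:
  assumes "set_mset M \<subseteq> J"
  shows "\<exists>L. (\<forall>s t. L (s + t) = L s + L t) \<and> (\<forall>c s. L (cst c * s) = c * L s) \<and>
    (\<forall>M'. set_mset M' \<subseteq> J \<longrightarrow> (L (mon M') \<noteq> 0 \<longleftrightarrow> M' = M))"
  using assms
proof (induction M)
  case empty
  have "ev (mon M') [] = (if M' = {#} then 1 else 0)" for M'
    by (cases M') simp_all
  then show ?case by (intro exI[of _ "\<lambda>s. ev s []"]) simp
next
  case (add \<beta> M)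
  then obtain L where L: "\<And>s t. L (s + t) = L s + L t" "\<And>c s. L (cst c * s) = c * L s"
    "\<And>M'. set_mset M' \<subseteq> J \<Longrightarrow> (L (mon M') \<noteq> 0 \<longleftrightarrow> M' = M)" by auto
  obtain A w where A: "finite A" and "\<forall>\<beta>\<in>J. \<forall>\<gamma>\<in>J.
    (\<Sum>n\<in>A. w \<beta> n * chi \<gamma> n) = (if \<beta> = \<gamma> then 1 else 0)"
    using duals by (elim exE conjE) (rule that)
  note w = this(2)[rule_format]
  define d where "d s = (\<Sum>n\<in>A. cst (w \<beta> n) * E n s)" for s
  have d1: "d 1 = 0" by (simp add: d_def)
  have dm: "d (s * t) = d s * t + s * d t" for s t
    by (simp add: d_def sum.distrib sum_distrib_left sum_distrib_right algebra_simps)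
  have dX: "d (X \<gamma>) = (if \<gamma> = \<beta> then 1 else 0)" if "\<gamma> \<in> J" for \<gamma>
  proof -
    have "d (X \<gamma>) = cst (\<Sum>n\<in>A. w \<beta> n * chi \<gamma> n)" by (simp add: d_def cst_sum cst_mult)
    then show ?thesis using w[of \<beta> \<gamma>] add.prems that by auto
  qed
  have dmon: "d (mon M') = cst (of_nat (count M' \<beta>)) * mon (M' - {#\<beta>#})" if "set_mset M' \<subseteq> J" for M'
  proof -
    have "d (mon M') = (\<Sum>\<gamma>\<in>#M'. d (X \<gamma>) * mon (M' - {#\<gamma>#}))"
      by (rule derivation_mon[OF d1 dm])
    also have "\<dots> = (\<Sum>\<gamma>\<in>#M'. if \<gamma> = \<beta> then mon (M' - {#\<beta>#}) else 0)"
      using that by (intro arg_cong[of _ _ sum_mset] image_mset_cong) (auto simp: dX)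
    also have "\<dots> = cst (of_nat (count M' \<beta>)) * mon (M' - {#\<beta>#})"
      by (simp add: sum_mset_delta cst_of_nat mult.commute)
    finally show ?thesis .
  qed
  show ?case
  proof (intro exI[of _ "\<lambda>s. L (d s)"] conjI allI impI)
    show "L (d (s + t)) = L (d s) + L (d t)" for s t
      by (simp add: d_def algebra_simps sum.distrib L)
    show "L (d (cst c * s)) = c * L (d s)" for c s
    proof -
      have "d (cst c) = 0" by (simp add: d_def)
      then show ?thesis by (simp add: dm L)
    qed
    fix M' assume M': "set_mset M' \<subseteq> J"
    then have "set_mset (M' - {#\<beta>#}) \<subseteq> J" by (auto dest: in_diffD)
    then have "L (d (mon M')) \<noteq> 0 \<longleftrightarrow> count M' \<beta> \<noteq> 0 \<and> M' - {#\<beta>#} = M"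
      using L(3) by (simp add: dmon[OF M'] L)
    also have "\<dots> \<longleftrightarrow> M' = add_mset \<beta> M"
      by (auto simp: count_eq_zero_iff dest!: multi_member_split)
    finally show "L (d (mon M')) \<noteq> 0 \<longleftrightarrow> M' = add_mset \<beta> M" .
  qed
qed

lemma mon_independent:
  assumes "finite S" "\<And>M. M \<in> S \<Longrightarrow> set_mset M \<subseteq> J" "(\<Sum>M\<in>S. cst (c M) * mon M) = 0" "M \<in> S"
  shows "c M = 0"
proof -
  obtain L where L: "\<And>s t. L (s + t) = L s + L t" "\<And>c s. L (cst c * s) = c * L s"
    "\<And>M'. set_mset M' \<subseteq> J \<Longrightarrow> (L (mon M') \<noteq> 0 \<longleftrightarrow> M' = M)"
    using mon_coefficient[OF assms(2)[OF assms(4)]] by auto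
  have L0: "L 0 = 0" using L(1)[of 0 0] by simp
  have LS: "L (\<Sum>M\<in>S. f M) = (\<Sum>M\<in>S. L (f M))" for f
    by (induction S rule: infinite_finite_induct) (simp_all add: L L0)
  have "0 = L (\<Sum>M\<in>S. cst (c M) * mon M)" using assms(3) L0 by simp
  also have "\<dots> = (\<Sum>M'\<in>S. c M' * L (mon M'))" by (simp add: LS L(2))
  also have "\<dots> = (\<Sum>M'\<in>S. if M' = M then c M * L (mon M) else 0)"
    using assms(2) L(3) by (intro sum.cong refl) auto
  also have "\<dots> = c M * L (mon M)" using assms by (simp add: sum.delta')
  finally show ?thesis using L(3)[OF assms(2)[OF assms(4)]] by simp
qed

end

section \<open>Isotypic components of cyclic permutation modules\<close>

lemma sum_shift_mod:
  fixes f :: "nat \<Rightarrow> 'a::comm_monoid_add"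
  assumes "r > 0"
  shows "(\<Sum>j<r. f ((j + i) mod r)) = (\<Sum>j<r. f j)"
proof -
  have inj: "inj_on (\<lambda>j. (j + i) mod r) {..<r}"
  proof (rule inj_onI)
    fix x y assume xy: "x \<in> {..<r}" "y \<in> {..<r}" "(x + i) mod r = (y + i) mod r"
    then have "[x + i = y + i] (mod r)" by (simp add: cong_def)
    then have "[x = y] (mod r)" by (simp add: cong_add_rcancel_nat)
    then show "x = y" using xy by (simp add: cong_def)
  qed
  moreover have "(\<lambda>j. (j + i) mod r) ` {..<r} \<subseteq> {..<r}" using assms by auto
  ultimately have "(\<lambda>j. (j + i) mod r) ` {..<r} = {..<r}" by (simp add: endo_inj_surj)
  then have "(\<Sum>j<r. f j) = (\<Sum>j\<in>(\<lambda>j. (j + i) mod r) ` {..<r}. f j)" by simp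
  also have "\<dots> = (\<Sum>j<r. f ((j + i) mod r))" using inj by (subst sum.reindex) simp_all
  finally show ?thesis by simp
qed

lemma (in vector_space) independent_image:
  assumes "finite S" "\<And>c. (\<Sum>y\<in>S. scale (c y) (u y)) = 0 \<Longrightarrow> \<forall>y\<in>S. c y = 0"
  shows "inj_on u S" "independent (u ` S)"
proof -
  show inj: "inj_on u S"
  proof (rule inj_onI, rule ccontr)
    fix x y assume xy: "x \<in> S" "y \<in> S" "u x = u y" "x \<noteq> y"
    let ?c = "\<lambda>t. (if t = x then 1 else 0) - (if t = y then 1 else 0)"
    have "(\<Sum>t\<in>S. scale (?c t) (u t)) =
      (\<Sum>t\<in>S. if t = x then u t else 0) - (\<Sum>t\<in>S. if t = y then u t else 0)"
      unfolding sum_subtractf[symmetric] by (intro sum.cong) (auto simp: scale_left_diff_distrib)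
    then have "(\<Sum>t\<in>S. scale (?c t) (u t)) = 0" using xy assms(1) by (simp add: sum.delta)
    from assms(2)[OF this] show False using xy(1,4) by auto
  qed
  show "independent (u ` S)"
  proof
    assume "dependent (u ` S)"
    then obtain f where f: "\<exists>v\<in>u ` S. f v \<noteq> 0" "(\<Sum>v\<in>u ` S. scale (f v) v) = 0"
      using dependent_finite[of "u ` S"] assms(1) by auto
    then have "(\<Sum>y\<in>S. scale (f (u y)) (u y)) = 0" using inj by (simp add: sum.reindex)
    from assms(2)[OF this] show False using f(1) by auto
  qed
qed

text \<open>A finite set \<open>Y\<close> indexing independent vectors is permuted by a cyclic group of order \<open>r\<close>.
  The isotypic vectors \<open>u y\<close> are nonzero precisely when the stabiliser of \<open>y\<close> acts trivially, and
  one such vector per orbit gives a basis, counted as in Burnside's lemma.\<close>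

lemma cyclic_span_dim:
  fixes sc :: "'k::field_char_0 \<Rightarrow> 'v::ab_group_add \<Rightarrow> 'v" and v :: "'y \<Rightarrow> 'v"
  assumes "vector_space sc" and finY: "finite Y"
    and ind: "\<And>c. (\<Sum>y\<in>Y. sc (c y) (v y)) = 0 \<Longrightarrow> \<forall>y\<in>Y. c y = 0"
    and pY: "\<And>y. y \<in> Y \<Longrightarrow> p y \<in> Y" and pr: "\<And>y. y \<in> Y \<Longrightarrow> (p ^^ r) y = y"
    and r: "r > 0" and zr: "z ^ r = 1"
    and u: "\<And>y. u y = (\<Sum>j<r. sc (z ^ j) (v ((p ^^ j) y)))"
  shows "\<exists>B. finite B \<and> \<not> module.dependent sc B \<and> module.span sc B = module.span sc (u ` Y) \<and>
    of_nat r * of_nat (card B) = (\<Sum>j<r. z ^ j * of_nat (card {y \<in> Y. (p ^^ j) y = y}))"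
proof -
  interpret vector_space sc by fact
  have z0: "z \<noteq> 0" using zr r by (auto simp: power_0_left)
  have zmod: "z ^ (j mod r) = z ^ j" for j
  proof -
    have "z ^ (r * (j div r) + j mod r) = z ^ (j mod r)" by (simp only: power_add power_mult zr) simp
    then show ?thesis by simp
  qed
  have PY: "(p ^^ j) y \<in> Y" if "y \<in> Y" for j y
    using that by (induction j) (auto intro: pY)
  have Pmod: "(p ^^ (j mod r)) y = (p ^^ j) y" if "y \<in> Y" for j y
    by (rule funpow_mod_eq[OF pr[OF that]])
  have Padd: "(p ^^ i) ((p ^^ j) y) = (p ^^ (i + j)) y" for i j y by (simp add: funpow_add)
  have Pinv: "\<exists>k. (p ^^ k) ((p ^^ j) y) = y" if "y \<in> Y" for j y
  proof -
    have "(p ^^ (r - j mod r)) ((p ^^ (j mod r)) y) = y"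
      unfolding Padd using r pr[OF that] by (simp add: less_imp_le)
    then show ?thesis using Pmod[OF that] by metis
  qed
  have Pinj: "y = y'" if "y \<in> Y" "y' \<in> Y" "(p ^^ i) y = (p ^^ i) y'" for i y y'
  proof -
    have "(p ^^ (r - i mod r)) ((p ^^ (i mod r)) t) = t" if "t \<in> Y" for t
      unfolding Padd using r pr[OF that] by (simp add: less_imp_le)
    then show ?thesis using that Pmod by metis
  qed
  \<comment> \<open>Along an orbit the vectors \<open>u\<close> differ by scalars, by reindexing the
    sum modulo r.\<close>
  have ush: "sc (z ^ i) (u ((p ^^ i) y)) = u y" if y: "y \<in> Y" for i y
  proof -
    have "sc (z ^ i) (u ((p ^^ i) y)) = (\<Sum>j<r. sc (z ^ ((j + i) mod r)) (v ((p ^^ ((j + i) mod r)) y)))"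
      unfolding u scale_sum_right by (intro sum.cong refl) (simp add: Padd zmod Pmod[OF y] power_add mult.commute)
    also have "\<dots> = u y" unfolding u by (rule sum_shift_mod[OF r])
    finally show ?thesis .
  qed
  define St where "St y = {j. j < r \<and> (p ^^ j) y = y}" for y
  define good where "good y \<longleftrightarrow> (\<forall>j\<in>St y. z ^ j = 1)" for y
  \<comment> \<open>The coefficient of \<open>v x\<close> in \<open>u y\<close>.\<close>
  define kap where "kap y x = (\<Sum>j | j < r \<and> (p ^^ j) y = x. z ^ j)" for y x
  have finSt: "finite (St y)" "0 \<in> St y" for y using r by (auto simp: St_def)
  have u0: "u y = 0" if "y \<in> Y" "\<not> good y" for y
  proof -
    have "\<exists>j\<in>St y. z ^ j \<noteq> 1" using that by (auto simp: good_def)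
    then obtain j where j: "j \<in> St y" "z ^ j \<noteq> 1" by blast
    then have "sc (z ^ j) (u y) = u y" using ush[OF that(1), of j] by (simp add: St_def)
    then have "sc (z ^ j - 1) (u y) = 0" by (simp add: scale_left_diff_distrib)
    then show ?thesis using j(2) by simp
  qed
  have uexp: "u y = (\<Sum>x\<in>Y. sc (kap y x) (v x))" if y: "y \<in> Y" for y
  proof -
    have "u y = (\<Sum>x\<in>Y. \<Sum>j | j \<in> {..<r} \<and> (p ^^ j) y = x. sc (z ^ j) (v ((p ^^ j) y)))"
      unfolding u by (rule sum.group[symmetric]) (use finY PY[OF y] in auto)
    also have "\<dots> = (\<Sum>x\<in>Y. sc (kap y x) (v x))"
      unfolding kap_def scale_sum_left by (intro sum.cong refl) auto
    finally show ?thesis .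
  qed
  have kap_good: "kap y y = of_nat (card (St y))" if "good y" for y
    using that unfolding kap_def good_def St_def by simp
  \<comment> \<open>No character sum is needed here: it is the coefficient of \<open>v y\<close> in
    the zero vector.\<close>
  have kap_bad: "kap y y = 0" if "y \<in> Y" "\<not> good y" for y
    using ind[of "kap y"] uexp[OF that(1)] u0[OF that] that(1) by auto
  define orb where "orb y = {x. \<exists>j. x = (p ^^ j) y}" for y
  have orb_self: "y \<in> orb y" for y unfolding orb_def by (auto intro: exI[of _ 0])
  have orbY: "orb y \<subseteq> Y" if "y \<in> Y" for y using PY[OF that] by (auto simp: orb_def)
  have orb_eq: "orb x = orb y" if y: "y \<in> Y" and x: "x \<in> orb y" for x y
  proof -
    obtain j where j: "x = (p ^^ j) y" using x by (auto simp: orb_def)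
    obtain k where k: "(p ^^ k) x = y" using Pinv[OF y] j by metis
    show ?thesis
    proof (intro equalityI subsetI)
      fix t assume "t \<in> orb x" then show "t \<in> orb y" unfolding orb_def j by (auto simp: Padd)
    next
      fix t assume "t \<in> orb y"
      then obtain i where "t = (p ^^ i) ((p ^^ k) x)" by (auto simp: orb_def k)
      then show "t \<in> orb x" by (auto simp: orb_def Padd)
    qed
  qed
  \<comment> \<open>The choice depends on the orbit alone, so all its points get the same
    representative.\<close>
  define rep where "rep y = (SOME x. x \<in> orb y)" for y
  have rep_orb: "rep y \<in> orb y" for y unfolding rep_def by (rule someI[of _ y]) (rule orb_self)
  have rep_eq: "rep x = rep y" if "y \<in> Y" "x \<in> orb y" for x y
    using orb_eq[OF that] by (simp add: rep_def)
  have rep_rep: "rep (rep y) = rep y" if "y \<in> Y" for y by (rule rep_eq[OF that rep_orb])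
  have repY: "rep y \<in> Y" if "y \<in> Y" for y using rep_orb orbY[OF that] by auto
  define Y' where "Y' = {y \<in> rep ` Y. good y}"
  have Y'Y: "Y' \<subseteq> Y" using repY by (auto simp: Y'_def)
  have finY': "finite Y'" using finY Y'Y by (rule rev_finite_subset)
  have rep_Y': "rep y = y" if "y \<in> rep ` Y" for y using that rep_rep by auto
  have ind': "\<forall>y\<in>Y'. c y = 0" if c: "(\<Sum>y\<in>Y'. sc (c y) (u y)) = 0" for c
  proof
    fix x assume x: "x \<in> Y'"
    have "(\<Sum>y\<in>Y'. sc (c y) (u y)) = (\<Sum>t\<in>Y. sc (\<Sum>y\<in>Y'. c y * kap y t) (v t))"
    proof -
      have "(\<Sum>y\<in>Y'. sc (c y) (u y)) = (\<Sum>y\<in>Y'. \<Sum>t\<in>Y. sc (c y * kap y t) (v t))"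
        using Y'Y by (intro sum.cong refl) (simp add: uexp subset_iff scale_sum_right)
      then show ?thesis by (subst (asm) sum.swap) (simp add: scale_sum_left)
    qed
    then have "(\<Sum>y\<in>Y'. c y * kap y x) = 0" using ind[of "\<lambda>t. \<Sum>y\<in>Y'. c y * kap y t"] c x Y'Y by auto
    also have "(\<Sum>y\<in>Y'. c y * kap y x) = (\<Sum>y\<in>Y'. if y = x then c x * kap x x else 0)"
    proof (intro sum.cong refl)
      fix y assume y: "y \<in> Y'"
      have "kap y x = 0" if "y \<noteq> x"
      proof -
        have "x \<notin> orb y"
        proof
          assume "x \<in> orb y"
          then have "rep x = rep y" using y Y'Y by (intro rep_eq) auto
          moreover have "x \<in> rep ` Y" "y \<in> rep ` Y" using x y by (simp_all add: Y'_def)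
          ultimately show False using that rep_Y'[of x] rep_Y'[of y] by simp
        qed
        then have "{j. j < r \<and> (p ^^ j) y = x} = {}" by (auto simp: orb_def)
        then show ?thesis unfolding kap_def by (simp only: sum.empty)
      qed
      then show "c y * kap y x = (if y = x then c x * kap x x else 0)" by simp
    qed
    also have "\<dots> = c x * kap x x" using finY' x by (simp add: sum.delta)
    finally have "c x * kap x x = 0" .
    moreover have "kap x x \<noteq> 0"
      using kap_good[of x] x finSt[of x] by (auto simp: Y'_def card_eq_0_iff)
    ultimately show "c x = 0" by simp
  qed
  note B = independent_image[OF finY' ind']
  have "span (u ` Y') = span (u ` Y)"
  proof
    show "span (u ` Y') \<subseteq> span (u ` Y)" using Y'Y by (intro span_mono image_mono)
    have "u y \<in> span (u ` Y')" if y: "y \<in> Y" for y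
    proof (cases "good (rep y)")
      case True
      then have ry: "rep y \<in> Y'" using y by (auto simp: Y'_def)
      obtain i where i: "rep y = (p ^^ i) y" using rep_orb[of y] by (auto simp: orb_def)
      have "u y = sc (z ^ i) (u (rep y))" using ush[OF y, of i] i by simp
      then show ?thesis using ry by (simp add: span_scale span_base)
    next
      case False
      obtain i where i: "rep y = (p ^^ i) y" using rep_orb[of y] by (auto simp: orb_def)
      have "u y = sc (z ^ i) (u (rep y))" using ush[OF y, of i] i by simp
      also have "u (rep y) = 0" using u0[OF repY[OF y] False] .
      finally show ?thesis by (simp add: span_zero)
    qed
    then show "span (u ` Y) \<subseteq> span (u ` Y')" by (intro span_minimal subspace_span) auto
  qed
  moreover have "of_nat r * of_nat (card Y') = (\<Sum>j<r. z ^ j * of_nat (card {y \<in> Y. (p ^^ j) y = y}))"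
  proof -
    \<comment> \<open>Weighted Burnside count: exchanging the sums turns the fixed-point counts into
      the diagonal coefficients \<open>kap y y\<close>, which are then summed orbit by
      orbit.\<close>
    have "(\<Sum>j<r. z ^ j * of_nat (card {y \<in> Y. (p ^^ j) y = y})) =
        (\<Sum>j<r. \<Sum>y\<in>Y. if (p ^^ j) y = y then z ^ j else 0)"
      using finY by (intro sum.cong refl) (simp add: sum.If_cases Int_def mult.commute)
    also have "\<dots> = (\<Sum>y\<in>Y. kap y y)"
      by (subst sum.swap) (simp add: kap_def sum.If_cases Int_def)
    also have "\<dots> = (\<Sum>x\<in>rep ` Y. \<Sum>y | y \<in> Y \<and> rep y = x. kap y y)"
      by (rule sum.image_gen[OF finY])
    also have "\<dots> = (\<Sum>x\<in>rep ` Y. if good x then of_nat r else 0)"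
    proof (rule sum.cong[OF refl])
      fix x assume x: "x \<in> rep ` Y"
      then have xY: "x \<in> Y" using repY by auto
      have fib: "{y. y \<in> Y \<and> rep y = x} = orb x"
      proof (intro equalityI subsetI)
        fix y assume "y \<in> {y. y \<in> Y \<and> rep y = x}"
        then show "y \<in> orb x" using orb_eq[of y x] rep_orb[of y] orb_self[of y] by auto
      next
        fix y assume "y \<in> orb x"
        then show "y \<in> {y. y \<in> Y \<and> rep y = x}" using rep_eq[OF xY] rep_Y'[OF x] orbY[OF xY] by auto
      qed
      have Steq: "{j. j < r \<and> (p ^^ j) y = y} = St x" if yo: "y \<in> orb x" for y
      proof -
        obtain i where i: "y = (p ^^ i) x" using yo by (auto simp: orb_def)
        have "(p ^^ j) y = y \<longleftrightarrow> (p ^^ j) x = x" for j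
        proof -
          have "(p ^^ j) y = (p ^^ i) ((p ^^ j) x)" by (simp add: i Padd add.commute)
          then show ?thesis using Pinj[OF PY[OF xY] xY, of i j] i by auto
        qed
        then show ?thesis by (simp add: St_def)
      qed
      have "(\<Sum>y | y \<in> Y \<and> rep y = x. kap y y) = (\<Sum>y\<in>orb x. kap x x)"
        unfolding fib by (intro sum.cong refl) (simp add: kap_def Steq Steq[OF orb_self])
      also have "\<dots> = of_nat (card (orb x)) * kap x x" by simp
      also have "\<dots> = (if good x then of_nat r else 0)"
      proof (cases "good x")
        case True
        \<comment> \<open>Orbit-stabiliser: the exponents below r that take x to a given point of
          its orbit are a cyclic translate of the stabiliser.\<close>
        have card_fib: "card {j. j < r \<and> (p ^^ j) x = y} = card (St x)" if yo: "y \<in> orb x" for y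
        proof -
          obtain i where i: "y = (p ^^ i) x" using yo by (auto simp: orb_def)
          have c: "card {j. j < r \<and> Q j} = (\<Sum>j<r. if Q j then 1 else 0)" for Q
            by (simp add: sum.If_cases Int_def)
          have "(\<Sum>j<r. if (p ^^ j) x = y then 1 else 0 :: nat) =
              (\<Sum>j<r. if (p ^^ ((j + i) mod r)) x = y then 1 else 0)"
            by (rule sum_shift_mod[OF r, symmetric])
          also have "\<dots> = (\<Sum>j<r. if (p ^^ j) x = x then 1 else 0)"
          proof (intro sum.cong refl)
            fix j
            have "(p ^^ ((j + i) mod r)) x = (p ^^ i) ((p ^^ j) x)"
              by (simp add: Pmod[OF xY] Padd add.commute)
            then show "(if (p ^^ ((j + i) mod r)) x = y then 1 else 0 :: nat) = (if (p ^^ j) x = x then 1 else 0)"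
              using Pinj[OF PY[OF xY] xY, of i j] i by auto
          qed
          finally show ?thesis unfolding St_def c .
        qed
        have fino: "finite (orb x)" using finY orbY[OF xY] by (rule rev_finite_subset)
        have "r = (\<Sum>j<r. 1)" by simp
        also have "\<dots> = (\<Sum>y\<in>orb x. \<Sum>j | j \<in> {..<r} \<and> (p ^^ j) x = y. 1)"
          by (rule sum.group[symmetric]) (use fino in \<open>auto simp: orb_def\<close>)
        also have "\<dots> = card (orb x) * card (St x)"
          using card_fib by simp
        finally have "of_nat r = (of_nat (card (orb x)) * of_nat (card (St x)) :: 'k)"
          by (metis of_nat_mult)
        then show ?thesis using True kap_good[OF True] by simp
      qed (simp add: kap_bad[OF xY])
      finally show "(\<Sum>y | y \<in> Y \<and> rep y = x. kap y y) = (if good x then of_nat r else 0)" .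
    qed
    also have "\<dots> = of_nat r * of_nat (card Y')"
      using finY by (simp add: sum.If_cases Y'_def Int_def mult.commute)
    finally show ?thesis by simp
  qed
  moreover have "card (u ` Y') = card Y'" using B(1) by (rule card_image)
  ultimately show ?thesis using B(2) finY' by (intro exI[of _ "u ` Y'"]) simp
qed

section \<open>The grading by degree and the twist\<close>

text \<open>The effect on matrix coefficients of the rotation t to z t of the loop, under which e(k)
  is multiplied by z^k.\<close>

lift_definition twist :: "'k \<Rightarrow> 'k lfun \<Rightarrow> 'k::field lfun" is "\<lambda>z s ks. z powi sum_list ks * s ks" .

lemma ev_twist [simp]: "ev (twist z s) ks = z powi sum_list ks * ev s ks"
  by transfer simp

lemma E_twist: "z \<noteq> 0 \<Longrightarrow> E k (twist z s) = cst (z powi k) * twist z (E k s)"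
  by (rule lfun_eqI) (simp flip: ev_Cons add: power_int_add)

lemma twist_mult:
  assumes "z \<noteq> 0"
  shows "twist z (s * t) = twist z s * twist z t"
proof (rule lfun_eqI)
  show "ev (twist z (s * t)) ks = ev (twist z s * twist z t) ks" for ks
  proof (induction ks arbitrary: s t)
    case (Cons k ks)
    have tw: "twist z (a + b) = twist z a + twist z b" for a b :: "'a lfun"
      by (rule lfun_eqI) (simp add: algebra_simps)
    have "ev (twist z (s * t)) (k # ks) = z powi k * ev (twist z (E k s * t) + twist z (s * E k t)) ks"
      unfolding ev_Cons E_twist[OF assms] E_mult tw by simp
    also have "\<dots> = ev (twist z s * twist z t) (k # ks)"
      unfolding ev_Cons E_mult E_twist[OF assms] ev_simps Cons.IH
      by (simp add: mult.assoc mult.left_commute[of _ "cst (z powi k)"] distrib_left)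
    finally show ?case .
  qed simp
qed

text \<open>Degree g modulo r: the lists that bring a function of degree g back to the top have sum
  congruent to -g. The degree is kept modulo r because \<open>\<phi>\<close> lives on multiples of
  r.\<close>

definition hdeg :: "nat \<Rightarrow> int \<Rightarrow> 'k::comm_ring_1 lfun \<Rightarrow> bool" where
  "hdeg r g s \<longleftrightarrow> (\<forall>ks. \<not> int r dvd g + sum_list ks \<longrightarrow> ev s ks = 0)"

lemma hdeg_E: "hdeg r g s \<Longrightarrow> hdeg r (g + k) (E k s)"
  by (auto simp: hdeg_def add.assoc simp flip: ev_Cons)

context sl2_loop
begin

lemma hdeg_H: "hdeg r g s \<Longrightarrow> hdeg r (g + n) (H \<phi> n s)"
proof -
  have "ev (H \<phi> n s) ks = 0" if "hdeg r g s" "\<not> int r dvd g + n + sum_list ks" for ks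
    using that
  proof (induction ks arbitrary: g s)
    case Nil
    have "\<phi> n = 0 \<or> ev s [] = 0"
    proof (rule ccontr)
      assume "\<not> (\<phi> n = 0 \<or> ev s [] = 0)"
      then have "int r dvd n" "int r dvd g" using phi_dvd Nil.prems(1)[unfolded hdeg_def, rule_format, of "[]"] by auto
      then show False using Nil.prems(2) by simp
    qed
    then show ?case by auto
  next
    case (Cons k ks)
    have "ev (H \<phi> n (E k s)) ks = 0"
      by (rule Cons.IH[OF hdeg_E[OF Cons.prems(1)]]) (use Cons.prems(2) in \<open>simp add: algebra_simps\<close>)
    moreover have "ev (E (n + k) s) ks = 0"
      using Cons.prems by (simp add: hdeg_def algebra_simps flip: ev_Cons)
    ultimately show ?case by (simp add: ev_Cons E_H)
  qed
  then show "hdeg r g s \<Longrightarrow> hdeg r (g + n) (H \<phi> n s)" by (simp add: hdeg_def)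
qed

lemma hdeg_F: "hdeg r g s \<Longrightarrow> hdeg r (g + n) (F \<phi> n s)"
proof -
  have "ev (F \<phi> n s) ks = 0" if "hdeg r g s" "\<not> int r dvd g + n + sum_list ks" for ks
    using that
  proof (induction ks arbitrary: g s)
    case (Cons k ks)
    have "ev (F \<phi> n (E k s)) ks = 0"
      by (rule Cons.IH[OF hdeg_E[OF Cons.prems(1)]]) (use Cons.prems(2) in \<open>simp add: algebra_simps\<close>)
    moreover have "ev (H \<phi> (n + k) s) ks = 0"
      using hdeg_H[OF Cons.prems(1), of "n + k"] Cons.prems(2) by (simp add: hdeg_def algebra_simps)
    ultimately show ?case by (simp add: ev_Cons E_F)
  qed simp
  then show "hdeg r g s \<Longrightarrow> hdeg r (g + n) (F \<phi> n s)" by (simp add: hdeg_def)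
qed

lemma hdeg_fword: "hdeg r (sum_list ns) (fword \<phi> ns)"
proof (induction ns)
  case Nil
  then show ?case by (auto simp: hdeg_def fword_def one_lfun.rep_eq)
next
  case (Cons n ns)
  then show ?case using hdeg_F[OF Cons, of n] by (simp add: fword_def add.commute)
qed

definition prj :: "int \<Rightarrow> 'k lfun \<Rightarrow> 'k lfun" where
  "prj n s = Lf (\<lambda>ks. if int r dvd n + sum_list ks then ev s ks else 0)"

lemma ev_prj [simp]: "ev (prj n s) ks = (if int r dvd n + sum_list ks then ev s ks else 0)"
  by (simp add: prj_def Lf_inverse)

lemma prj_linear: "prj n (s + t) = prj n s + prj n t" "prj n (cst c * s) = cst c * prj n s" "prj n 0 = 0"
  by (rule lfun_eqI, simp)+

lemma prj_fword:
  "prj n (fword \<phi> ns) = (if int r dvd n - sum_list ns then fword \<phi> ns else 0)"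
proof (rule lfun_eqI)
  fix ks
  have "ev (fword \<phi> ns) ks = 0 \<or> int r dvd sum_list ns + sum_list ks"
    using hdeg_fword[of ns] by (auto simp: hdeg_def)
  moreover have "int r dvd n + sum_list ks \<longleftrightarrow> int r dvd n - sum_list ns"
    if "int r dvd sum_list ns + sum_list ks"
  proof -
    have "n + sum_list ks = (n - sum_list ns) + (sum_list ns + sum_list ks)" by simp
    then show ?thesis using that by (metis dvd_add_left_iff)
  qed
  ultimately show "ev (prj n (fword \<phi> ns)) ks =
      ev (if int r dvd n - sum_list ns then fword \<phi> ns else 0) ks" by auto
qed

lemma prj_span: "s \<in> lf.span S \<Longrightarrow> prj n s \<in> lf.span (prj n ` S)"
proof (induction rule: lf.span_induct_alt)
  case (step c x y)
  then show ?case by (simp add: prj_linear lf.span_add lf.span_scale lf.span_base)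
qed (simp add: prj_linear lf.span_zero)

text \<open>Every f-word is either fixed or annihilated by \<open>prj n\<close>, so
  \<open>G m n\<close> is the image of the full span under this projection and may be computed from
  any other spanning set, such as the monomials.\<close>

lemma G_eq_span_prj:
  assumes "lf.span {fword \<phi> ns |ns. length ns = m} = lf.span S"
  shows "G m n = lf.span (prj n ` S)"
proof
  have "fword \<phi> ns \<in> lf.span (prj n ` S)" if "length ns = m" "int r dvd n - sum_list ns" for ns
  proof -
    have "fword \<phi> ns \<in> lf.span S" using that(1) unfolding assms[symmetric] by (intro lf.span_base) auto
    then show ?thesis using prj_span[of "fword \<phi> ns" S n] that(2) by (simp add: prj_fword)
  qed
  then show "G m n \<subseteq> lf.span (prj n ` S)"
    unfolding G_def by (intro lf.span_minimal lf.subspace_span) auto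
  have "prj n s \<in> G m n" if "s \<in> S" for s
  proof -
    have "s \<in> lf.span {fword \<phi> ns |ns. length ns = m}" unfolding assms by (rule lf.span_base[OF that])
    then have "prj n s \<in> lf.span (prj n ` {fword \<phi> ns |ns. length ns = m})" by (rule prj_span)
    also have "\<dots> \<subseteq> G m n" unfolding G_def
    proof (intro lf.span_minimal lf.subspace_span subsetI)
      fix x assume "x \<in> prj n ` {fword \<phi> ns |ns. length ns = m}"
      then obtain ns where "length ns = m" "x = prj n (fword \<phi> ns)" by auto
      then show "x \<in> lf.span {fword \<phi> ns |ns. length ns = m \<and> int r dvd n - sum_list ns}"
        by (auto simp: prj_fword lf.span_zero intro!: lf.span_base)
    qed
    finally show ?thesis .
  qed
  then show "lf.span (prj n ` S) \<subseteq> G m n"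
    unfolding G_def by (intro lf.span_minimal lf.subspace_span) auto
qed

text \<open>Fourier inversion on \<int>/r: averaging over the rotations by powers of w isolates one
  residue class of the degree.\<close>

lemma prj_twist:
  assumes w: "\<And>m. w powi m = 1 \<longleftrightarrow> int r dvd m" and wr: "w ^ r = 1"
  shows "cst (of_nat r) * prj n s = (\<Sum>j<r. cst ((w powi n) ^ j) * twist (w ^ j) s)"
proof (rule lfun_eqI)
  fix ks
  have w0: "w \<noteq> 0" using wr r_pos by (auto simp: power_0_left)
  define y where "y = w powi (n + sum_list ks)"
  have "(\<Sum>j<r. y ^ j) = (if int r dvd n + sum_list ks then of_nat r else 0)"
  proof (cases "y = 1")
    case True
    then show ?thesis using w[of "n + sum_list ks"] by (simp add: y_def)
  next
    case False
    have "y ^ r = (w ^ r) powi (n + sum_list ks)"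
      by (simp add: y_def power_int_mult[symmetric] mult.commute flip: power_int_of_nat)
    then have "y ^ r = 1" using wr by simp
    then have "(\<Sum>j<r. y ^ j) = 0" using False geometric_sum[OF False, of r] by simp
    then show ?thesis using w[of "n + sum_list ks"] False by (simp add: y_def)
  qed
  moreover have "(w powi n) ^ j * (w ^ j) powi sum_list ks = y ^ j" for j
  proof -
    have "(w ^ j) powi t = (w powi t) ^ j" for t
      by (simp add: power_int_mult[symmetric] mult.commute flip: power_int_of_nat)
    then show ?thesis using w0 by (simp add: y_def power_int_add power_mult_distrib)
  qed
  ultimately show "ev (cst (of_nat r) * prj n s) ks =
      ev (\<Sum>j<r. cst ((w powi n) ^ j) * twist (w ^ j) s) ks"
    by (simp add: mult.assoc[symmetric] sum_distrib_right[symmetric])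
qed

end

section \<open>Roots of unity and Ramanujan sums\<close>

definition primitive_root :: "'k::field \<Rightarrow> nat \<Rightarrow> bool" where
  "primitive_root x n \<longleftrightarrow> n > 0 \<and> (\<forall>k. x ^ k = 1 \<longleftrightarrow> n dvd k)"

lemma primitive_root_iff: "primitive_root x n \<Longrightarrow> x ^ k = 1 \<longleftrightarrow> n dvd k"
  unfolding primitive_root_def by blast

text \<open>The polynomial X^n - 1 splits, and a double root would also be a root of n X^(n-1),
  hence 0, which is not a root of unity.\<close>

lemma card_roots_of_unity:
  assumes "n > 0"
  shows "card {x :: 'k::{alg_closed_field, field_char_0}. x ^ n = 1} = n"
proof -
  define p where "p = Polynomial.monom 1 n - (1 :: 'k poly)"
  have cn: "coeff p n = 1" using assms by (simp add: p_def)
  have "degree p \<le> n" unfolding p_def by (intro degree_diff_le) (simp_all add: degree_monom_le)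
  then have dp: "degree p = n" using cn le_degree[of p n] by simp
  have p0: "p \<noteq> 0" using cn by auto
  obtain A where A: "size A = n" "p = (\<Prod>x\<in>#A. [:- x, 1:])"
    using alg_closed_imp_factorization[OF p0] dp cn by auto
  have root: "poly p x = 0 \<longleftrightarrow> x ^ n = 1" for x by (simp add: p_def poly_monom)
  have set_A: "x \<in># A \<longleftrightarrow> x ^ n = 1" for x
    unfolding root[symmetric] A(2) by (simp add: poly_prod_mset prod_mset_zero_iff image_iff)
  have simple: "count A x = 1" if "x \<in># A" for x
  proof (rule ccontr)
    assume "count A x \<noteq> 1"
    moreover have "count A x \<noteq> 0" using that by simp
    ultimately have "count A x > 1" by linarith
    then have "count (A - {#x#}) x > 0" by simp
    then have "x \<in># A - {#x#}" by (simp only: count_greater_zero_iff)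
    then obtain B where "A - {#x#} = add_mset x B" by (metis multi_member_split)
    then have "A = add_mset x (add_mset x B)" using insert_DiffM[OF that] by simp
    then have "p = [:- x, 1:] * ([:- x, 1:] * (\<Prod>x\<in>#B. [:- x, 1:]))" by (simp add: A(2))
    then have "poly (pderiv p) x = 0" by (simp only: pderiv_mult) simp
    moreover have "pderiv p = Polynomial.monom (of_nat n) (n - 1)"
      by (simp add: p_def pderiv_diff pderiv_monom)
    ultimately have "x ^ (n - 1) = 0" using assms by (simp add: poly_monom)
    then have "x = 0" by (metis power_eq_0_iff)
    then show False using that set_A[of x] assms by (simp add: power_0_left)
  qed
  have "{x :: 'k. x ^ n = 1} = set_mset A" using set_A by blast
  then have "card {x :: 'k. x ^ n = 1} = card (set_mset A)" by (rule arg_cong)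
  also have "\<dots> = (\<Sum>x\<in>set_mset A. count A x)" by (simp add: simple)
  also have "\<dots> = n" using A(1) by (simp add: size_multiset_overloaded_eq)
  finally show ?thesis .
qed

text \<open>Each n-th root of unity is primitive for exactly one divisor of n. Comparing the
  resulting count with the divisor sum of the totient gives, by induction, \<open>totient n\<close>
  primitive roots, a positive number.\<close>

lemma primitive_root_exists:
  assumes "n > 0"
  shows "\<exists>x :: 'k::{alg_closed_field, field_char_0}. primitive_root x n"
proof -
  have ex: "\<exists>d. d dvd n \<and> primitive_root x d" if "n > 0" "x ^ n = 1" for n and x :: 'k
  proof -
    define d where "d = (LEAST d. d > 0 \<and> x ^ d = 1)"
    have d: "d > 0" "x ^ d = 1" using LeastI[of "\<lambda>d. d > 0 \<and> x ^ d = 1" n] that by (auto simp: d_def)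
    have min: "d \<le> k" if "k > 0" "x ^ k = 1" for k
      unfolding d_def by (rule Least_le) (use that in simp)
    have "x ^ k = 1 \<longleftrightarrow> d dvd k" for k
    proof
      assume k: "x ^ k = 1"
      have "x ^ (d * (k div d) + k mod d) = x ^ (k mod d)" by (simp only: power_add power_mult d) simp
      then have "x ^ (k mod d) = 1" using k by simp
      then have "k mod d = 0" using min[of "k mod d"] d(1) by (metis mod_less_divisor not_gr0 not_le)
      then show "d dvd k" by (simp add: dvd_eq_mod_eq_0)
    next
      assume "d dvd k"
      then show "x ^ k = 1" using d(2) by (auto simp: power_mult)
    qed
    then show ?thesis using d that by (auto simp: primitive_root_def)
  qed
  have uniq: "d = d'" if "primitive_root x d" "primitive_root x d'" for d d' and x :: 'k
    using that by (metis dvd_antisym dvd_refl primitive_root_def)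
  have "card {x :: 'k. primitive_root x n} = totient n" using assms
  proof (induction n rule: less_induct)
    case (less n)
    have fin: "finite {x :: 'k. primitive_root x d}" if "d > 0" for d
    proof -
      have "{x :: 'k. primitive_root x d} \<subseteq> {x. x ^ d = 1}"
        by (intro Collect_mono impI) (simp only: primitive_root_iff dvd_refl)
      moreover have "finite {x :: 'k. x ^ d = 1}"
        by (rule card_ge_0_finite) (simp add: card_roots_of_unity[OF that] that)
      ultimately show ?thesis by (rule finite_subset)
    qed
    have "{x :: 'k. x ^ n = 1} = (\<Union>d\<in>{d. d dvd n}. {x. primitive_root x d})"
    proof (intro equalityI subsetI)
      fix x :: 'k assume "x \<in> {x. x ^ n = 1}"
      then show "x \<in> (\<Union>d\<in>{d. d dvd n}. {x. primitive_root x d})" using ex[OF less.prems, of x] by simp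
    qed (auto simp only: UN_iff mem_Collect_eq primitive_root_iff)
    then have "n = card (\<Union>d\<in>{d. d dvd n}. {x :: 'k. primitive_root x d})"
      using card_roots_of_unity[OF less.prems, where 'k = 'k] by simp
    also have "\<dots> = (\<Sum>d | d dvd n. card {x :: 'k. primitive_root x d})"
    proof (rule card_UN_disjoint)
      show "finite {d. d dvd n}" using less.prems by simp
      show "\<forall>d\<in>{d. d dvd n}. finite {x :: 'k. primitive_root x d}"
        using fin dvd_pos_nat[OF less.prems] by simp
      show "\<forall>i\<in>{d. d dvd n}. \<forall>j\<in>{d. d dvd n}. i \<noteq> j \<longrightarrow>
          {x :: 'k. primitive_root x i} \<inter> {x. primitive_root x j} = {}"
        using uniq by blast
    qed
    also have "\<dots> = card {x :: 'k. primitive_root x n} + (\<Sum>d\<in>{d. d dvd n} - {n}. card {x :: 'k. primitive_root x d})"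
      using less.prems by (subst sum.remove[of _ n]) auto
    also have "(\<Sum>d\<in>{d. d dvd n} - {n}. card {x :: 'k. primitive_root x d}) = (\<Sum>d\<in>{d. d dvd n} - {n}. totient d)"
    proof (intro sum.cong refl)
      fix d assume d: "d \<in> {d. d dvd n} - {n}"
      then have "d < n" "d > 0" using less.prems dvd_imp_le[of d n] dvd_pos_nat[of n d] by auto
      then show "card {x :: 'k. primitive_root x d} = totient d" by (rule less.IH)
    qed
    finally have "card {x :: 'k. primitive_root x n} + (\<Sum>d\<in>{d. d dvd n} - {n}. totient d) = n" ..
    moreover have "totient n + (\<Sum>d\<in>{d. d dvd n} - {n}. totient d) = n"
      using less.prems totient_divisor_sum[of n] by (subst (asm) sum.remove[of _ n]) auto
    ultimately show ?case by linarith
  qed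
  then have "{x :: 'k. primitive_root x n} \<noteq> {}" using assms by (metis card.empty totient_gt_0_iff less_irrefl)
  then show ?thesis by blast
qed

lemma primitive_root_power:
  assumes "primitive_root x m"
  shows "primitive_root (x ^ e) (m div gcd m e)"
proof -
  have m: "m > 0" "\<And>k. x ^ k = 1 \<longleftrightarrow> m dvd k" using assms by (auto simp: primitive_root_def)
  define g where "g = gcd m e"
  have g: "g > 0" "g dvd m" "g dvd e" using m(1) by (auto simp: g_def)
  then obtain m' e' where me: "m = g * m'" "e = g * e'" by (auto elim!: dvdE)
  have "coprime m' e'" using m(1) by (metis div_gcd_coprime g(1) g_def gr_implies_not0 me(1) me(2) nonzero_mult_div_cancel_left)
  then have "m dvd e * k \<longleftrightarrow> m' dvd k" for k
    using g(1) me by (simp add: mult.assoc coprime_dvd_mult_right_iff)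
  then show ?thesis
    unfolding primitive_root_def g_def[symmetric] using m g me by (simp flip: power_mult)
qed

text \<open>Representatives from 0 to d - 1, unlike \<open>totatives\<close>, where d = 1 is
  represented by 1. This matches division with remainder in the block decomposition.\<close>

definition units_below :: "nat \<Rightarrow> nat set" where
  "units_below d = {t. t < d \<and> coprime t d}"

lemma finite_units_below [simp]: "finite (units_below d)"
  by (simp add: units_below_def)

lemma sum_units_blocks:
  fixes f :: "nat \<Rightarrow> 'a::comm_monoid_add"
  assumes "e > 0"
  shows "(\<Sum>t | t < p * e \<and> coprime t e. f t) = (\<Sum>t\<in>units_below e. \<Sum>k<p. f (t + e * k))"
proof -
  have c: "coprime (t + e * k) e \<longleftrightarrow> coprime t e" for t k
    by (metis coprime_iff_gcd_eq_1 gcd.commute gcd_add_mult add.commute mult.commute)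
  have "(\<Sum>t\<in>units_below e. \<Sum>k<p. f (t + e * k)) = (\<Sum>(t, k)\<in>units_below e \<times> {..<p}. f (t + e * k))"
    by (rule sum.cartesian_product)
  also have "\<dots> = (\<Sum>t | t < p * e \<and> coprime t e. f t)"
  proof (rule sum.reindex_bij_witness[of _ "\<lambda>t. (t mod e, t div e)" "\<lambda>(t, k). t + e * k"], goal_cases)
    case (2 a)
    then obtain t k where a: "a = (t, k)" "t < e" "coprime t e" "k < p" by (auto simp: units_below_def)
    have "t + e * k < e * Suc k" using a by simp
    also have "\<dots> \<le> p * e" using a by (metis Suc_leI mult.commute mult_le_mono2)
    finally show ?case using a c by simp
  next
    case (4 b)
    then have "b div e < p" using assms by (simp add: less_mult_imp_div_less)
    then show ?case using 4 assms c[of "b mod e" "b div e"] by (auto simp: units_below_def)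
  qed (use assms in \<open>auto simp: units_below_def\<close>)
  finally show ?thesis by simp
qed

text \<open>For p dividing e the numbers prime to p e are those prime to e, taken over p consecutive
  blocks.\<close>

lemma sum_units_prime_dvd:
  fixes f :: "nat \<Rightarrow> 'a::comm_monoid_add"
  assumes "e > 0" "p dvd e"
  shows "(\<Sum>t\<in>units_below (p * e). f t) = (\<Sum>t\<in>units_below e. \<Sum>k<p. f (t + e * k))"
proof -
  have "units_below (p * e) = {t. t < p * e \<and> coprime t e}"
    using assms(2) by (auto simp: units_below_def coprime_mult_right_iff intro: coprime_divisors[OF dvd_refl assms(2)])
  then show ?thesis using sum_units_blocks[OF assms(1), where f = f and p = p] by simp
qed

text \<open>The p blocks of numbers prime to e also contain the multiples of p; these are p times
  the units modulo e and are subtracted.\<close>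

lemma sum_units_prime_not_dvd:
  fixes f :: "nat \<Rightarrow> 'a::ab_group_add"
  assumes e: "e > 0" and p: "prime p" "\<not> p dvd e"
  shows "(\<Sum>t\<in>units_below (p * e). f t) =
    (\<Sum>t\<in>units_below e. \<Sum>k<p. f (t + e * k)) - (\<Sum>t\<in>units_below e. f (p * t))"
proof -
  have pe: "coprime p e" using p by (simp add: prime_imp_coprime)
  have p0: "p > 0" using p by (simp add: prime_gt_0_nat)
  have im: "{t. t < p * e \<and> coprime t e \<and> p dvd t} = (\<lambda>t. p * t) ` units_below e"
    using pe p0 by (auto simp: units_below_def coprime_mult_left_iff elim!: dvdE)
  have ct: "coprime t p \<longleftrightarrow> \<not> p dvd t" for t
    using p(1) by (metis coprime_absorb_left coprime_commute not_prime_unit prime_imp_coprime)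
  have "{t. t < p * e \<and> coprime t e} = units_below (p * e) \<union> (\<lambda>t. p * t) ` units_below e"
    unfolding im[symmetric] by (auto simp: units_below_def coprime_mult_right_iff ct)
  moreover have "units_below (p * e) \<inter> (\<lambda>t. p * t) ` units_below e = {}"
    unfolding im[symmetric] by (auto simp: units_below_def coprime_mult_right_iff ct)
  ultimately have "(\<Sum>t | t < p * e \<and> coprime t e. f t) =
      (\<Sum>t\<in>units_below (p * e). f t) + (\<Sum>t\<in>(\<lambda>t. p * t) ` units_below e. f t)"
    by (simp add: sum.union_disjoint)
  also have "(\<Sum>t\<in>(\<lambda>t. p * t) ` units_below e. f t) = (\<Sum>t\<in>units_below e. f (p * t))"
    using p0 by (subst sum.reindex) (auto simp: inj_on_def)
  finally show ?thesis using sum_units_blocks[OF e, where f = f and p = p] by (simp add: eq_diff_eq)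
qed

lemma card_units_below: "d > 0 \<Longrightarrow> card (units_below d) = totient d"
proof (cases "d = 1")
  case True
  then have "units_below d = {0}" by (auto simp: units_below_def)
  then show ?thesis using True by simp
next
  case False
  assume d: "d > 0"
  have "units_below d = totatives d"
    using False d by (auto simp: units_below_def totatives_def le_less intro!: Nat.gr0I)
  then show ?thesis by (simp add: totient_def)
qed

lemma totient_prime_mult:
  assumes "e > 0" "prime p"
  shows "totient (p * e) = (if p dvd e then p * totient e else (p - 1) * totient e)"
proof (cases "p dvd e")
  case True
  have "card (units_below (p * e)) = p * card (units_below e)"
    using sum_units_prime_dvd[OF assms(1) True, of "\<lambda>_. 1 :: nat"] by simp
  then show ?thesis using True assms card_units_below by (simp add: prime_gt_0_nat)
next
  case False
  then have "coprime p e" using assms by (simp add: prime_imp_coprime)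
  then show ?thesis using False assms by (simp add: totient_mult_coprime totient_prime)
qed

lemma moebius_prime_mult:
  assumes "prime p" "\<not> p dvd m" "m > 0"
  shows "moebius (p * m) = - moebius m"
proof -
  have cp: "coprime p m" using assms by (simp add: prime_imp_coprime)
  have "squarefree (p * m) \<longleftrightarrow> squarefree m"
    using squarefree_mult_coprime[OF cp squarefree_prime[OF assms(1)]] squarefree_multD[of p m] by blast
  moreover have "prime_factors (p * m) = insert p (prime_factors m)"
    using assms by (simp add: prime_factors_product prime_prime_factors)
  moreover have "p \<notin> prime_factors m" using assms by auto
  ultimately show ?thesis by (simp add: moebius_def)
qed

text \<open>Induction on \<open>d\<close> by splitting off a prime factor gives the sum over the units modulo \<open>d\<close>
  directly, without multiplicativity of Ramanujan sums.\<close>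

lemma sum_units_primitive_root:
  fixes x :: "'k::field_char_0"
  assumes "d > 0" "m dvd d" "primitive_root x m"
  shows "(\<Sum>t\<in>units_below d. x ^ t) = of_nat (totient d) * of_int (moebius m) / of_nat (totient m)"
  using assms
proof (induction d arbitrary: x m rule: less_induct)
  case (less d)
  have m0: "m > 0" and xm: "\<And>k. x ^ k = 1 \<longleftrightarrow> m dvd k" using less.prems by (auto simp: primitive_root_def)
  show ?case
  proof (cases "d = 1")
    case True
    then have "m = 1" "units_below d = {0}" using less.prems by (auto simp: units_below_def)
    then show ?thesis using True by (simp add: moebius_def)
  next
    case False
    then obtain p where p: "prime p" "p dvd d" by (metis prime_factor_nat)
    then obtain e where d: "d = p * e" by (elim dvdE)
    have e: "e > 0" "e < d" using less.prems p d prime_gt_1_nat[OF p(1)] by auto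
    have p1: "(of_nat (p - 1) :: 'k) \<noteq> 0" using prime_gt_1_nat[OF p(1)] by simp
    \<comment> \<open>The inner sum is geometric in x^e, whose p-th power is x^d = 1. It is p or 0
      according to whether x^e is 1.\<close>
    have S1: "(\<Sum>t\<in>units_below e. \<Sum>k<p. x ^ (t + e * k)) =
        (if m dvd e then of_nat p * (\<Sum>t\<in>units_below e. x ^ t) else 0)"
    proof -
      have "(\<Sum>t\<in>units_below e. \<Sum>k<p. x ^ (t + e * k)) =
          (\<Sum>t\<in>units_below e. x ^ t) * (\<Sum>k<p. (x ^ e) ^ k)"
        by (simp only: power_add power_mult sum_product)
      moreover have "(\<Sum>k<p. (x ^ e) ^ k) = (if m dvd e then of_nat p else 0)"
      proof (cases "m dvd e")
        case True
        then show ?thesis using xm[of e] by simp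
      next
        case False
        have "(x ^ e) ^ p = 1" using xm[of d] less.prems(2) by (simp add: d mult.commute flip: power_mult)
        then show ?thesis using False xm[of e] geometric_sum[of "x ^ e" p] by simp
      qed
      ultimately show ?thesis by simp
    qed
    have IH: "(\<Sum>t\<in>units_below e. y ^ t) = of_nat (totient e) * of_int (moebius n) / of_nat (totient n)"
      if "n dvd e" "primitive_root y n" for y :: 'k and n
      using less.IH[OF e(2) e(1)] that by blast
    have mp: "\<exists>m1. m = p * m1 \<and> m1 dvd e" if "\<not> m dvd e"
    proof -
      have "p dvd m"
      proof (rule ccontr)
        assume "\<not> p dvd m"
        then have "coprime m p" using p(1) by (metis coprime_commute prime_imp_coprime)
        then show False using that less.prems(2) d by (simp add: coprime_dvd_mult_right_iff)
      qed
      then obtain m1 where "m = p * m1" by (elim dvdE)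
      then show ?thesis using less.prems(2) d prime_gt_0_nat[OF p(1)] by auto
    qed
    show ?thesis
    proof (cases "p dvd e")
      case True
      have T: "(\<Sum>t\<in>units_below d. x ^ t) = (if m dvd e then of_nat p * (\<Sum>t\<in>units_below e. x ^ t) else 0)"
        unfolding d sum_units_prime_dvd[OF e(1) True] by (rule S1)
      show ?thesis
      proof (cases "m dvd e")
        case m: True
        then show ?thesis using T IH[OF m less.prems(3)] True
          by (simp add: d totient_prime_mult[OF e(1) p(1)])
      next
        case m: False
        obtain m1 where m1: "m = p * m1" "m1 dvd e" using mp[OF m] by blast
        \<comment> \<open>Otherwise p and \<open>m1\<close> would be coprime divisors of e, so that
          m divides e. Hence p^2 divides m, and both sides are 0.\<close>
        have "p dvd m1"
        proof (rule ccontr)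
          assume "\<not> p dvd m1"
          then have "coprime p m1" using p(1) by (simp add: prime_imp_coprime)
          then show False using m m1 True by (simp add: divides_mult)
        qed
        then have "p ^ 2 dvd m" by (auto simp: m1 power2_eq_square)
        then have "\<not> squarefree m" using p(1) by (metis not_prime_unit squarefree_def)
        then show ?thesis using T m by (simp add: moebius_def)
      qed
    next
      case False
      have T: "(\<Sum>t\<in>units_below d. x ^ t) = (if m dvd e then of_nat p * (\<Sum>t\<in>units_below e. x ^ t) else 0)
          - (\<Sum>t\<in>units_below e. (x ^ p) ^ t)"
        unfolding d sum_units_prime_not_dvd[OF e(1) p(1) False] S1 by (simp add: power_mult)
      have td: "of_nat (totient d) = (of_nat (p - 1) * of_nat (totient e) :: 'k)"
        using False by (simp add: d totient_prime_mult[OF e(1) p(1)])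
      show ?thesis
      proof (cases "m dvd e")
        case m: True
        then have "\<not> p dvd m" using False by (metis dvd_trans)
        then have "gcd m p = 1" using p(1) by (metis coprime_iff_gcd_eq_1 coprime_commute prime_imp_coprime)
        then have "primitive_root (x ^ p) m" using primitive_root_power[OF less.prems(3), of p] by simp
        then have "(\<Sum>t\<in>units_below e. (x ^ p) ^ t) = (\<Sum>t\<in>units_below e. x ^ t)"
          using IH[OF m less.prems(3)] IH[OF m] by metis
        then have "(\<Sum>t\<in>units_below d. x ^ t) = of_nat (p - 1) * (\<Sum>t\<in>units_below e. x ^ t)"
          using T m prime_gt_1_nat[OF p(1)] by (simp add: of_nat_diff left_diff_distrib)
        then show ?thesis unfolding IH[OF m less.prems(3)] td by simp
      next
        case m: False
        obtain m1 where m1: "m = p * m1" "m1 dvd e" using mp[OF m] by blast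
        have pm1: "\<not> p dvd m1" using m1 False by (metis dvd_trans)
        have m10: "m1 > 0" using m0 m1 by auto
        \<comment> \<open>Only the subtracted sum survives. Its minus sign is the sign change of
          \<open>moebius\<close> from \<open>m1\<close> to p \<open>m1\<close>, and the factors p -
          1 of the two totients cancel.\<close>
        have "primitive_root (x ^ p) m1"
          using primitive_root_power[OF less.prems(3), of p] prime_gt_0_nat[OF p(1)] by (simp add: m1)
        then have "(\<Sum>t\<in>units_below d. x ^ t) = - (of_nat (totient e) * of_int (moebius m1) / of_nat (totient m1))"
          using T m IH[OF m1(2)] by simp
        also have "\<dots> = of_nat (totient d) * of_int (moebius m) / of_nat (totient m)"
          using p1 pm1 m10 p(1) by (simp add: td m1(1) moebius_prime_mult totient_prime_mult)
        finally show ?thesis .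
      qed
    qed
  qed
qed

lemma primitive_root_powi:
  assumes "primitive_root x r"
  shows "x powi m = 1 \<longleftrightarrow> int r dvd m"
proof (cases "m \<ge> 0")
  case True
  then show ?thesis using assms by (metis int_dvd_int_iff int_nat_eq nat_0_le power_int_of_nat primitive_root_def)
next
  case False
  then obtain k where k: "m = - int k" by (metis int_cases2 nle_le of_nat_0_le_iff)
  then show ?thesis using assms by (simp add: power_int_minus primitive_root_def)
qed

text \<open>The residues of order d modulo r are (r/d) t with t a unit modulo d, and the (r/d)-th
  power of w^n is a primitive root of order d / gcd(d, n).\<close>

lemma sum_powers_fixed_order:
  fixes w :: "'k::field_char_0"
  assumes w: "primitive_root w r" and d: "d dvd r"
  shows "(\<Sum>j | j < r \<and> r div gcd j r = d. (w powi n) ^ j) = of_rat (ramanujan_sum d n)"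
proof -
  have r: "r > 0" using w by (simp add: primitive_root_def)
  obtain q where q: "r = q * d" using d by (metis dvd_def mult.commute)
  have q0: "q > 0" "d > 0" using r q by auto
  have "{j. j < r \<and> r div gcd j r = d} = (\<lambda>t. q * t) ` units_below d"
  proof (intro equalityI subsetI)
    fix j assume "j \<in> {j. j < r \<and> r div gcd j r = d}"
    then have j: "j < r" "r div gcd j r = d" by auto
    have "gcd j r * d = r" using j(2) by (metis dvd_mult_div_cancel gcd_dvd2)
    then have g: "gcd j r = q" using q q0 by simp
    then obtain t where t: "j = q * t" by (metis dvdE gcd_dvd1)
    have "q * gcd t d = q" using g unfolding t q by (simp add: gcd_mult_distrib_nat)
    then have "coprime t d" using q0 by (simp add: coprime_iff_gcd_eq_1)
    then show "j \<in> (\<lambda>t. q * t) ` units_below d" using j t q q0 by (auto simp: units_below_def)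
  next
    fix j assume "j \<in> (\<lambda>t. q * t) ` units_below d"
    then obtain t where t: "j = q * t" "t < d" "coprime t d" by (auto simp: units_below_def)
    have "gcd j r = q" using t(3) unfolding t(1) q by (simp flip: gcd_mult_distrib_nat)
    then show "j \<in> {j. j < r \<and> r div gcd j r = d}" using t q q0 by simp
  qed
  then have "(\<Sum>j | j < r \<and> r div gcd j r = d. (w powi n) ^ j) = (\<Sum>t\<in>units_below d. (w powi n) ^ (q * t))"
    using q0 by (simp add: sum.reindex inj_on_def)
  also have "\<dots> = (\<Sum>t\<in>units_below d. ((w powi n) ^ q) ^ t)" by (simp add: power_mult)
  also have "\<dots> = of_nat (totient d) * of_int (moebius (d div nat (gcd (int d) n))) /
      of_nat (totient (d div nat (gcd (int d) n)))"
  proof (rule sum_units_primitive_root[OF q0(2)])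
    let ?g = "nat (gcd (int d) n)"
    have gd: "?g dvd d" "?g > 0" using q0
      by (simp_all add: nat_dvd_iff)
    show "d div ?g dvd d" using gd by (metis dvd_div_mult_self dvd_triv_left)
    show "primitive_root ((w powi n) ^ q) (d div ?g)"
      unfolding primitive_root_def
    proof (intro conjI allI)
      show "0 < d div ?g" using gd q0 by (metis div_greater_zero_iff dvd_imp_le)
      fix k
      have "((w powi n) ^ q) ^ k = w powi (n * (int q * int k))"
        by (simp add: power_int_mult flip: power_int_of_nat)
      then have "((w powi n) ^ q) ^ k = 1 \<longleftrightarrow> int r dvd n * (int q * int k)"
        by (simp add: primitive_root_powi[OF w])
      also have "\<dots> \<longleftrightarrow> int q * int d dvd int q * (n * int k)"
        by (simp add: q mult_ac)
      also have "\<dots> \<longleftrightarrow> int d dvd n * int k" using q0 by simp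
      also have "\<dots> \<longleftrightarrow> int (d div ?g) dvd int k"
      proof -
        define g where "g = gcd (int d) n"
        have g: "g > 0" using q0 by (simp add: g_def)
        obtain d' n' where dn: "int d = g * d'" "n = g * n'" by (metis dvdE g_def gcd_dvd1 gcd_dvd2)
        have "coprime d' n'"
        proof -
          have "g * gcd d' n' = g" using g gcd_mult_distrib_int[of g d' n'] by (simp add: dn[symmetric] g_def[symmetric])
          then show ?thesis using g by (simp add: coprime_iff_gcd_eq_1)
        qed
        then have "int d dvd n * int k \<longleftrightarrow> d' dvd int k"
          using g by (simp add: dn mult.assoc coprime_dvd_mult_right_iff)
        moreover have "int (d div ?g) = d'"
        proof -
          have "int (d div ?g) = int d div g" by (simp add: zdiv_int g_def)
          then show ?thesis using g dn(1) by simp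
        qed
        ultimately show ?thesis by simp
      qed
      also have "\<dots> \<longleftrightarrow> d div ?g dvd k" by (rule int_dvd_int_iff)
      finally show "((w powi n) ^ q) ^ k = 1 \<longleftrightarrow> d div ?g dvd k" .
    qed
  qed
  also have "\<dots> = of_rat (ramanujan_sum d n)"
    by (simp add: ramanujan_sum_def Let_def of_rat_mult of_rat_divide)
  finally show ?thesis .
qed

section \<open>Supports, degrees and the series P\<close>

text \<open>A monoid of integers containing elements of both signs is a group, and the group is
  generated by its least positive element.\<close>

lemma expoly_support_subgroup:
  assumes pos: "p \<in> add_submonoid S" "p > 0" and neg: "q \<in> add_submonoid S" "q < 0"
  shows "\<exists>r. r > 0 \<and> add_submonoid S = {int r * k |k. True}"
proof -
  let ?M = "add_submonoid S"
  have mult: "int t * x \<in> ?M" if "x \<in> ?M" for t x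
    by (induction t) (auto simp: algebra_simps intro: add_submonoid.intros that)
  have minus: "- x \<in> ?M" if x: "x \<in> ?M" for x
  proof (cases "x > 0")
    case True
    \<comment> \<open>The negative of x as a combination of q and x with the non-negative
      coefficients x and -q-1.\<close>
    have "int (nat x) * q + int (nat (- q - 1)) * x \<in> ?M"
      by (intro add_submonoid.add mult x neg)
    also have "int (nat x) * q + int (nat (- q - 1)) * x = - x"
      using True neg(2) by (simp add: algebra_simps)
    finally show ?thesis .
  next
    case False
    have "int (nat (- x)) * p + int (nat (p - 1)) * x \<in> ?M"
      by (intro add_submonoid.add mult x pos)
    also have "int (nat (- x)) * p + int (nat (p - 1)) * x = - x"
      using False pos(2) by (simp add: algebra_simps)
    finally show ?thesis .
  qed
  have zmult: "x * t \<in> ?M" if "x \<in> ?M" for x t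
  proof (cases "t \<ge> 0")
    case True
    then show ?thesis using mult[OF that, of "nat t"] by (simp add: mult.commute)
  next
    case False
    then show ?thesis using mult[OF minus[OF that], of "nat (- t)"] by (simp add: mult.commute)
  qed
  define r where "r = (LEAST r. r > 0 \<and> int r \<in> ?M)"
  have r: "r > 0" "int r \<in> ?M"
    using LeastI[of "\<lambda>r. r > 0 \<and> int r \<in> ?M" "nat p"] pos by (auto simp: r_def)
  have min: "r \<le> k" if "k > 0" "int k \<in> ?M" for k
    unfolding r_def by (rule Least_le) (use that in simp)
  have "x \<in> {int r * k |k. True}" if x: "x \<in> ?M" for x
  proof -
    have "x + int r * (- (x div int r)) \<in> ?M" by (intro add_submonoid.add x zmult r)
    then have mM: "x mod int r \<in> ?M" by (simp add: minus_mult_div_eq_mod)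
    have b: "0 \<le> x mod int r" "x mod int r < int r" using r(1) by simp_all
    have "x mod int r = 0"
    proof (rule ccontr)
      assume "x mod int r \<noteq> 0"
      then have "r \<le> nat (x mod int r)" using b mM by (intro min) auto
      then show False using b by linarith
    qed
    then have "x = int r * (x div int r)" by (metis add.right_neutral mult_div_mod_eq)
    then show ?thesis by blast
  qed
  moreover have "{int r * k |k. True} \<subseteq> ?M" using zmult[OF r(2)] by auto
  ultimately show ?thesis using r(1) by (intro exI[of _ r]) auto
qed

text \<open>Vanishing on one half-line already forces all coefficient polynomials to be zero; the
  negative half-line is reflected to the positive one, inverting the exponents.\<close>

lemma exponential_polynomial_support:
  fixes \<phi> :: "int \<Rightarrow> 'k::field_char_0"
  assumes "exponential_polynomial \<phi>" and nz: "\<phi> \<noteq> (\<lambda>m. 0)"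
  shows "\<exists>m>0. \<phi> m \<noteq> 0" "\<exists>m<0. \<phi> m \<noteq> 0"
proof -
  obtain n p c where c: "\<forall>i<n::nat. c i \<noteq> 0"
    and \<phi>: "\<phi> = (\<lambda>m. \<Sum>i<n. poly (p i) (of_int m) * EXP (c i) m)"
    using assms(1) unfolding exponential_polynomial_def by blast
  define L where "L = c ` {..<n}"
  \<comment> \<open>The exponents in \<open>exponential_polynomial\<close> may repeat, so the
    polynomials belonging to equal exponents are collected.\<close>
  define P where "P x = (\<Sum>i | i \<in> {..<n} \<and> c i = x. p i)" for x
  have finL: "finite L" and L0: "\<And>x. x \<in> L \<Longrightarrow> x \<noteq> 0" using c by (auto simp: L_def)
  have \<phi>': "\<phi> m = (\<Sum>x\<in>L. poly (P x) (of_int m) * x powi m)" for m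
  proof -
    have "\<phi> m = (\<Sum>x\<in>L. \<Sum>i | i \<in> {..<n} \<and> c i = x. poly (p i) (of_int m) * EXP (c i) m)"
      unfolding \<phi> L_def by (rule sum.image_gen) simp
    also have "\<dots> = (\<Sum>x\<in>L. poly (P x) (of_int m) * x powi m)"
      by (intro sum.cong refl) (auto simp: P_def poly_sum sum_distrib_right EXP_def intro!: sum.cong)
    finally show ?thesis .
  qed
  have Pnz: "\<not> (\<forall>x\<in>L. P x = 0)"
  proof
    assume "\<forall>x\<in>L. P x = 0"
    then have "\<phi> m = 0" for m by (simp add: \<phi>')
    then show False using nz by auto
  qed
  show "\<exists>m>0. \<phi> m \<noteq> 0"
  proof (rule ccontr)
    assume "\<not> (\<exists>m>0. \<phi> m \<noteq> 0)"
    then have *: "(\<Sum>x\<in>L. poly (P x) (of_nat k) * x ^ k) = 0" if "k \<ge> 1" for k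
      using \<phi>'[of "int k"] that by simp
    have "P x = 0" if x: "x \<in> L" for x
      by (rule exponential_polynomial_zero[where l = "\<lambda>x. x" and p = P, OF finL _ L0 * x]) simp_all
    then show False using Pnz by simp
  qed
  show "\<exists>m<0. \<phi> m \<noteq> 0"
  proof (rule ccontr)
    assume neg: "\<not> (\<exists>m<0. \<phi> m \<noteq> 0)"
    have *: "(\<Sum>x\<in>L. poly (pcompose (P x) [:0, - 1:]) (of_nat k) * inverse x ^ k) = 0" if "k \<ge> 1" for k
    proof -
      have "\<phi> (- int k) = 0" using neg that by auto
      then show ?thesis unfolding \<phi>' by (simp add: poly_pcompose power_int_minus power_inverse)
    qed
    have "pcompose (P x) [:0, - 1:] = 0" if x: "x \<in> L" for x
    proof (rule exponential_polynomial_zero[where l = inverse and p = "\<lambda>x. pcompose (P x) [:0, - 1:]"])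
      show "inj_on inverse L" by (auto simp: inj_on_def)
    qed (use finL L0 * x in auto)
    then have "\<forall>x\<in>L. P x = 0" using pcompose_eq_0[of _ "[:0, - 1 :: 'k:]"] by auto
    then show False using Pnz by simp
  qed
qed

text \<open>A positive generator of a subgroup of \<int> is unique, so the \<open>THE\<close> in
  \<open>expoly_degree\<close> denotes the generator found above.\<close>

lemma expoly_degree_props:
  fixes \<phi> :: "int \<Rightarrow> 'k::field_char_0"
  assumes "exponential_polynomial \<phi>" and "\<phi> \<noteq> (\<lambda>m. 0)"
  shows "sl2_loop \<phi> (expoly_degree \<phi>)"
proof -
  let ?S = "{m. \<phi> m \<noteq> 0}"
  obtain p q where "p > 0" "\<phi> p \<noteq> 0" "q < 0" "\<phi> q \<noteq> 0"
    using exponential_polynomial_support[OF assms] by blast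
  then have "\<exists>r. r > 0 \<and> add_submonoid ?S = {int r * k |k. True}"
    by (intro expoly_support_subgroup[of p _ q] add_submonoid.base) auto
  then obtain r where r: "r > 0 \<and> add_submonoid ?S = {int r * k |k. True}" by blast
  have "r' = r" if r': "r' > 0 \<and> add_submonoid ?S = {int r' * k |k. True}" for r'
  proof -
    have e: "int r \<in> {int r' * k |k. True}" "int r' \<in> {int r * k |k. True}"
      using r r' by (metis (mono_tags, lifting) mem_Collect_eq mult.right_neutral)+
    have "int r' dvd int r" using e(1) by (elim CollectE exE conjE) (rule dvdI)
    moreover have "int r dvd int r'" using e(2) by (elim CollectE exE conjE) (rule dvdI)
    ultimately show ?thesis by (simp add: dvd_antisym)
  qed
  then have "expoly_degree \<phi> = r" unfolding expoly_degree_def using r by (intro the_equality) blast+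
  then show ?thesis using r by unfold_locales auto
qed

section \<open>Generating series of bounded exponents\<close>

lemma fps_nth_compose_X_power:
  fixes f :: "rat fps"
  assumes "d > 0"
  shows "fps_nth (f oo fps_X ^ d) m = (if d dvd m then fps_nth f (m div d) else 0)"
proof -
  have "fps_nth (f oo fps_X ^ d) m = (\<Sum>i\<in>{0..m}. if m = d * i then fps_nth f i else 0)"
    by (simp add: fps_compose_nth power_mult[symmetric] fps_X_power_nth if_distrib[of "\<lambda>x. _ * x"] cong: if_cong)
  also have "\<dots> = (if d dvd m then fps_nth f (m div d) else 0)"
  proof (cases "d dvd m")
    case True
    then obtain k where k: "m = d * k" by (elim dvdE)
    have "k \<le> m" using assms by (simp add: k)
    have "(\<Sum>i\<in>{0..m}. if m = d * i then fps_nth f i else 0) = (\<Sum>i\<in>{0..m}. if i = k then fps_nth f k else 0)"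
      using assms by (intro sum.cong refl) (auto simp: k)
    then show ?thesis using \<open>k \<le> m\<close> assms by (simp add: k sum.delta)
  qed (auto intro!: sum.neutral)
  finally show ?thesis .
qed

definition allowed :: "'k::field_char_0 poly \<Rightarrow> nat \<Rightarrow> bool" where
  "allowed p t \<longleftrightarrow> (\<forall>k::nat. degree p = 0 \<and> coeff p 0 = of_nat k \<longrightarrow> t \<le> k)"

text \<open>The generating series for the exponent of one generator: a full geometric series, or one
  cut off after X^k at a constant node with value k.\<close>

definition allowed_fps :: "'k::field_char_0 poly \<Rightarrow> rat fps" where
  "allowed_fps p = Abs_fps (\<lambda>t. if allowed p t then 1 else 0)"

lemma const_poly_iff: "p = [:c:] \<longleftrightarrow> degree p = 0 \<and> coeff p 0 = c"
  by (metis coeff_pCons_0 degree_0_id degree_pCons_0)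

lemma allowed_fps_mult:
  "allowed_fps p * (1 - fps_X) =
    (if \<exists>k::nat. p = [:of_nat k:] then 1 - fps_X ^ ((THE k::nat. p = [:of_nat k:]) + 1) else 1)"
proof (cases "\<exists>k::nat. p = [:of_nat k:]")
  case True
  then obtain k :: nat where k: "p = [:of_nat k:]" by blast
  have the: "(THE k::nat. p = [:of_nat k:]) = k"
    by (rule the_equality) (simp_all add: k)
  have a: "allowed p t \<longleftrightarrow> t \<le> k" for t by (auto simp: allowed_def k)
  have "fps_nth (allowed_fps p * (1 - fps_X)) n = fps_nth (1 - fps_X ^ (k + 1)) n" for n
    by (cases n) (auto simp: algebra_simps allowed_fps_def a fps_X_power_nth simp del: power_Suc)
  then show ?thesis using True by (simp only: the if_True fps_eq_iff) simp
next
  case False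
  then have a: "allowed p t" for t by (auto simp: allowed_def const_poly_iff)
  have "fps_nth (allowed_fps p * (1 - fps_X)) n = fps_nth 1 n" for n
    by (cases n) (auto simp: algebra_simps allowed_fps_def a)
  then show ?thesis using False by (simp add: fps_eq_iff)
qed

text \<open>Index i owns deg a_i + 1 generators with independent exponents. Multiplying by the
  denominator turns each series into 1 or into a factor of the numerator.\<close>

lemma P_series_eq:
  assumes "finite I"
  shows "P_series I a = (\<Prod>i\<in>I. allowed_fps (a i) ^ (degree (a i) + 1))"
proof -
  let ?Q = "\<lambda>i. \<exists>k::nat. a i = [:of_nat k:]"
  let ?f = "\<lambda>i. 1 - fps_X ^ ((THE k::nat. a i = [:of_nat k:]) + 1) :: rat fps"
  have "(\<Prod>i\<in>I. allowed_fps (a i) ^ (degree (a i) + 1)) * (1 - fps_X) ^ (\<Sum>i\<in>I. degree (a i) + 1) =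
      (\<Prod>i\<in>I. (allowed_fps (a i) * (1 - fps_X)) ^ (degree (a i) + 1))"
    by (simp only: power_sum prod.distrib[symmetric] power_mult_distrib)
  \<comment> \<open>Where a factor 1 - X^(k+1) occurs, \<open>a i\<close> is constant, so the outer
    exponent is 1; elsewhere a power of 1 is taken.\<close>
  also have "\<dots> = (\<Prod>i\<in>I. if ?Q i then ?f i else 1)"
    by (intro prod.cong refl) (auto simp: allowed_fps_mult)
  also have "\<dots> = (\<Prod>i | i \<in> I \<and> ?Q i. ?f i)"
    using assms by (simp add: prod.If_cases Int_def)
  finally have "(\<Prod>i | i \<in> I \<and> ?Q i. ?f i) =
    (\<Prod>i\<in>I. allowed_fps (a i) ^ (degree (a i) + 1)) * (1 - fps_X) ^ (\<Sum>i\<in>I. degree (a i) + 1)" ..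
  moreover have "(1 - fps_X :: rat fps) ^ (\<Sum>i\<in>I. degree (a i) + 1) \<noteq> 0" by simp
  ultimately show ?thesis unfolding P_series_def by simp
qed

section \<open>Counting fixed monomials\<close>

lemma sum_mod_blocks:
  fixes f :: "nat \<Rightarrow> nat"
  assumes "g > 0"
  shows "(\<Sum>j<d * g. f (j mod g)) = d * (\<Sum>j<g. f j)"
proof -
  have "(\<Sum>j<d * g. f (j mod g)) = (\<Sum>b<d. \<Sum>j\<in>{b * g..<b * g + g}. f (j mod g))"
    by (rule sum.nat_group[symmetric])
  moreover have "(\<Sum>j\<in>{b * g..<b * g + g}. f (j mod g)) = (\<Sum>j<g. f j)" for b
  proof -
    have "(\<Sum>j\<in>{b * g..<b * g + g}. f (j mod g)) = (\<Sum>j\<in>{0..<g}. f ((j + b * g) mod g))"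
      using sum.shift_bounds_nat_ivl[of "\<lambda>j. f (j mod g)" 0 "b * g" g] by (simp add: add.commute)
    then show ?thesis by (simp add: lessThan_atLeast0)
  qed
  ultimately show ?thesis by simp
qed

text \<open>By Bezout a multiple of k is congruent to gcd(k, r) modulo r, so invariance under the
  shift by k implies invariance under the shift by the gcd. For k = 0 the gcd is r and both
  conditions are empty.\<close>

lemma periodic_reduce:
  fixes h :: "nat \<Rightarrow> 'a"
  assumes r: "r > 0" and g: "g = gcd k r"
  shows "(\<forall>j<r. h ((j + k) mod r) = h j) \<longleftrightarrow> (\<forall>j<r. h j = h (j mod g))"
proof
  assume h: "\<forall>j<r. h ((j + k) mod r) = h j"
  have g0: "g > 0" using r g by simp
  show "\<forall>j<r. h j = h (j mod g)"
  proof (cases "k = 0")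
    case True
    then show ?thesis using g by simp
  next
    case False
    then obtain t where t: "[k * t = g] (mod r)" using cong_solve_nat[of k r] g by auto
    have ht: "h ((j + k * s) mod r) = h j" if "j < r" for j s
    proof (induction s)
      case (Suc s)
      have "h ((j + k * Suc s) mod r) = h (((j + k * s) mod r + k) mod r)"
        by (simp add: mod_simps add_ac)
      also have "\<dots> = h ((j + k * s) mod r)" using h r by simp
      finally show ?case using Suc by simp
    qed (use that in simp)
    have "(j + k * t) mod r = (j + g) mod r" for j using t by (metis cong_def mod_add_right_eq)
    then have hg: "h ((j + g) mod r) = h j" if "j < r" for j using ht[OF that, of t] by simp
    have hs: "h ((j + g * s) mod r) = h j" if "j < r" for j s
    proof (induction s)
      case (Suc s)
      have "h ((j + g * Suc s) mod r) = h (((j + g * s) mod r + g) mod r)"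
        by (simp add: mod_simps add_ac)
      also have "\<dots> = h ((j + g * s) mod r)" using hg r by simp
      finally show ?case using Suc by simp
    qed (use that in simp)
    show ?thesis
    proof (intro allI impI)
      fix j assume j: "j < r"
      have "j mod g < r" using j by (meson le_less_trans mod_less_eq_dividend)
      from hs[OF this, of "j div g"] show "h j = h (j mod g)" using j by simp
    qed
  qed
next
  assume h: "\<forall>j<r. h j = h (j mod g)"
  show "\<forall>j<r. h ((j + k) mod r) = h j"
  proof (intro allI impI)
    fix j assume j: "j < r"
    have "h ((j + k) mod r) = h ((j + k) mod r mod g)" using h r by simp
    also have "(j + k) mod r mod g = j mod g"
      using g by (metis gcd_dvd1 gcd_dvd2 mod_add_eq mod_mod_cancel dvd_imp_mod_0 add.right_neutral mod_mod_trivial)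
    finally show "h ((j + k) mod r) = h j" using h j by simp
  qed
qed

lemma count_image_mset_inj_on:
  "inj_on f J \<Longrightarrow> set_mset M \<subseteq> J \<Longrightarrow> x \<in> J \<Longrightarrow> count (image_mset f M) (f x) = count M x"
  by (induction M) (auto simp: inj_on_def)

lemma funpow_image_mset:
  fixes f :: "'a \<Rightarrow> 'a"
  shows "(image_mset f ^^ k) M = image_mset (f ^^ k) M"
  by (induction k) (simp_all add: multiset.map_comp comp_def)

lemma size_eq_sum_count:
  assumes "finite J" "set_mset M \<subseteq> J"
  shows "size M = (\<Sum>x\<in>J. count M x)"
  unfolding size_multiset_overloaded_eq using assms
  by (intro sum.mono_neutral_left) (auto simp: not_in_iff)

lemma sum_pairs: "(\<Sum>b\<in>A \<times> B. f b) = (\<Sum>x\<in>A. \<Sum>y\<in>B. f (x, y))"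
  by (simp add: sum.cartesian_product)

lemma prod_pairs: "(\<Prod>b\<in>A \<times> B. f b) = (\<Prod>x\<in>A. \<Prod>y\<in>B. f (x, y))"
  by (simp add: prod.cartesian_product)

lemma sum_Sigma:
  "finite A \<Longrightarrow> (\<And>x. x \<in> A \<Longrightarrow> finite (B x)) \<Longrightarrow>
    (\<Sum>b\<in>Sigma A B. f b) = (\<Sum>x\<in>A. \<Sum>y\<in>B x. f (x, y))"
  by (subst sum.Sigma) auto

lemma prod_Sigma:
  "finite A \<Longrightarrow> (\<And>x. x \<in> A \<Longrightarrow> finite (B x)) \<Longrightarrow>
    (\<Prod>b\<in>Sigma A B. f b) = (\<Prod>x\<in>A. \<Prod>y\<in>B x. f (x, y))"
  by (subst prod.Sigma) auto

text \<open>The hypothesis of the theorem with the factor \<open>wp r\<close> already written out as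
  a sum over powers of a primitive root; \<open>lam_inj\<close> keeps the resulting nodes
  distinct.\<close>

locale cyclic_expoly = sl2_loop \<phi> r for \<phi> :: "int \<Rightarrow> 'k::field_char_0" and r :: nat +
  fixes I :: "'i set" and a :: "'i \<Rightarrow> 'k poly" and lam :: "'i \<Rightarrow> 'k" and w :: 'k
  assumes w: "primitive_root w r" and fin_I: "finite I"
    and lam_nz: "\<And>i. i \<in> I \<Longrightarrow> lam i \<noteq> 0"
    and lam_inj: "\<And>i j. i \<in> I \<Longrightarrow> j \<in> I \<Longrightarrow> (lam i / lam j) ^ r = 1 \<Longrightarrow> i = j"
    and phi_eq: "\<And>m. \<phi> m = (\<Sum>i\<in>I. \<Sum>j<r. poly (a i) (of_int m) * (w ^ j * lam i) powi m)"
begin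

lemma w_pow: "w ^ k = 1 \<longleftrightarrow> r dvd k"
  by (rule primitive_root_iff[OF w])

lemma w_nz: "w \<noteq> 0"
  using w_pow[of r] r_pos by (auto simp: power_0_left)

lemma w_mod: "w ^ (k mod r) = w ^ k"
proof -
  have "w ^ (r * (k div r) + k mod r) = w ^ (k mod r)"
    unfolding power_add using w_pow[of "r * (k div r)"] by simp
  then show ?thesis by simp
qed

definition node :: "'i \<times> nat \<Rightarrow> 'k" where
  "node b = w ^ snd b * lam (fst b)"

definition dg :: "'i \<times> nat \<Rightarrow> nat" where
  "dg b = degree (a (fst b))"

text \<open>The factorial cancels the division in \<open>chi\<close>. For c = 0 it is 1, so the
  bound in \<open>adm\<close> refers to the constant value of \<open>a i\<close> itself.\<close>

definition cf :: "'i \<times> nat \<Rightarrow> nat \<Rightarrow> 'k" where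
  "cf b c = fact c * coeff (a (fst b)) c"

sublocale expoly \<phi> "I \<times> {..<r}" node dg cf
proof
  show "finite (I \<times> {..<r})" using fin_I by simp
  show "inj_on node (I \<times> {..<r})"
  proof (rule inj_onI)
    fix b b' assume bb: "b \<in> I \<times> {..<r}" "b' \<in> I \<times> {..<r}" "node b = node b'"
    obtain i j where b: "b = (i, j)" by (cases b)
    obtain i' j' where b': "b' = (i', j')" by (cases b')
    have *: "i \<in> I" "i' \<in> I" "j \<in> {..<r}" "j' \<in> {..<r}" "node (i, j) = node (i', j')"
      using bb by (simp_all add: b b')
    have wr: "(w ^ s) ^ r = 1" for s using w_pow[of "s * r"] by (simp add: power_mult)
    \<comment> \<open>Taking r-th powers removes the root of unity and leaves the condition excluded
      by \<open>lam_inj\<close>.\<close>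
    have "(w ^ j * lam i) ^ r = (w ^ j' * lam i') ^ r" using *(5) by (simp add: node_def)
    then have "lam i ^ r = lam i' ^ r" by (simp add: power_mult_distrib wr)
    then have "(lam i / lam i') ^ r = 1" using lam_nz[OF *(2)] by (simp add: power_divide)
    then have i: "i = i'" using lam_inj * by blast
    then have wj: "w ^ j = w ^ j'" using * lam_nz by (simp add: node_def)
    have "j = j'" if "j \<le> j'" "w ^ j = w ^ j'" "j' < r" for j j'
    proof -
      have "w ^ (j' - j) = 1" using that w_nz by (simp add: power_diff)
      then have "r dvd j' - j" by (simp add: w_pow)
      then show ?thesis using that by (auto dest: dvd_imp_le)
    qed
    then have "j = j'" using wj * by (metis lessThan_iff nle_le)
    then show "b = b'" using i by (simp add: b b')
  qed
  show "node b \<noteq> 0" if "b \<in> I \<times> {..<r}" for b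
    using that lam_nz w_nz by (auto simp: node_def)
  show "cf b (dg b) \<noteq> 0" if "b \<in> I \<times> {..<r}" "0 < dg b" for b
    using that by (auto simp: cf_def dg_def)
  show "\<phi> m = (\<Sum>b\<in>I \<times> {..<r}. \<Sum>c\<le>dg b. cf b c * (node b powi m * of_int m ^ c / fact c))" for m
    unfolding phi_eq sum.cartesian_product
    by (intro sum.cong refl) (auto simp: poly_altdef sum_distrib_left mult_ac node_def dg_def cf_def)
qed

section \<open>Rotation of generators and monomials\<close>

definition rk :: "nat \<Rightarrow> ('i \<times> nat) \<times> nat \<Rightarrow> ('i \<times> nat) \<times> nat" where
  "rk k = (\<lambda>((i, j), c). ((i, (j + k) mod r), c))"

lemma J_iff: "((i, j), c) \<in> J \<longleftrightarrow> i \<in> I \<and> j < r \<and> c \<le> degree (a i)"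
  by (auto simp: J_def dg_def)

lemma rk_J: "\<beta> \<in> J \<Longrightarrow> rk k \<beta> \<in> J"
  using r_pos by (auto simp: J_def rk_def dg_def)

lemma rk_rk: "rk k (rk k' \<beta>) = rk (k + k') \<beta>"
  by (auto simp: rk_def mod_simps add_ac split: prod.splits)

lemma rk_0: "\<beta> \<in> J \<Longrightarrow> rk 0 \<beta> = \<beta>"
  by (auto simp: J_def rk_def)

lemma rk_r: "\<beta> \<in> J \<Longrightarrow> rk (r * k) \<beta> = \<beta>"
  by (auto simp: J_def rk_def)

text \<open>The inverse rotation is by \<open>r * k - k\<close>, a natural number congruent to -k
  modulo r.\<close>

lemma rk_inv: "\<beta> \<in> J \<Longrightarrow> rk (r * k - k) (rk k \<beta>) = \<beta>" "\<beta> \<in> J \<Longrightarrow> rk k (rk (r * k - k) \<beta>) = \<beta>"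
proof -
  have "k \<le> r * k" using r_pos by simp
  then have "r * k - k + k = r * k" "k + (r * k - k) = r * k" by auto
  then show "\<beta> \<in> J \<Longrightarrow> rk (r * k - k) (rk k \<beta>) = \<beta>" "\<beta> \<in> J \<Longrightarrow> rk k (rk (r * k - k) \<beta>) = \<beta>"
    by (simp_all only: rk_rk rk_r)
qed

lemma rk_inj: "inj_on (rk k) J"
  by (rule inj_onI) (metis rk_inv(1))

lemma rk_funpow: "\<beta> \<in> J \<Longrightarrow> (rk (Suc 0) ^^ k) \<beta> = rk k \<beta>"
  by (induction k) (simp_all add: rk_0 rk_rk)

lemma image_rk_funpow:
  assumes "set_mset M \<subseteq> J"
  shows "(image_mset (rk (Suc 0)) ^^ k) M = image_mset (rk k) M"
  unfolding funpow_image_mset using assms by (intro image_mset_cong) (auto simp: rk_funpow)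

lemma adm_iff: "adm M \<longleftrightarrow> set_mset M \<subseteq> J \<and>
    (\<forall>i\<in>I. \<forall>j<r. \<forall>c\<le>degree (a i). allowed (a i) (count M ((i, j), c)))"
  by (auto simp: adm_def allowed_def dg_def cf_def)

lemma count_rk:
  assumes "set_mset M \<subseteq> J" "\<beta> \<in> J"
  shows "count (image_mset (rk k) M) (rk k \<beta>) = count M \<beta>"
  by (rule count_image_mset_inj_on[OF rk_inj assms])

lemma adm_rk:
  assumes "adm M"
  shows "adm (image_mset (rk k) M)"
  unfolding adm_iff
proof (intro conjI ballI allI impI)
  have MJ: "set_mset M \<subseteq> J" using assms by (simp add: adm_def)
  then show "set_mset (image_mset (rk k) M) \<subseteq> J" using rk_J by auto
  fix i j c assume "i \<in> I" "j < r" "c \<le> degree (a i)"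
  then have b: "((i, j), c) \<in> J" by (simp add: J_iff)
  define \<beta> where "\<beta> = rk (r * k - k) ((i, j), c)"
  have \<beta>: "\<beta> \<in> J" "rk k \<beta> = ((i, j), c)" using rk_J[OF b] rk_inv(2)[OF b] by (auto simp: \<beta>_def)
  obtain j' where j': "\<beta> = ((i, j'), c)" by (simp add: \<beta>_def rk_def)
  have "count (image_mset (rk k) M) ((i, j), c) = count M ((i, j'), c)"
    using count_rk[OF MJ \<beta>(1), of k] \<beta>(2) j' by simp
  then show "allowed (a i) (count (image_mset (rk k) M) ((i, j), c))"
    using assms \<beta>(1) j' by (auto simp: adm_iff J_iff)
qed

lemma twist_X: "twist (w ^ k) (X \<beta>) = X (rk k \<beta>)"
proof (rule lfun_eqI)
  fix ks
  obtain i j c where b: "\<beta> = ((i, j), c)" by (metis surj_pair)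
  have "(w ^ k) powi n * chi \<beta> n = chi (rk k \<beta>) n" for n
    by (simp add: b chi_def rk_def node_def w_mod power_add power_int_mult_distrib mult_ac)
  then show "ev (twist (w ^ k) (X \<beta>)) ks = ev (X (rk k \<beta>)) ks"
    by (auto simp: ev_X split: list.splits)
qed

lemma twist_mon: "twist (w ^ k) (mon M) = mon (image_mset (rk k) M)"
proof (induction M)
  case empty
  have "twist z 1 = 1" for z :: 'k
    by (rule lfun_eqI) (auto simp: one_lfun.rep_eq)
  then show ?case by simp
qed (simp add: twist_mult w_nz twist_X)

lemma fixed_iff:
  assumes "set_mset M \<subseteq> J"
  shows "image_mset (rk k) M = M \<longleftrightarrow> (\<forall>\<beta>\<in>J. count M (rk k \<beta>) = count M \<beta>)"
proof
  assume "image_mset (rk k) M = M"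
  then show "\<forall>\<beta>\<in>J. count M (rk k \<beta>) = count M \<beta>" using count_rk[OF assms, of _ k] by simp
next
  assume c: "\<forall>\<beta>\<in>J. count M (rk k \<beta>) = count M \<beta>"
  show "image_mset (rk k) M = M"
  proof (rule multiset_eqI)
    fix x
    show "count (image_mset (rk k) M) x = count M x"
    proof (cases "x \<in> J")
      case True
      then have "count (image_mset (rk k) M) (rk k (rk (r * k - k) x)) = count M (rk k (rk (r * k - k) x))"
        using count_rk[OF assms rk_J[OF True]] c rk_J[OF True] by simp
      then show ?thesis by (simp add: rk_inv(2)[OF True])
    next
      case False
      then have "x \<notin># M" "x \<notin># image_mset (rk k) M" using assms rk_J by auto
      then show ?thesis by (simp only: not_in_iff)
    qed
  qed
qed

text \<open>A fixed monomial has multiplicities periodic in j with period g = gcd(k, r), so it is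
  given by g copies of the original data. Each multiplicity is repeated r/g times in the total size;
  the copies account for the power g, the repetition for the substitution Z to Z^(r/g).\<close>

lemma card_fixed:
  defines "Y m \<equiv> {M. adm M \<and> size M = m}"
  assumes g: "g = gcd k r"
  shows "of_nat (card {M \<in> Y m. image_mset (rk k) M = M}) =
    fps_nth ((P_series I a oo fps_X ^ (r div g)) ^ g) m"
proof -
  have g0: "g > 0" "g dvd r" using r_pos g by simp_all
  define d where "d = r div g"
  have d: "r = d * g" "d > 0" using g0 r_pos by (auto simp: d_def elim: dvdE)
  \<comment> \<open>One period of generators; \<open>red\<close> maps every generator to its
    representative there.\<close>
  define K where "K = (SIGMA b:I \<times> {..<g}. {..degree (a (fst b))})"
  have finK: "finite K" using fin_I by (auto simp: K_def)
  have K_iff: "((i, j), c) \<in> K \<longleftrightarrow> i \<in> I \<and> j < g \<and> c \<le> degree (a i)" for i j c by (auto simp: K_def)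
  have gr: "g \<le> r" using g0 r_pos by (simp add: dvd_imp_le)
  have KJ: "K \<subseteq> J" using gr by (auto simp: K_iff J_iff)
  define red where "red = (\<lambda>((i::'i, j), c::nat). ((i, j mod g), c))"
  have red_K: "red \<beta> \<in> K" if "\<beta> \<in> J" for \<beta> using that g0 by (auto simp: red_def J_def K_def dg_def)
  have red_id: "red \<beta> = \<beta>" if "\<beta> \<in> K" for \<beta> using that by (auto simp: red_def K_def)
  have per: "(\<forall>\<beta>\<in>J. h (rk k \<beta>) = h \<beta>) \<longleftrightarrow> (\<forall>\<beta>\<in>J. h \<beta> = h (red \<beta>))" for h :: "_ \<Rightarrow> nat"
  proof -
    have "(\<forall>\<beta>\<in>J. h (rk k \<beta>) = h \<beta>) \<longleftrightarrow>
        (\<forall>i\<in>I. \<forall>c\<le>degree (a i). \<forall>j<r. h ((i, (j + k) mod r), c) = h ((i, j), c))"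
      by (auto simp: J_def rk_def dg_def)
    also have "\<dots> \<longleftrightarrow> (\<forall>i\<in>I. \<forall>c\<le>degree (a i). \<forall>j<r. h ((i, j), c) = h ((i, j mod g), c))"
      using periodic_reduce[OF r_pos g, of "\<lambda>j. h ((_, j), _)"] by meson
    also have "\<dots> \<longleftrightarrow> (\<forall>\<beta>\<in>J. h \<beta> = h (red \<beta>))" by (auto simp: J_def red_def dg_def)
    finally show ?thesis .
  qed
  have sumJ: "(\<Sum>\<beta>\<in>J. h (red \<beta>)) = d * (\<Sum>\<beta>\<in>K. h \<beta>)" for h :: "_ \<Rightarrow> nat"
  proof -
    have "(\<Sum>\<beta>\<in>J. h (red \<beta>)) = (\<Sum>i\<in>I. \<Sum>j<r. \<Sum>c\<le>degree (a i). h ((i, j mod g), c))"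
      by (simp only: sum_J sum_pairs dg_def red_def fst_conv prod.case)
    also have "\<dots> = (\<Sum>i\<in>I. d * (\<Sum>j<g. \<Sum>c\<le>degree (a i). h ((i, j), c)))"
      by (intro sum.cong refl) (simp only: d(1), rule sum_mod_blocks[OF g0(1)])
    also have "\<dots> = d * (\<Sum>i\<in>I. \<Sum>j<g. \<Sum>c\<le>degree (a i). h ((i, j), c))"
      by (simp add: sum_distrib_left)
    also have "(\<Sum>i\<in>I. \<Sum>j<g. \<Sum>c\<le>degree (a i). h ((i, j), c)) = (\<Sum>\<beta>\<in>K. h \<beta>)"
      unfolding K_def using fin_I
      by (subst sum_Sigma) (auto simp: sum_pairs)
    finally show ?thesis .
  qed
  \<comment> \<open>The restrictions of fixed monomials to one period, of size m/d. The map
    \<open>ex\<close> repeats such a restriction periodically and inverts the restriction.\<close>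
  define Nx where "Nx = {N. set_mset N \<subseteq> K \<and> d * size N = m \<and> (\<forall>\<beta>\<in>K. allowed (a (fst (fst \<beta>))) (count N \<beta>))}"
  define ex where "ex N = (\<Sum>\<beta>\<in>J. replicate_mset (count N (red \<beta>)) \<beta>)" for N
  have cex: "count (ex N) \<beta> = (if \<beta> \<in> J then count N (red \<beta>) else 0)" for N \<beta>
    using fin_J by (simp add: ex_def count_sum sum.delta)
  have sex: "set_mset (ex N) \<subseteq> J" for N
  proof
    fix x assume "x \<in># ex N"
    then have "count (ex N) x \<noteq> 0" by simp
    then show "x \<in> J" by (auto simp: cex split: if_splits)
  qed
  let ?F = "{M \<in> Y m. image_mset (rk k) M = M}"
  have F_iff: "M \<in> ?F \<longleftrightarrow> adm M \<and> size M = m \<and> (\<forall>\<beta>\<in>J. count M \<beta> = count M (red \<beta>))" for M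
    unfolding Y_def using fixed_iff[of M k] per[of "count M"] by (auto simp: adm_def)
  have "bij_betw (filter_mset (\<lambda>\<beta>. \<beta> \<in> K)) ?F Nx"
  proof (rule bij_betw_byWitness[where f' = ex])
    show "\<forall>M\<in>?F. ex (filter_mset (\<lambda>\<beta>. \<beta> \<in> K) M) = M"
    proof
      fix M assume "M \<in> ?F"
      then have M: "adm M" "\<forall>\<beta>\<in>J. count M \<beta> = count M (red \<beta>)" unfolding F_iff by auto
      show "ex (filter_mset (\<lambda>\<beta>. \<beta> \<in> K) M) = M"
      proof (rule multiset_eqI)
        fix x
        have "count M x = 0" if "x \<notin> J" using that M(1) by (auto simp: adm_def not_in_iff[symmetric])
        then show "count (ex (filter_mset (\<lambda>\<beta>. \<beta> \<in> K) M)) x = count M x"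
          using M(2) red_K by (simp add: cex)
      qed
    qed
    show "\<forall>N\<in>Nx. filter_mset (\<lambda>\<beta>. \<beta> \<in> K) (ex N) = N"
    proof
      fix N assume "N \<in> Nx"
      then have N: "set_mset N \<subseteq> K" by (simp add: Nx_def)
      show "filter_mset (\<lambda>\<beta>. \<beta> \<in> K) (ex N) = N"
      proof (rule multiset_eqI)
        fix x
        have "count N x = 0" if "x \<notin> K" using that N by (auto simp: not_in_iff[symmetric])
        then show "count (filter_mset (\<lambda>\<beta>. \<beta> \<in> K) (ex N)) x = count N x"
          using KJ red_id[of x] by (auto simp: cex)
      qed
    qed
    show "filter_mset (\<lambda>\<beta>. \<beta> \<in> K) ` ?F \<subseteq> Nx"
    proof
      fix N assume "N \<in> filter_mset (\<lambda>\<beta>. \<beta> \<in> K) ` ?F"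
      then obtain M where N: "N = filter_mset (\<lambda>\<beta>. \<beta> \<in> K) M" and M: "M \<in> ?F" by blast
      have M: "adm M" "size M = m" "\<forall>\<beta>\<in>J. count M \<beta> = count M (red \<beta>)" using M unfolding F_iff by auto
      have NK: "set_mset N \<subseteq> K" by (auto simp: N)
      have cN: "count N \<beta> = count M \<beta>" if "\<beta> \<in> K" for \<beta> using that by (simp add: N)
      have MJ: "set_mset M \<subseteq> J" using M(1) by (simp add: adm_def)
      have "size M = (\<Sum>\<beta>\<in>J. count M (red \<beta>))"
        unfolding size_eq_sum_count[OF fin_J MJ] using M(3) by (intro sum.cong) auto
      also have "\<dots> = d * size N"
        unfolding sumJ size_eq_sum_count[OF finK NK] using cN by simp
      finally have "d * size N = m" using M(2) by simp
      moreover have "allowed (a (fst (fst \<beta>))) (count N \<beta>)" if "\<beta> \<in> K" for \<beta>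
        using M(1) that KJ gr cN[OF that] by (cases \<beta>) (auto simp: adm_iff K_def)
      ultimately show "N \<in> Nx" using NK by (simp add: Nx_def)
    qed
    show "ex ` Nx \<subseteq> ?F"
    proof
      fix M assume "M \<in> ex ` Nx"
      then obtain N where M: "M = ex N" and N: "set_mset N \<subseteq> K" "d * size N = m"
        "\<forall>\<beta>\<in>K. allowed (a (fst (fst \<beta>))) (count N \<beta>)" by (auto simp: Nx_def)
      have "size M = (\<Sum>\<beta>\<in>J. count N (red \<beta>))"
        unfolding M size_eq_sum_count[OF fin_J sex] by (intro sum.cong) (auto simp: cex)
      also have "\<dots> = m" using sumJ[of "count N"] size_eq_sum_count[OF finK N(1)] N(2) by simp
      finally have "size M = m" .
      moreover have "adm M" unfolding adm_iff M
      proof (intro conjI sex ballI allI impI)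
        fix i j c assume ij: "i \<in> I" "j < r" "c \<le> degree (a i)"
        then have "((i, j), c) \<in> J" by (simp add: J_iff)
        then show "allowed (a i) (count (ex N) ((i, j), c))"
          using N(3) red_K[of "((i, j), c)"] by (auto simp: cex red_def)
      qed
      moreover have "count M \<beta> = count M (red \<beta>)" if "\<beta> \<in> J" for \<beta>
        using that red_K[OF that] KJ red_id by (auto simp: M cex)
      ultimately show "M \<in> ?F" unfolding F_iff by simp
    qed
  qed
  then have "card ?F = card Nx" by (rule bij_betw_same_card)
  moreover have "of_nat (card Nx) = fps_nth ((P_series I a oo fps_X ^ d) ^ g) m"
  proof -
    \<comment> \<open>One factor for each generator of a period, so coefficients of the product
      count admissible multisets on \<open>K\<close>.\<close>
    have "P_series I a ^ g = (\<Prod>\<beta>\<in>K. allowed_fps (a (fst (fst \<beta>))))"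
    proof -
      have "(\<Prod>\<beta>\<in>K. allowed_fps (a (fst (fst \<beta>)))) = (\<Prod>i\<in>I. \<Prod>j<g. \<Prod>c\<le>degree (a i). allowed_fps (a i))"
        unfolding K_def using fin_I
        by (subst prod_Sigma) (auto simp: prod_pairs)
      also have "\<dots> = (\<Prod>i\<in>I. (allowed_fps (a i) ^ (degree (a i) + 1)) ^ g)"
        by simp
      also have "\<dots> = (\<Prod>i\<in>I. allowed_fps (a i) ^ (degree (a i) + 1)) ^ g"
        by (simp only: prod_power_distrib)
      finally show ?thesis by (simp add: P_series_eq[OF fin_I])
    qed
    then have "fps_nth ((P_series I a oo fps_X ^ d) ^ g) m =
      (if d dvd m then fps_nth (\<Prod>\<beta>\<in>K. allowed_fps (a (fst (fst \<beta>)))) (m div d) else 0)"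
      using d(2) by (simp add: fps_compose_power fps_nth_compose_X_power)
    also have "\<dots> = of_nat (card Nx)"
    proof (cases "d dvd m")
      case True
      have "fps_nth (\<Prod>\<beta>\<in>K. allowed_fps (a (fst (fst \<beta>)))) (m div d) =
          (\<Sum>N\<in>multisets_of_size K (m div d). \<Prod>\<beta>\<in>K. if allowed (a (fst (fst \<beta>))) (count N \<beta>) then 1 else 0)"
        unfolding fps_prod_nth'[OF finK] by (simp add: allowed_fps_def)
      also have "\<dots> = (\<Sum>N\<in>multisets_of_size K (m div d).
          if \<forall>\<beta>\<in>K. allowed (a (fst (fst \<beta>))) (count N \<beta>) then 1 else 0)"
        using finK by (intro sum.cong refl) (auto simp: prod_zero_iff)
      also have "\<dots> = of_nat (card {N \<in> multisets_of_size K (m div d). \<forall>\<beta>\<in>K. allowed (a (fst (fst \<beta>))) (count N \<beta>)})"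
        using finite_multisets_of_size[OF finK] by (simp add: sum.If_cases Int_def)
      also have "{N \<in> multisets_of_size K (m div d). \<forall>\<beta>\<in>K. allowed (a (fst (fst \<beta>))) (count N \<beta>)} = Nx"
        using True d(2) by (auto simp: Nx_def multisets_of_size_def)
      finally show ?thesis using True by simp
    next
      case False
      then have "Nx = {}" by (auto simp: Nx_def)
      then show ?thesis using False by simp
    qed
    finally show ?thesis ..
  qed
  ultimately show ?thesis by (simp add: d_def)
qed

text \<open>The rotations of a monomial, weighted by powers of w^n, add up to r times its projection
  to degree n. So \<open>G m n\<close> is an isotypic component of the permutation module on
  admissible monomials of size m, and its dimension is a weighted count of fixed points.\<close>

lemma G_dim:
  "\<exists>B. finite B \<and> \<not> lf.dependent B \<and> lf.span B = G m n \<and>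
    of_nat r * of_nat (card B) = (\<Sum>d | d dvd r. ramanujan_sum d n *
       fps_nth ((P_series I a oo fps_X ^ d) ^ (r div d)) m)"
proof -
  define Y where "Y = {M. adm M \<and> size M = m}"
  define z where "z = w powi n"
  let ?p = "image_mset (rk (Suc 0))"
  define u where "u M = (\<Sum>j<r. cst (z ^ j) * mon ((?p ^^ j) M))" for M
  have YJ: "set_mset M \<subseteq> J" if "M \<in> Y" for M using that by (simp add: Y_def adm_def)
  have finY: "finite Y"
    by (rule finite_subset[OF _ finite_multisets_of_size[OF fin_J, of m]])
      (auto simp: Y_def adm_def multisets_of_size_def)
  have wp: "w powi k = 1 \<longleftrightarrow> int r dvd k" for k by (rule primitive_root_powi[OF w])
  have wr: "w ^ r = 1" by (simp add: w_pow)
  have "\<exists>B. finite B \<and> \<not> lf.dependent B \<and> lf.span B = lf.span (u ` Y) \<and>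
    of_nat r * of_nat (card B) = (\<Sum>j<r. z ^ j * of_nat (card {M \<in> Y. (?p ^^ j) M = M}))"
  proof (rule cyclic_span_dim[OF vector_space_cst finY])
    show "\<forall>M\<in>Y. c M = 0" if "(\<Sum>M\<in>Y. cst (c M) * mon M) = 0" for c
      using mon_independent[OF finY _ that] YJ by blast
    show "?p M \<in> Y" if "M \<in> Y" for M using that adm_rk by (simp add: Y_def)
    show "(?p ^^ r) M = M" if "M \<in> Y" for M
    proof -
      have "image_mset (rk r) M = image_mset (\<lambda>x. x) M"
        using YJ[OF that] rk_r[of _ 1] by (intro image_mset_cong) auto
      then show ?thesis by (simp add: image_rk_funpow[OF YJ[OF that]])
    qed
    show "r > 0" by (rule r_pos)
    show "z ^ r = 1" using wp[of "n * int r"] by (simp add: z_def power_int_mult flip: power_int_of_nat)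
    show "u M = (\<Sum>j<r. cst (z ^ j) * mon ((?p ^^ j) M))" for M by (rule u_def)
  qed
  then obtain B where B: "finite B" "\<not> lf.dependent B" "lf.span B = lf.span (u ` Y)"
    "of_nat r * of_nat (card B) = (\<Sum>j<r. z ^ j * of_nat (card {M \<in> Y. (?p ^^ j) M = M}))"
    by (elim exE conjE) (rule that)
  \<comment> \<open>The rotation \<open>twist (w ^ j)\<close> permutes monomials, so the averaging
    formula for \<open>prj\<close> is the isotypic sum.\<close>
  have uY: "u M = cst (of_nat r) * prj n (mon M)" if "M \<in> Y" for M
    unfolding prj_twist[OF wp wr] u_def
    by (intro sum.cong refl) (simp add: twist_mon image_rk_funpow[OF YJ[OF that]] z_def)
  have "lf.span (u ` Y) = lf.span (prj n ` mon ` Y)"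
  proof
    have "u M \<in> lf.span (prj n ` mon ` Y)" if "M \<in> Y" for M
      unfolding uY[OF that] by (intro lf.span_scale lf.span_base imageI that)
    then show "lf.span (u ` Y) \<subseteq> lf.span (prj n ` mon ` Y)"
      by (intro lf.span_minimal lf.subspace_span) auto
    have "prj n (mon M) \<in> lf.span (u ` Y)" if "M \<in> Y" for M
    proof -
      have "prj n (mon M) = cst (inverse (of_nat r)) * u M"
        using r_pos by (simp add: uY[OF that])
      then show ?thesis using that by (auto intro: lf.span_scale lf.span_base)
    qed
    then show "lf.span (prj n ` mon ` Y) \<subseteq> lf.span (u ` Y)"
      by (intro lf.span_minimal lf.subspace_span) auto
  qed
  also have "\<dots> = G m n"
    by (rule G_eq_span_prj[symmetric]) (use Gm_eq[of m] in \<open>simp add: Gm_def Y_def\<close>)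
  finally have BG: "lf.span B = G m n" using B(3) by simp
  let ?c = "\<lambda>d. fps_nth ((P_series I a oo fps_X ^ d) ^ (r div d)) m"
  have "(\<Sum>j<r. z ^ j * of_nat (card {M \<in> Y. (?p ^^ j) M = M})) = (\<Sum>j<r. z ^ j * of_rat (?c (r div gcd j r)))"
  proof (intro sum.cong refl arg_cong2[where f = "(*)"])
    fix j
    have "{M \<in> Y. (?p ^^ j) M = M} = {M \<in> Y. image_mset (rk j) M = M}"
      using image_rk_funpow YJ by auto
    moreover have "of_nat (card {M \<in> Y. image_mset (rk j) M = M}) = ?c (r div gcd j r)"
    proof -
      obtain q where q: "r = gcd j r * q" by (metis dvdE gcd_dvd2)
      then have "q > 0" using r_pos by (cases q) auto
      moreover have "r div gcd j r = q" using q r_pos by (metis gcd_pos_nat nonzero_mult_div_cancel_left less_irrefl)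
      ultimately have "r div (r div gcd j r) = gcd j r" using q by (metis nonzero_mult_div_cancel_right less_irrefl)
      then show ?thesis using card_fixed[of "gcd j r" j m] by (simp only: Y_def)
    qed
    ultimately have "of_rat (of_nat (card {M \<in> Y. (?p ^^ j) M = M})) = (of_rat (?c (r div gcd j r)) :: 'k)"
      by simp
    then show "of_nat (card {M \<in> Y. (?p ^^ j) M = M}) = (of_rat (?c (r div gcd j r)) :: 'k)"
      by simp
  qed
  \<comment> \<open>The fixed-point count depends on j through its order
    \<open>r div gcd j r\<close> alone; the remaining sums of powers are Ramanujan sums.\<close>
  also have "\<dots> = (\<Sum>d | d dvd r. \<Sum>j | j \<in> {..<r} \<and> r div gcd j r = d. z ^ j * of_rat (?c (r div gcd j r)))"
    by (rule sum.group[symmetric]) (use r_pos in \<open>auto simp: div_dvd_iff_mult\<close>)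
  also have "\<dots> = (\<Sum>d | d dvd r. of_rat (ramanujan_sum d n) * of_rat (?c d))"
  proof (intro sum.cong refl)
    fix d assume "d \<in> {d. d dvd r}"
    then have d: "d dvd r" by simp
    have "(\<Sum>j | j \<in> {..<r} \<and> r div gcd j r = d. z ^ j * of_rat (?c (r div gcd j r))) =
        (\<Sum>j | j < r \<and> r div gcd j r = d. z ^ j) * of_rat (?c d)"
      unfolding sum_distrib_right by (intro sum.cong) auto
    then show "(\<Sum>j | j \<in> {..<r} \<and> r div gcd j r = d. z ^ j * of_rat (?c (r div gcd j r))) =
        (of_rat (ramanujan_sum d n) * of_rat (?c d) :: 'k)"
      using sum_powers_fixed_order[OF w d, of n] by (simp add: z_def)
  qed
  also have "\<dots> = of_rat (\<Sum>d | d dvd r. ramanujan_sum d n * ?c d)"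
    by (simp add: of_rat_sum of_rat_mult)
  \<comment> \<open>The character sums live in the field, the formula in the rationals; injectivity
    of \<open>of_rat\<close> in characteristic zero carries the identity back.\<close>
  finally have "of_rat (of_nat r * of_nat (card B)) = (of_rat (\<Sum>d | d dvd r. ramanujan_sum d n * ?c d) :: 'k)"
    using B(4) by (simp add: of_rat_mult)
  then have "of_nat r * of_nat (card B) = (\<Sum>d | d dvd r. ramanujan_sum d n * ?c d)"
    by (simp only: of_rat_eq_iff)
  then show ?thesis using B(1,2) BG by blast
qed

end

section \<open>The character\<close>

theorem theorem6p10:
  fixes \<phi> :: "int \<Rightarrow> 'k::{alg_closed_field, field_char_0}"
    and r :: nat and I :: "'i set" and a :: "'i \<Rightarrow> 'k poly" and lam :: "'i \<Rightarrow> 'k"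
  assumes "exponential_polynomial \<phi>"
    and "\<phi> \<noteq> (\<lambda>m. 0)"
    and "r = expoly_degree \<phi>"
    and "finite I"
    and "\<And>i. i \<in> I \<Longrightarrow> lam i \<noteq> 0"
    and "inj_on lam I"
    and "\<And>i j. i \<in> I \<Longrightarrow> j \<in> I \<Longrightarrow> (lam i / lam j) ^ r = 1 \<Longrightarrow> i = j"
    and "\<phi> = (\<lambda>m. wp r m * (\<Sum>i\<in>I. poly (a i) (of_int m) * EXP (lam i) m))"
  shows "irreducible_module (N_module \<phi>)
    \<and> weight_module (N_module \<phi>)
    \<and> finite_weight_spaces (N_module \<phi>)
    \<and> character (N_module \<phi>) =
        formal_sum
          (\<lambda>(n::int, m::nat).
             wscale (\<phi> 0 / 2) \<alpha>_wt + wscale (- of_nat m) \<alpha>_wt + wscale (of_int n) \<delta>_wt)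
          (\<lambda>(n, m). 1 / of_nat r *
             (\<Sum>d | d dvd r. ramanujan_sum d n *
                fps_nth ((P_series I a oo fps_X ^ d) ^ (r div d)) m))"
proof -
  interpret sl2_loop \<phi> r unfolding assms(3) by (rule expoly_degree_props[OF assms(1,2)])
  obtain w :: 'k where w: "primitive_root w r" using primitive_root_exists[OF r_pos] by blast
  note wp_iff = primitive_root_iff[OF w]
  have w0: "w \<noteq> 0" using wp_iff[of r] r_pos by (auto simp: power_0_left)
  have inj: "inj_on (\<lambda>j. w ^ j) {..<r}"
  proof (rule inj_onI)
    have "j = j'" if "j \<le> j'" "w ^ j = w ^ j'" "j' < r" for j j'
    proof -
      have "w ^ (j' - j) = 1" using that w0 by (simp add: power_diff)
      then have "r dvd j' - j" by (simp add: wp_iff)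
      then show ?thesis using that by (auto dest: dvd_imp_le)
    qed
    then show "x = y" if "x \<in> {..<r}" "y \<in> {..<r}" "w ^ x = w ^ y" for x y
      using that by (metis lessThan_iff nle_le)
  qed
  \<comment> \<open>The powers of w below r are r distinct roots of unity, and there are exactly r
    of them.\<close>
  have roots: "{x. x ^ r = 1} = (\<lambda>j. w ^ j) ` {..<r}"
  proof (rule card_subset_eq[symmetric])
    show "finite {x :: 'k. x ^ r = 1}"
      by (rule card_ge_0_finite) (simp add: card_roots_of_unity[OF r_pos] r_pos)
    show "(\<lambda>j. w ^ j) ` {..<r} \<subseteq> {x. x ^ r = 1}"
      using wp_iff by (auto simp flip: power_mult)
    show "card ((\<lambda>j. w ^ j) ` {..<r}) = card {x :: 'k. x ^ r = 1}"
      by (simp add: card_image[OF inj] card_roots_of_unity[OF r_pos])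
  qed
  have phi_eq: "\<phi> m = (\<Sum>i\<in>I. \<Sum>j<r. poly (a i) (of_int m) * (w ^ j * lam i) powi m)" for m
  proof -
    have "wp r m = (\<Sum>j<r. (w ^ j) powi m)"
      unfolding wp_def roots by (simp add: sum.reindex[OF inj] EXP_def)
    then have "\<phi> m = (\<Sum>j<r. (w ^ j) powi m) * (\<Sum>i\<in>I. poly (a i) (of_int m) * lam i powi m)"
      using assms(8) by (simp add: EXP_def)
    also have "\<dots> = (\<Sum>j<r. \<Sum>i\<in>I. poly (a i) (of_int m) * (w ^ j * lam i) powi m)"
      by (simp add: sum_product power_int_mult_distrib mult_ac)
    also have "\<dots> = (\<Sum>i\<in>I. \<Sum>j<r. poly (a i) (of_int m) * (w ^ j * lam i) powi m)"
      by (rule sum.swap)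
    finally show ?thesis .
  qed
  interpret cyclic_expoly \<phi> r I a lam w
    by unfold_locales (use w assms(4,5,7) phi_eq in auto)
  obtain p where p: "epi (tensor_module \<phi>) (N_module \<phi>) p"
    "{u \<in> carrier (tensor_module \<phi>). p u = \<zero>\<^bsub>N_module \<phi>\<^esub>} = Z"
    using N_module_epi by blast
  let ?rhs = "\<lambda>n m. 1 / of_nat r * (\<Sum>d | d dvd r. ramanujan_sum d n *
                fps_nth ((P_series I a oo fps_X ^ d) ^ (r div d)) m)"
  let ?w = "\<lambda>(n::int, m::nat). wscale (\<phi> 0 / 2) \<alpha>_wt + wscale (- of_nat m) \<alpha>_wt + wscale (of_int n) \<delta>_wt"
  have wt_eq: "?w (n, m) = wt m n" for n m
    by (simp add: wscale_def \<alpha>_wt_def \<delta>_wt_def wt_def plus_prod_def)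
  have dims: "vectorspace.fin_dim class_ring (N_module \<phi>\<lparr>carrier := weight_space (N_module \<phi>) (wt m n)\<rparr>)"
    "character (N_module \<phi>) (wt m n) = ?rhs n m" for m n
  proof -
    obtain B where B: "finite B" "\<not> lf.dependent B" "lf.span B = G m n"
      "of_nat r * of_nat (card B) = (\<Sum>d | d dvd r. ramanujan_sum d n *
         fps_nth ((P_series I a oo fps_X ^ d) ^ (r div d)) m)"
      using G_dim[of m n] by (elim exE conjE) (rule that)
    show "vectorspace.fin_dim class_ring (N_module \<phi>\<lparr>carrier := weight_space (N_module \<phi>) (wt m n)\<rparr>)"
      by (rule weight_space_dim(1)[OF p B(1-3)])
    have "(of_nat (card B) :: rat) = ?rhs n m" using r_pos by (simp add: B(4)[symmetric])
    then show "character (N_module \<phi>) (wt m n) = ?rhs n m"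
      unfolding character_def weight_space_dim(2)[OF p B(1-3)] .
  qed
  have "finite_weight_spaces (N_module \<phi>)"
    unfolding finite_weight_spaces_def
  proof
    fix \<chi>
    show "vectorspace.fin_dim class_ring (N_module \<phi>\<lparr>carrier := weight_space (N_module \<phi>) \<chi>\<rparr>)"
    proof (cases "\<exists>m n. \<chi> = wt m n")
      case True
      then show ?thesis using dims(1) by auto
    next
      case False
      then show ?thesis using weight_space_trivial(1)[OF p] by blast
    qed
  qed
  moreover have "character (N_module \<phi>) = formal_sum ?w (\<lambda>(n, m). ?rhs n m)"
  proof
    fix \<chi>
    show "character (N_module \<phi>) \<chi> = formal_sum ?w (\<lambda>(n, m). ?rhs n m) \<chi>"
    proof (cases "\<exists>m n. \<chi> = wt m n")
      case True
      then obtain m n where \<chi>: "\<chi> = wt m n" by blast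
      \<comment> \<open>Depth and degree are determined by the weight, so the formal sum has one
        term at \<open>\<chi>\<close>.\<close>
      have "{x. ?w x = \<chi>} = {(n, m)}"
      proof (intro equalityI subsetI)
        fix x assume "x \<in> {x. ?w x = \<chi>}"
        then show "x \<in> {(n, m)}" using wt_eq wt_inj \<chi> by (cases x) (simp only: mem_Collect_eq, simp)
      next
        fix x assume "x \<in> {(n, m)}"
        then show "x \<in> {x. ?w x = \<chi>}" using wt_eq[of n m] \<chi> by (simp only: singleton_iff mem_Collect_eq)
      qed
      then show ?thesis using dims(2)[of m n] by (simp only: formal_sum_def \<chi>) simp
    next
      case False
      have "?w x \<noteq> \<chi>" for x
      proof
        assume "?w x = \<chi>"
        then have "?w (fst x, snd x) = \<chi>" by simp
        then show "False" using False unfolding wt_eq by blast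
      qed
      then have "{x. ?w x = \<chi>} = {}" by blast
      moreover have "character (N_module \<phi>) \<chi> = 0"
        using weight_space_trivial(2)[OF p, of \<chi>] False by (simp add: character_def)
      ultimately show ?thesis by (simp only: formal_sum_def sum.empty)
    qed
  qed
  ultimately show ?thesis using N_module_irreducible weight_module_N[OF p] by blast
qed

end
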